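(* Let $0<\gamma<1$. Let $(X_i)_{i\ge0}$ be a stationary Markov chain with invariant measure $\nu_\gamma$ and transition kernel $K_\gamma$, and let $\alpha_k(n)$, $\beta_k(n)$ be its dependence coefficients. There exist positive constants $C_1(\gamma)$ and $C_2(\delta,\gamma,k)$ such that, for any $\delta\in\,]0,(1-\gamma)/\gamma[$, any positive integer $k$ and any non-negative integer $n$, $$C_1(\gamma)(n+1)^{\frac{\gamma-1}{\gamma}}\le\alpha_k(n)\le\beta_k(n)\le C_2(\delta,\gamma,k)(n+1)^{\frac{\gamma-1}{\gamma}+\delta}.$$
   Context: For $\gamma\in\,]0,1[$, the map $T_\gamma:[0,1]\to[0,1]$ is $T_\gamma(x)=x(1+2^\gamma x^\gamma)$ if $x\in[0,1/2[$ and $T_\gamma(x)=2x-1$ if $x\in[1/2,1]$. $\nu_\gamma$ is its unique absolutely continuous invariant probability measure on $[0,1]$. For a measure $\mu$ and a function $f$, $\mu(f)=\int f\,d\mu$. $K_\gamma$ is the Perron-Frobenius operator of $T_\gamma$ with respect to $\nu_\gamma$, defined by $\nu_\gamma(f\cdot g\circ T_\gamma)=\nu_\gamma(K_\gamma(f)\,g)$ for all bounded measurable $f,g$; it is realized as a Markov kernel with invariant measure $\nu_\gamma$. For a Markov kernel $K$ with invariant measure $\mu$, non-negative integers $n_1,\dots,n_k$ and bounded measurable functions $f_1,\dots,f_k$, set $$K^{(n_1,\dots,n_k)}(f_1,\dots,f_k)=K^{n_1}(f_1K^{n_2}(f_2K^{n_3}(f_3\cdots K^{n_{k-1}}(f_{k-1}K^{n_k}(f_k))\cdots))),$$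 $$K^{(0)(n_1,\dots,n_k)}(f_1,\dots,f_k)=K^{(n_1,\dots,n_k)}(f_1,\dots,f_k)-\mu\big(K^{(n_1,\dots,n_k)}(f_1,\dots,f_k)\big).$$ Let $f_t(x)=\mathbf 1_{x\le t}$. For a stationary Markov chain with invariant measure $\mu$ and transition kernel $K$, define $$\alpha_1(n)=\sup_{t\in\mathbb R}\mu(|K^n(f_t)-\mu(f_t)|),\qquad \beta_1(n)=\mu\Big(\sup_{t\in\mathbb R}|K^n(f_t)-\mu(f_t)|\Big),$$ and for $k\ge2$ $$\alpha_k(n)=\alpha_1(n)\vee\sup_{2\le l\le k}\ \sup_{n_2\ge1,\dots,n_l\ge1}\ \sup_{t_1,\dots,t_l\in\mathbb R}\mu\big(|K^{(0)(n,n_2,\dots,n_l)}(f_{t_1},\dots,f_{t_l})|\big),$$ $$\beta_k(n)=\beta_1(n)\vee\sup_{2\le l\le k}\ \sup_{n_2\ge1,\dots,n_l\ge1}\mu\Big(\sup_{t_1,\dots,t_l\in\mathbb R}|K^{(0)(n,n_2,\dots,n_l)}(f_{t_1},\dots,f_{t_l})|\Big).$$ *)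

theory Defs
  imports "HOL-Probability.Probability"
begin

definition lsv_map :: "real \<Rightarrow> real \<Rightarrow> real" where
  "lsv_map \<gamma> x = (if x < 1/2 then x * (1 + 2 powr \<gamma> * x powr \<gamma>) else 2 * x - 1)"

definition unit_borel :: "real measure" where
  "unit_borel = restrict_space borel {0..1}"

definition lsv_acim :: "real \<Rightarrow> real measure \<Rightarrow> bool" where
  "lsv_acim \<gamma> \<nu> \<longleftrightarrow>
     prob_space \<nu> \<and> sets \<nu> = sets unit_borel \<and>
     absolutely_continuous (restrict_space lborel {0..1}) \<nu> \<and>
     distr \<nu> unit_borel (lsv_map \<gamma>) = \<nu>"

text \<open>The measure \<open>\<mu>\<close> also serves as the measurable state space: a kernel on it is a measurable map
  into the probability measures on the same sigma-algebra.\<close>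

definition invariant_markov_kernel :: "'a measure \<Rightarrow> ('a \<Rightarrow> 'a measure) \<Rightarrow> bool" where
  "invariant_markov_kernel \<mu> K \<longleftrightarrow>
     prob_space \<mu> \<and> K \<in> \<mu> \<rightarrow>\<^sub>M prob_algebra \<mu> \<and> \<mu> \<bind> K = \<mu>"

definition kernel_op :: "('a \<Rightarrow> 'a measure) \<Rightarrow> ('a \<Rightarrow> real) \<Rightarrow> 'a \<Rightarrow> real" where
  "kernel_op K f x = (\<integral>y. f y \<partial>K x)"

definition bounded_measurable :: "'a measure \<Rightarrow> ('a \<Rightarrow> real) \<Rightarrow> bool" where
  "bounded_measurable \<mu> f \<longleftrightarrow> f \<in> borel_measurable \<mu> \<and> bounded (f ` space \<mu>)"

text \<open>The duality determines \<open>kernel_op K f\<close> only up to \<open>\<mu>\<close>-null sets, so it is a property of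
  \<open>K\<close> (any Markov kernel realizing the Perron-Frobenius operator) rather than a definition of it.\<close>

definition perron_frobenius_kernel :: "('a \<Rightarrow> 'a) \<Rightarrow> 'a measure \<Rightarrow> ('a \<Rightarrow> 'a measure) \<Rightarrow> bool" where
  "perron_frobenius_kernel T \<mu> K \<longleftrightarrow>
     invariant_markov_kernel \<mu> K \<and>
     (\<forall>f g. bounded_measurable \<mu> f \<longrightarrow> bounded_measurable \<mu> g \<longrightarrow>
        (\<integral>x. f x * g (T x) \<partial>\<mu>) = (\<integral>x. kernel_op K f x * g x \<partial>\<mu>))"

text \<open>The conditioning in the Markov property is on the sigma-algebra generated by
  \<open>X 0, \<dots>, X n\<close>.\<close>

definition stationary_markov_chain ::
    "'w measure \<Rightarrow> (nat \<Rightarrow> 'w \<Rightarrow> 'a) \<Rightarrow> 'a measure \<Rightarrow> ('a \<Rightarrow> 'a measure) \<Rightarrow> bool" where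
  "stationary_markov_chain M X \<mu> K \<longleftrightarrow>
     prob_space M \<and> invariant_markov_kernel \<mu> K \<and>
     (\<forall>i. X i \<in> M \<rightarrow>\<^sub>M \<mu>) \<and> distr M \<mu> (X 0) = \<mu> \<and>
     (\<forall>n f. bounded_measurable \<mu> f \<longrightarrow>
        (AE w in M.
           real_cond_exp M
             (vimage_algebra (space M) (\<lambda>w. \<lambda>i\<in>{..n}. X i w) (Pi\<^sub>M {..n} (\<lambda>_. \<mu>)))
             (\<lambda>w. f (X (Suc n) w)) w
           = kernel_op K f (X n w)))"

text \<open>The list \<open>[(n\<^sub>1, f\<^sub>1), \<dots>, (n\<^sub>k, f\<^sub>k)]\<close> stands for the pair of tuples
  \<open>(n\<^sub>1, \<dots>, n\<^sub>k)\<close>, \<open>(f\<^sub>1, \<dots>, f\<^sub>k)\<close>; the value \<open>1\<close> for the empty list makes the innermost factor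
  \<open>K\<^sup>n f\<close> with \<open>n = n\<^sub>k\<close>, \<open>f = f\<^sub>k\<close>.\<close>

fun kernel_iter :: "('a \<Rightarrow> 'a measure) \<Rightarrow> (nat \<times> ('a \<Rightarrow> real)) list \<Rightarrow> 'a \<Rightarrow> real" where
  "kernel_iter K [] = (\<lambda>_. 1)"
| "kernel_iter K ((n, f) # ps) = (kernel_op K ^^ n) (\<lambda>x. f x * kernel_iter K ps x)"

definition kernel_iter0 ::
    "'a measure \<Rightarrow> ('a \<Rightarrow> 'a measure) \<Rightarrow> (nat \<times> ('a \<Rightarrow> real)) list \<Rightarrow> 'a \<Rightarrow> real" where
  "kernel_iter0 \<mu> K ps x = kernel_iter K ps x - (\<integral>y. kernel_iter K ps y \<partial>\<mu>)"

definition half_line :: "real \<Rightarrow> real \<Rightarrow> real" where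
  "half_line t = indicator {..t}"

text \<open>For a Markov kernel all suprema below are over nonempty families with values in \<open>{0..1}\<close>, so
  the conditionally complete supremum on the reals is the intended one. In the definitions for
  \<open>k \<ge> 2\<close>, \<open>ns = [n\<^sub>2, \<dots>, n\<^sub>l]\<close> and \<open>ts = [t\<^sub>1, \<dots>, t\<^sub>l]\<close>; the index \<open>k = 0\<close> is not meaningful.\<close>

definition alpha1_coeff :: "real measure \<Rightarrow> (real \<Rightarrow> real measure) \<Rightarrow> nat \<Rightarrow> real" where
  "alpha1_coeff \<mu> K n =
     (SUP t. \<integral>x. \<bar>(kernel_op K ^^ n) (half_line t) x - (\<integral>y. half_line t y \<partial>\<mu>)\<bar> \<partial>\<mu>)"

definition beta1_coeff :: "real measure \<Rightarrow> (real \<Rightarrow> real measure) \<Rightarrow> nat \<Rightarrow> real" where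
  "beta1_coeff \<mu> K n =
     (\<integral>x. (SUP t. \<bar>(kernel_op K ^^ n) (half_line t) x - (\<integral>y. half_line t y \<partial>\<mu>)\<bar>) \<partial>\<mu>)"

definition alpha_coeff :: "real measure \<Rightarrow> (real \<Rightarrow> real measure) \<Rightarrow> nat \<Rightarrow> nat \<Rightarrow> real" where
  "alpha_coeff \<mu> K k n =
     (if k < 2 then alpha1_coeff \<mu> K n
      else max (alpha1_coeff \<mu> K n)
        (SUP l\<in>{2..k}. SUP ns\<in>{ns. length ns = l - 1 \<and> (\<forall>m\<in>set ns. 1 \<le> m)}.
           SUP ts\<in>{ts. length ts = l}.
             \<integral>x. \<bar>kernel_iter0 \<mu> K (zip (n # ns) (map half_line ts)) x\<bar> \<partial>\<mu>))"

definition beta_coeff :: "real measure \<Rightarrow> (real \<Rightarrow> real measure) \<Rightarrow> nat \<Rightarrow> nat \<Rightarrow> real" where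
  "beta_coeff \<mu> K k n =
     (if k < 2 then beta1_coeff \<mu> K n
      else max (beta1_coeff \<mu> K n)
        (SUP l\<in>{2..k}. SUP ns\<in>{ns. length ns = l - 1 \<and> (\<forall>m\<in>set ns. 1 \<le> m)}.
           \<integral>x. (SUP ts\<in>{ts. length ts = l}.
             \<bar>kernel_iter0 \<mu> K (zip (n # ns) (map half_line ts)) x\<bar>) \<partial>\<mu>))"

end

(*
  For the distribution function F of an atomless measure on [0,1], the image measure has the
  distribution function F (y x) + F ((1 + x) / 2) - F (1/2), where y inverts the left branch. As y is
  concave, this operation preserves concavity, that is, measures with a nonincreasing density, and it
  preserves the bound F x <= A x^(1-gamma). Only the mass A t^(1-gamma) starting in [0,t], with t the
  N-th preimage of 1 (of order N^(-1/gamma)), can fail to visit [1/2,1] within N steps; the rest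
  produces a density bounded below. Hence, for two nonincreasing densities of equal mass m, the same
  constant multiple of m - O(N^(1-1/gamma)) of Lebesgue measure splits off both in each block of N steps,
  and after k blocks the remainders have mass at most (1-c)^k + O(N^(1-1/gamma)). Taking k a small power of
  n costs only n^delta. This also yields the uniqueness and the monotone density of the invariant measure.

  If h is the invariant density and f_i are indicators of half-lines, then h f_1 K^(n_2)(f_2 ...) is
  again nonincreasing, so all coefficients are treated at once. A nonincreasing density of mass r is
  at most r/x, uniformly in the thresholds, so moving the supremum inside the integral costs only a
  logarithm. The lower bound tests the threshold t on the indicator of (1/2,1], t being the (n+1)-st
  preimage of 1: the covariance is - nu[0,t] nu(1/2,1], and nu[0,t] is of order n^(1-1/gamma).
*)

theory Submission
  imports Defs "HOL-Real_Asymp.Real_Asymp"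
begin

section \<open>The left branch and its preimages of one\<close>

text \<open>The constants precede the quantifiers over the invariant measure and the kernel, so the
  monotone density has to be derived for an arbitrary absolutely continuous invariant measure.
  Coupling reaches nonincreasing densities only; indicators of half-lines generate the rest, and an
  L1 bound uniform in time carries the loss of memory over to every integrable density. The kernel
  operator is given by a duality, that is, up to null sets. The dynamics is therefore stated for
  distribution functions, on which it acts as the explicit map \<open>push\<close>, and a density
  bound becomes an inequality between increments. Densities return at the end: increments bounded by
  r (b - a) / a refine to r ln (b / a), the integral of r / z, and integral inequalities on all
  intervals give one almost everywhere. The exceptional null sets depend on the thresholds, so
  suprema are reduced to rational ones. The multiple of Lebesgue measure that is split off is not
  invariant; it is the same for both measures and cancels in their difference, so only the
  remainders must stay in the class.\<close>

lemma concave_on_three_points: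
  fixes F :: "real \<Rightarrow> real"
  assumes F: "concave_on I F" and I: "a \<in> I" "c \<in> I" and abc: "a \<le> b" "b \<le> c"
  shows "(F c - F b) * (b - a) \<le> (F b - F a) * (c - b)"
proof (cases "a = c")
  case True then show ?thesis using abc by auto
next
  case False
  then have ac: "c - a > 0" using abc by auto
  define t where "t = (b - a) / (c - a)"
  have t: "0 \<le> t" "t \<le> 1" using abc ac by (auto simp: t_def)
  have tc: "t * (c - a) = b - a" using ac by (simp add: t_def)
  then have b: "(1 - t) * a + t * c = b" by (simp add: algebra_simps)
  have "(1 - t) * F a + t * F c \<le> F b"
    using concave_onD[OF F t I] b by simp
  then have "(c - a) * ((1 - t) * F a + t * F c) \<le> (c - a) * F b"
    using ac by (intro mult_left_mono) auto
  moreover have "(c - a) * ((1 - t) * F a + t * F c) = (c - a) * F a + (b - a) * (F c - F a)"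
    by (simp add: tc[symmetric] algebra_simps)
  ultimately show ?thesis by (simp add: algebra_simps)
qed

text \<open>The chord of the concave power function between 1 and 2. It serves with exponent
  \<open>1 - \<gamma>\<close> for the mass near 0 and with \<open>\<gamma>\<close> for the speed of
  escape from 0.\<close>

lemma one_plus_powr_ge_chord:
  fixes p z :: real
  assumes "0 < p" "p < 1" "0 \<le> z" "z \<le> 1"
  shows "1 + (2 powr p - 1) * z \<le> (1 + z) powr p"
proof -
  have "concave_on {0<..} (\<lambda>x::real. x powr p)"
    unfolding concave_on_def
    by (rule f''_ge0_imp_convex[where f' = "\<lambda>x. - (p * x powr (p - 1))" 
          and f'' = "\<lambda>x. - (p * ((p - 1) * x powr (p - 1 - 1)))"])
      (use assms in \<open>auto intro!: derivative_eq_intros simp: mult_le_0_iff\<close>)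
  from concave_onD[OF this, of z 1 2] show ?thesis
    using assms by (simp add: algebra_simps)
qed

locale lsv =
  fixes \<gamma> :: real
  assumes gamma_pos: "0 < \<gamma>" and gamma_less_1: "\<gamma> < 1"
begin

definition left_branch :: "real \<Rightarrow> real" where
  "left_branch x = x * (1 + (2 * x) powr \<gamma>)"

lemma left_branch_0 [simp]: "left_branch 0 = 0"
  and left_branch_half [simp]: "left_branch (1/2) = 1"
  by (auto simp: left_branch_def)

lemma lsv_map_left: "0 \<le> x \<Longrightarrow> x < 1/2 \<Longrightarrow> lsv_map \<gamma> x = left_branch x"
  and lsv_map_right: "1/2 \<le> x \<Longrightarrow> lsv_map \<gamma> x = 2 * x - 1"
  by (auto simp: lsv_map_def left_branch_def powr_mult)

lemma left_branch_expanding: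
  assumes "0 \<le> u" "u \<le> v" shows "v - u \<le> left_branch v - left_branch u"
proof -
  have "u * (2 * u) powr \<gamma> \<le> v * (2 * v) powr \<gamma>"
    using assms gamma_pos by (intro mult_mono powr_mono2) auto
  then show ?thesis by (simp add: left_branch_def algebra_simps)
qed

lemma left_branch_strict_mono: "0 \<le> u \<Longrightarrow> u < v \<Longrightarrow> left_branch u < left_branch v"
  using left_branch_expanding[of u v] by auto

lemma left_branch_convex: "convex_on {0..1/2} left_branch"
proof (rule convex_on_linorderI)
  fix t x y :: real
  assume t: "0 < t" "t < 1" and x: "x \<in> {0..1/2}" and y: "y \<in> {0..1/2}" and xy: "x < y"
  have cv: "convex_on {0<..} (\<lambda>x::real. x powr (1 + \<gamma>))"
    using gamma_pos by (intro powr_convex) auto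
  have eq: "left_branch x = x + 2 powr \<gamma> * x powr (1 + \<gamma>)" if "0 \<le> x" for x
    using that by (auto simp: left_branch_def powr_mult powr_add algebra_simps)
  show "left_branch ((1 - t) *\<^sub>R x + t *\<^sub>R y) \<le> (1 - t) * left_branch x + t * left_branch y"
  \<comment> \<open>The convexity fact \<open>cv\<close> concerns positive arguments; at the
    endpoint 0 monotonicity of the power suffices.\<close>
  proof (cases "x = 0")
    case True
    have "(2 * (t * y)) powr \<gamma> \<le> (2 * y) powr \<gamma>"
      using t y gamma_pos by (intro powr_mono2) (auto simp: mult_left_le_one_le)
    then show ?thesis using True t y by (auto simp: left_branch_def mult_ac intro!: mult_left_mono)
  next
    case False
    then have "((1 - t) * x + t * y) powr (1 + \<gamma>) \<le> (1 - t) * x powr (1 + \<gamma>) + t * y powr (1 + \<gamma>)"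
      using convex_onD[OF cv, of t x y] t x xy by auto
    then have "2 powr \<gamma> * ((1 - t) * x + t * y) powr (1 + \<gamma>)
        \<le> 2 powr \<gamma> * ((1 - t) * x powr (1 + \<gamma>) + t * y powr (1 + \<gamma>))"
      by (intro mult_left_mono) auto
    moreover have "0 \<le> (1 - t) * x + t * y" using t x y by auto
    ultimately show ?thesis using x y eq[of x] eq[of y] eq[of "(1 - t) * x + t * y"]
      by (simp add: algebra_simps)
  qed
qed auto

lemma left_branch_has_derivative:
  "0 < x \<Longrightarrow> (left_branch has_real_derivative (1 + (1 + \<gamma>) * (2 * x) powr \<gamma>)) (at x)"
  unfolding left_branch_def
  by (auto intro!: derivative_eq_intros simp: powr_diff field_simps)

lemma continuous_on_left_branch: "continuous_on {0..} left_branch"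
  unfolding left_branch_def using gamma_pos
  by (intro continuous_intros continuous_on_powr') auto

text \<open>The derivative \<open>1 + (1 + \<gamma>) * (2 * x) powr \<gamma>\<close> is at most 3 on
  the left half. This 3 is the factor that a lower density bound loses in each step.\<close>

lemma left_branch_Lipschitz:
  assumes "0 \<le> u" "u \<le> v" "v \<le> 1/2"
  shows "left_branch v - left_branch u \<le> 3 * (v - u)"
proof (cases "u = v")
  case False
  have "\<exists>l z. u < z \<and> z < v \<and> (left_branch has_real_derivative l) (at z) \<and> left_branch v - left_branch u = (v - u) * l"
  proof (rule MVT)
    show "continuous_on {u..v} left_branch"
      using continuous_on_left_branch by (rule continuous_on_subset) (use assms in auto)
    show "left_branch differentiable (at x)" if "u < x" "x < v" for x
      using left_branch_has_derivative[of x] that assms real_differentiable_def by auto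
  qed (use False assms in auto)
  then obtain l z where z: "u < z" "z < v" "(left_branch has_real_derivative l) (at z)"
    and eq: "left_branch v - left_branch u = (v - u) * l" by blast
  have l: "l = 1 + (1 + \<gamma>) * (2 * z) powr \<gamma>"
    using z assms left_branch_has_derivative[of z] DERIV_unique by auto
  have "(2 * z) powr \<gamma> \<le> 1" using z assms gamma_pos by (intro powr_le1) auto
  then have "(1 + \<gamma>) * (2 * z) powr \<gamma> \<le> 2 * 1" using gamma_less_1 gamma_pos by (intro mult_mono) auto
  then have "l \<le> 3" using l by simp
  then have "(v - u) * l \<le> (v - u) * 3" using assms by (intro mult_left_mono) auto
  then show ?thesis using eq by simp
qed simp

section \<open>The inverse of the left branch\<close>

definition preim :: "real \<Rightarrow> real" where
  "preim = the_inv_into {0..1/2} left_branch"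

lemma left_branch_bij: "bij_betw left_branch {0..1/2} {0..1}"
proof -
  have "inj_on left_branch {0..1/2}"
    by (rule linorder_inj_onI) (use left_branch_strict_mono in \<open>force+\<close>)
  moreover have "left_branch ` {0..1/2} = {0..1}"
  proof (intro equalityI subsetI)
    fix x assume "x \<in> left_branch ` {0..1/2}"
    then show "x \<in> {0..1}"
      using left_branch_expanding[of 0] left_branch_expanding[of _ "1/2"] by fastforce
  next
    fix x :: real assume "x \<in> {0..1}"
    moreover have "continuous_on {0..1/2} left_branch"
      using continuous_on_left_branch by (rule continuous_on_subset) auto
    ultimately have "\<exists>z\<ge>0. z \<le> 1/2 \<and> left_branch z = x"
      by (intro IVT') auto
    then show "x \<in> left_branch ` {0..1/2}" by auto
  qed
  ultimately show ?thesis by (simp add: bij_betw_def)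
qed

lemma
  assumes "x \<in> {0..1}"
  shows left_branch_preim: "left_branch (preim x) = x" and preim_range: "preim x \<in> {0..1/2}"
proof -
  have "x \<in> left_branch ` {0..1/2}" using left_branch_bij assms by (simp add: bij_betw_def)
  then show "left_branch (preim x) = x" "preim x \<in> {0..1/2}"
    using left_branch_bij unfolding preim_def bij_betw_def
    by (blast intro: f_the_inv_into_f the_inv_into_into)+
qed

lemma preim_le_half: "x \<in> {0..1} \<Longrightarrow> 0 \<le> preim x" "x \<in> {0..1} \<Longrightarrow> preim x \<le> 1/2"
    "x \<in> {0..1} \<Longrightarrow> preim x \<le> 1"
  using preim_range[of x] by auto

lemma preim_left_branch: "z \<in> {0..1/2} \<Longrightarrow> preim (left_branch z) = z"
  using left_branch_bij by (simp add: preim_def bij_betw_def the_inv_into_f_f)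

lemma preim_0 [simp]: "preim 0 = 0" and preim_1 [simp]: "preim 1 = 1/2"
  using preim_left_branch[of 0] preim_left_branch[of "1/2"] by auto

lemma left_branch_le_iff: 
  "z \<in> {0..1/2} \<Longrightarrow> x \<in> {0..1} \<Longrightarrow> left_branch z \<le> x \<longleftrightarrow> z \<le> preim x"
  using left_branch_strict_mono[of z "preim x"] left_branch_strict_mono[of "preim x" z]
    left_branch_preim[of x] preim_range[of x] by (cases z "preim x" rule: linorder_cases) auto

lemma preim_mono: "x \<in> {0..1} \<Longrightarrow> z \<in> {0..1} \<Longrightarrow> x \<le> z \<Longrightarrow> preim x \<le> preim z"
  using left_branch_le_iff[of "preim x" z] left_branch_preim[of x] preim_range[of x] by auto

lemma preim_le: "x \<in> {0..1} \<Longrightarrow> preim x \<le> x"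
  using left_branch_expanding[of 0 "preim x"] left_branch_preim[of x] preim_range[of x] by auto

lemma preim_slope:
  assumes "u \<in> {0..1}" "v \<in> {0..1}" "u \<le> v"
  shows "(v - u) / 3 \<le> preim v - preim u"
  using left_branch_Lipschitz[of "preim u" "preim v"] preim_mono[OF assms]
    preim_range[of u] preim_range[of v] assms left_branch_preim[of u] left_branch_preim[of v]
  by (auto simp: field_simps)

text \<open>The inverse of an increasing convex function is concave. The other inverse branch is
  affine, so this is what makes \<open>push\<close> preserve concavity.\<close>

lemma preim_concave: "concave_on {0..1} preim"
proof (rule concave_on_linorderI)
  fix t x y :: real
  assume t: "0 < t" "t < 1" and x: "x \<in> {0..1}" and y: "y \<in> {0..1}" and "x < y"
  define z where "z = (1 - t) * x + t * y"
  define w where "w = (1 - t) * preim x + t * preim y"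
  have z: "z \<in> {0..1}"
    using convexD_alt[of "{0..1::real}" x y t] x y t by (auto simp: z_def)
  have w: "w \<in> {0..1/2}"
    using convexD_alt[of "{0..1/2::real}" "preim x" "preim y" t] preim_range[OF x] preim_range[OF y] t
    unfolding w_def by simp
  have "left_branch w \<le> z"
    using convex_onD[OF left_branch_convex, of t "preim x" "preim y"] t preim_range[OF x] preim_range[OF y]
      left_branch_preim[OF x] left_branch_preim[OF y] by (simp add: w_def z_def)
  then show "(1 - t) * preim x + t * preim y \<le> preim ((1 - t) *\<^sub>R x + t *\<^sub>R y)"
    using left_branch_le_iff[OF w z] by (simp add: w_def z_def)
qed auto

section \<open>A power bound for the mass near 0\<close>

text \<open>Chosen so that \<open>tail_const * (2 powr (1 - \<gamma>) - 1) \<ge> 2\<close>, which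
  leaves room for the mass that the right branch brings into \<open>{0..x}\<close>. The added 1
  makes \<open>tail_const \<ge> 1\<close> evident, as needed for Lebesgue measure itself.\<close>

definition tail_const :: real where
  "tail_const = 1 + 2 / (2 powr (1 - \<gamma>) - 1)"

lemma tail_const_ge_1: "1 \<le> tail_const" and tail_const_pos: "0 < tail_const"
proof -
  have "(1::real) < 2 powr (1 - \<gamma>)" using gamma_less_1 by simp
  then show "1 \<le> tail_const" by (simp add: tail_const_def)
  then show "0 < tail_const" by simp
qed

text \<open>The inequality by which the bound in \<open>decr_cdf\<close> reproduces itself under
  \<open>push\<close>. With y the preimage and x = y (1 + z), the chord bound gives a gain of at
  least \<open>tail_const * (2 powr (1 - \<gamma>) - 1)\<close> times
  \<open>y powr (1 - \<gamma>) * z\<close>; the latter equals \<open>2 powr \<gamma> * y\<close>,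
  hence is at least y, and 2 y \<ge> x.\<close>

lemma tail_const_preim:
  assumes x: "x \<in> {0..1}"
  shows "tail_const * preim x powr (1 - \<gamma>) + x \<le> tail_const * x powr (1 - \<gamma>)"
proof (cases "x = 0")
  case False
  define y where "y = preim x"
  define z where "z = (2 * y) powr \<gamma>"
  have y: "0 \<le> y" "y \<le> 1/2" using preim_range[OF x] by (auto simp: y_def)
  have z: "0 \<le> z" "z \<le> 1" using y gamma_pos by (auto simp: z_def intro!: powr_le1)
  have xy: "x = y * (1 + z)" using left_branch_preim[OF x] by (simp add: y_def z_def left_branch_def)
  have y0: "0 < y" using y xy False by (cases "y = 0") auto
  have c: "(1::real) < 2 powr (1 - \<gamma>)" using gamma_less_1 by simp
  have "tail_const * (2 powr (1 - \<gamma>) - 1) = (2 powr (1 - \<gamma>) - 1) + 2"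
  proof -
    have "(1 + 2 / r) * r = r + 2" if "r \<noteq> 0" for r :: real using that by (simp add: field_simps)
    from this[of "2 powr (1 - \<gamma>) - 1"] show ?thesis
      using c gamma_less_1 by (simp add: tail_const_def)
  qed
  then have "2 \<le> tail_const * (2 powr (1 - \<gamma>) - 1)" using c by simp
  then have "2 * y \<le> tail_const * (2 powr (1 - \<gamma>) - 1) * y" using y by (intro mult_right_mono) auto
  also have "\<dots> \<le> tail_const * (2 powr (1 - \<gamma>) - 1) * (y powr (1 - \<gamma>) * z)"
  proof (intro mult_left_mono)
    have "y powr (1 - \<gamma>) * z = 2 powr \<gamma> * (y powr (1 - \<gamma>) * y powr \<gamma>)"
      using y by (simp add: z_def powr_mult)
    also have "y powr (1 - \<gamma>) * y powr \<gamma> = y" using y0 by (simp flip: powr_add)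
    finally show "y \<le> y powr (1 - \<gamma>) * z" 
      using y gamma_pos mult_right_mono[of 1 "2 powr \<gamma>" y] by (simp add: ge_one_powr_ge_zero)
  qed (use c tail_const_pos in auto)
  also have "\<dots> = tail_const * y powr (1 - \<gamma>) * ((2 powr (1 - \<gamma>) - 1) * z)" by simp
  also have "\<dots> \<le> tail_const * y powr (1 - \<gamma>) * ((1 + z) powr (1 - \<gamma>) - 1)"
    using one_plus_powr_ge_chord[of "1 - \<gamma>" z] gamma_pos gamma_less_1 z tail_const_pos
    by (intro mult_left_mono) auto
  also have "\<dots> = tail_const * x powr (1 - \<gamma>) - tail_const * y powr (1 - \<gamma>)"
    using y z by (simp add: xy powr_mult right_diff_distrib)
  finally have "2 * y \<le> tail_const * x powr (1 - \<gamma>) - tail_const * y powr (1 - \<gamma>)" .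
  moreover have "x \<le> 2 * y" unfolding xy using mult_left_mono[of "1 + z" 2 y] y z by (simp add: mult.commute)
  ultimately show ?thesis unfolding y_def by linarith
qed simp

lemma preim_iter_range: "x \<in> {0..1} \<Longrightarrow> (preim ^^ n) x \<in> {0..1}"
  by (induction n) (use preim_range in \<open>auto simp: preim_le_half\<close>)

lemma preim_iter_mono: "x \<in> {0..1} \<Longrightarrow> z \<in> {0..1} \<Longrightarrow> x \<le> z \<Longrightarrow> (preim ^^ n) x \<le> (preim ^^ n) z"
  by (induction n) (use preim_iter_range in \<open>auto intro!: preim_mono\<close>)

section \<open>Decay of the preimages of 1\<close>

text \<open>The count starts with \<open>cusp_seq 0 = 1\<close> and \<open>cusp_seq 1 = 1/2\<close>;
  an orbit starting below \<open>cusp_seq n\<close> stays below 1/2 at the times 0 to n - 1.\<close>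

definition cusp_seq :: "nat \<Rightarrow> real" where
  "cusp_seq n = (preim ^^ n) 1"

lemma cusp_seq_range: "cusp_seq n \<in> {0..1}"
  unfolding cusp_seq_def by (rule preim_iter_range) auto

lemma cusp_seq_Suc: "cusp_seq (Suc n) = preim (cusp_seq n)"
  by (simp add: cusp_seq_def)

lemma cusp_seq_recursion:
  "cusp_seq n = cusp_seq (Suc n) * (1 + (2 * cusp_seq (Suc n)) powr \<gamma>)"
  using left_branch_preim[OF cusp_seq_range[of n]] by (simp add: cusp_seq_Suc left_branch_def)

lemma cusp_seq_pos: "0 < cusp_seq n"
proof (induction n)
  case (Suc n)
  then show ?case using cusp_seq_recursion[of n] cusp_seq_range[of "Suc n"] 
    by (cases "cusp_seq (Suc n) = 0") auto
qed (simp add: cusp_seq_def)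

lemma cusp_seq_antimono: "m \<le> n \<Longrightarrow> cusp_seq n \<le> cusp_seq m"
  by (rule lift_Suc_antimono_le) (auto simp: cusp_seq_Suc intro!: preim_le cusp_seq_range[unfolded atLeastAtMost_iff])

text \<open>The recursion for \<open>cusp_seq\<close> becomes almost linear for its \<open>-\<gamma>\<close>-th power.\<close>

lemma cusp_seq_powr_step:
  "cusp_seq (Suc n) powr -\<gamma> - cusp_seq n powr -\<gamma> \<in> {2 powr \<gamma> - 1..2}"
proof -
  define y where "y = cusp_seq (Suc n)"
  define z where "z = (2 * y) powr \<gamma>"
  have y: "0 < y" "y \<le> 1/2" using cusp_seq_pos[of "Suc n"] preim_range[OF cusp_seq_range[of n]]
    by (auto simp: y_def cusp_seq_Suc)
  have z: "0 \<le> z" "z \<le> 1" using y gamma_pos by (auto simp: z_def intro!: powr_le1)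
  have xy: "cusp_seq n = y * (1 + z)" using cusp_seq_recursion[of n] by (simp add: y_def z_def)
  \<comment> \<open>This cancellation is why the increments stay between positive constants.\<close>
  have zy: "z * y powr -\<gamma> = 2 powr \<gamma>" using y by (simp add: z_def powr_mult powr_minus)
  define d where "d = cusp_seq (Suc n) powr -\<gamma> - cusp_seq n powr -\<gamma>"
  have d: "d = y powr -\<gamma> * (1 + z) powr -\<gamma> * ((1 + z) powr \<gamma> - 1)"
  proof -
    have "(1 + z) powr -\<gamma> * (1 + z) powr \<gamma> = 1" using z by (simp flip: powr_add)
    then show ?thesis unfolding d_def xy y_def[symmetric] using y z
      by (simp add: powr_mult right_diff_distrib mult.assoc)
  qed
  have le2: "(1 + z) powr \<gamma> \<le> 2 powr \<gamma>" using z gamma_pos by (intro powr_mono2) auto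
  have ge1: "1 \<le> (1 + z) powr \<gamma>" using z gamma_pos by (intro ge_one_powr_ge_zero) auto
  have "(1 + z) powr \<gamma> \<le> (1 + z) powr 1" using z gamma_less_1 by (intro powr_mono) auto
  then have "d \<le> y powr -\<gamma> * 1 * z"
    unfolding d using ge1 z by (intro mult_mono) (auto simp: powr_minus field_simps)
  also have "\<dots> = 2 powr \<gamma>" using zy by (simp add: mult.commute)
  also have "\<dots> \<le> 2 powr 1" using gamma_less_1 by (intro powr_mono) auto
  finally have up: "d \<le> 2" by simp
  have "2 powr \<gamma> - 1 = y powr -\<gamma> * 2 powr -\<gamma> * ((2 powr \<gamma> - 1) * z)"
    using zy y by (simp add: powr_minus field_simps)
  also have "\<dots> \<le> d"
  proof -
    have "2 powr -\<gamma> \<le> (1 + z) powr -\<gamma>" using le2 z by (simp add: powr_minus field_simps)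
    moreover have "1 + (2 powr \<gamma> - 1) * z \<le> (1 + z) powr \<gamma>"
      using one_plus_powr_ge_chord[of \<gamma> z] gamma_pos gamma_less_1 z by auto
    moreover have "1 \<le> 2 powr \<gamma>" using gamma_pos by (simp add: ge_one_powr_ge_zero)
    ultimately show ?thesis unfolding d using z by (intro mult_mono) auto
  qed
  finally show ?thesis using up by (simp add: d_def)
qed

text \<open>Summation of the increments from the value 1 at index 0. Taking the power -1/\<gamma>
  then shows that \<open>cusp_seq n\<close> is of exact order (n + 1)^(-1/\<gamma>).\<close>

lemma cusp_seq_powr_bounds:
  "cusp_seq n powr -\<gamma> \<in> {(2 powr \<gamma> - 1) * (real n + 1)..2 * (real n + 1)}"
proof (induction n)
  case 0
  have "2 powr \<gamma> \<le> (2::real) powr 1" using gamma_less_1 by (intro powr_mono) auto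
  then show ?case by (simp add: cusp_seq_def)
next
  case (Suc n)
  then show ?case using cusp_seq_powr_step[of n] by (auto simp: algebra_simps)
qed

lemma cusp_seq_lower: "(2 * (real n + 1)) powr (-1/\<gamma>) \<le> cusp_seq n"
proof -
  have "cusp_seq n powr -\<gamma> \<le> 2 * (real n + 1)" using cusp_seq_powr_bounds[of n] by auto
  then have "(2 * (real n + 1)) powr (-1/\<gamma>) \<le> (cusp_seq n powr -\<gamma>) powr (-1/\<gamma>)"
    using gamma_pos cusp_seq_pos[of n] by (intro powr_mono2') (auto simp: divide_simps)
  also have "\<dots> = cusp_seq n" using gamma_pos cusp_seq_pos[of n] by (simp add: powr_powr)
  finally show ?thesis .
qed

lemma cusp_seq_upper: 
  "cusp_seq n \<le> ((2 powr \<gamma> - 1) * (real n + 1)) powr (-1/\<gamma>)"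
proof -
  have c: "(1::real) < 2 powr \<gamma>" using gamma_pos by simp
  have "cusp_seq n = (cusp_seq n powr -\<gamma>) powr (-1/\<gamma>)"
    using gamma_pos cusp_seq_pos[of n] by (simp add: powr_powr)
  also have "\<dots> \<le> ((2 powr \<gamma> - 1) * (real n + 1)) powr (-1/\<gamma>)"
    using cusp_seq_powr_bounds[of n] gamma_pos c by (intro powr_mono2') (auto simp: divide_simps)
  finally show ?thesis .
qed

end

section \<open>Evolution of distribution functions and coupling\<close>

lemma concave_on_compose_mono:
  fixes f g :: "real \<Rightarrow> real"
  assumes f: "concave_on I f" and fI: "\<And>x. x \<in> I \<Longrightarrow> f x \<in> J"
    and g: "concave_on J g" "mono_on J g"
  shows "concave_on I (\<lambda>x. g (f x))"
  unfolding concave_on_iff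
proof (intro conjI ballI allI impI)
  show "convex I" using f by (rule concave_on_imp_convex)
  fix x y u v :: real
  assume *: "x \<in> I" "y \<in> I" "0 \<le> u" "0 \<le> v" "u + v = 1"
  have J: "u * f x + v * f y \<in> J" 
    using convexD[OF concave_on_imp_convex[OF g(1)] fI[OF *(1)] fI[OF *(2)]] * by simp
  have "u * g (f x) + v * g (f y) \<le> g (u * f x + v * f y)"
    using g(1) * fI by (auto simp: concave_on_iff)
  also have "\<dots> \<le> g (f (u *\<^sub>R x + v *\<^sub>R y))"
  proof (rule mono_onD[OF g(2) J])
    show "f (u *\<^sub>R x + v *\<^sub>R y) \<in> J"
      using convexD[OF concave_on_imp_convex[OF f]] * by (intro fI) auto
    show "u * f x + v * f y \<le> f (u *\<^sub>R x + v *\<^sub>R y)"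
      using f * by (auto simp: concave_on_iff)
  qed
  finally show "u * g (f x) + v * g (f y) \<le> g (f (u *\<^sub>R x + v *\<^sub>R y))" .
qed

context lsv begin

text \<open>If \<open>F\<close> is the distribution function of an atomless measure on \<open>{0..1}\<close>, then \<open>push F\<close> is the
  one of its image under \<open>lsv_map \<gamma>\<close>.\<close>

definition push :: "(real \<Rightarrow> real) \<Rightarrow> real \<Rightarrow> real" where
  "push F x = F (preim x) + F ((1 + x) / 2) - F (1/2)"

text \<open>Distribution functions of measures of mass at most one with a nonincreasing density that puts
  mass at most \<open>tail_const * x\<^sup>1\<^sup>-\<^sup>\<gamma>\<close> on \<open>{0..x}\<close>.\<close>

definition decr_cdf :: "(real \<Rightarrow> real) \<Rightarrow> bool" where
  "decr_cdf F \<longleftrightarrow> concave_on {0..1} F \<and> mono_on {0..1} F \<and> F 0 = 0 \<and> F 1 \<le> 1 \<and>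
     (\<forall>x\<in>{0..1}. F x \<le> tail_const * x powr (1 - \<gamma>))"

lemma decr_cdfD:
  assumes "decr_cdf F"
  shows "concave_on {0..1} F" "mono_on {0..1} F" "F 0 = 0" "F 1 \<le> 1"
    and "\<And>x. x \<in> {0..1} \<Longrightarrow> F x \<le> tail_const * x powr (1 - \<gamma>)"
  using assms by (auto simp: decr_cdf_def)

lemma decr_cdf_mono: "decr_cdf F \<Longrightarrow> 0 \<le> x \<Longrightarrow> x \<le> y \<Longrightarrow> y \<le> 1 \<Longrightarrow> F x \<le> F y"
  by (rule mono_onD[OF decr_cdfD(2)]) auto

lemma decr_cdf_nonneg: "decr_cdf F \<Longrightarrow> x \<in> {0..1} \<Longrightarrow> 0 \<le> F x"
  using decr_cdf_mono[of F 0 x] decr_cdfD(3)[of F] by auto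

lemma decr_cdf_three_points:
  assumes "decr_cdf F" "0 \<le> a" "a \<le> b" "b \<le> c" "c \<le> 1"
  shows "(F c - F b) * (b - a) \<le> (F b - F a) * (c - b)"
  by (rule concave_on_three_points[OF decr_cdfD(1)]) (use assms in auto)

lemma decr_cdf_cong:
  assumes "decr_cdf F" and eq: "\<And>x. x \<in> {0..1} \<Longrightarrow> F x = G x"
  shows "decr_cdf G"
proof -
  have "concave_on {0..1} G"
    unfolding concave_on_iff
  proof (intro conjI ballI allI impI)
    fix x y u v :: real
    assume *: "x \<in> {0..1}" "y \<in> {0..1}" "0 \<le> u" "0 \<le> v" "u + v = 1"
    then have "u *\<^sub>R x + v *\<^sub>R y \<in> {0..1}" by (intro convexD) auto
    moreover have "u * F x + v * F y \<le> F (u *\<^sub>R x + v *\<^sub>R y)"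
      using decr_cdfD(1)[OF assms(1)] * by (auto simp: concave_on_iff)
    ultimately show "u * G x + v * G y \<le> G (u *\<^sub>R x + v *\<^sub>R y)"
      using eq * by metis
  qed auto
  moreover have "mono_on {0..1} G"
    using decr_cdfD(2)[OF assms(1)] eq by (auto simp: mono_on_def)
  ultimately show ?thesis using assms by (auto simp: decr_cdf_def)
qed

lemma mono_on_push:
  assumes "mono_on {0..1} F" shows "mono_on {0..1} (push F)"
proof (rule mono_onI)
  fix r s :: real assume "r \<in> {0..1}" "s \<in> {0..1}" "r \<le> s"
  then show "push F r \<le> push F s"
    unfolding push_def using preim_range[of r] preim_range[of s] preim_mono[of r s]
    by (intro diff_right_mono add_mono mono_onD[OF assms]) auto
qed

lemma push_0: "push F 0 = F 0" and push_1: "push F 1 = F 1"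
  by (simp_all add: push_def)

text \<open>A nonincreasing density is on the right half at most its mean over the left half, hence
  at most 2, and the interval in question has length x / 2.\<close>

lemma push_right_le:
  assumes "decr_cdf F" "x \<in> {0..1}"
  shows "F ((1 + x) / 2) - F (1/2) \<le> x"
proof -
  have "(F ((1 + x) / 2) - F (1/2)) * (1/2 - 0) \<le> (F (1/2) - F 0) * ((1 + x) / 2 - 1/2)"
    using assms decr_cdf_three_points[of F 0 "1/2" "(1 + x) / 2"] by auto
  moreover have "F (1/2) \<le> F 1" using assms decr_cdf_mono[of F "1/2" 1] by auto
  then have "(F (1/2) - F 0) * ((1 + x) / 2 - 1/2) \<le> 1 * ((1 + x) / 2 - 1/2)"
    using decr_cdfD(3,4)[OF assms(1)] assms(2) by (intro mult_right_mono) (auto simp: field_simps)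
  ultimately show ?thesis by (simp add: field_simps)
qed

lemma concave_on_push:
  assumes "concave_on {0..1} F" "mono_on {0..1} F"
  shows "concave_on {0..1} (push F)"
proof -
  have "concave_on {0..1} (\<lambda>x. F (preim x))"
    by (rule concave_on_compose_mono[OF preim_concave _ assms]) (auto simp: preim_le_half)
  moreover have "concave_on {0..1} (\<lambda>x. F ((1 + x) / 2))"
  proof (rule concave_on_compose_mono[OF _ _ assms])
    show "concave_on {0..1::real} (\<lambda>x. (1 + x) / 2)"
      by (auto simp: concave_on_iff field_simps)
  qed auto
  ultimately show ?thesis
    unfolding push_def 
    by (intro concave_on_diff concave_on_add convex_on_const[THEN iffD2] convex_real_interval) auto
qed

lemma decr_cdf_push:
  assumes F: "decr_cdf F" shows "decr_cdf (push F)"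
  unfolding decr_cdf_def
proof (intro conjI ballI concave_on_push mono_on_push decr_cdfD(1,2)[OF F])
  fix x :: real assume x: "x \<in> {0..1}"
  have "push F x \<le> tail_const * preim x powr (1 - \<gamma>) + x"
    unfolding push_def using decr_cdfD(5)[OF F, of "preim x"] preim_range[OF x] push_right_le[OF F x] by auto
  also have "\<dots> \<le> tail_const * x powr (1 - \<gamma>)" by (rule tail_const_preim[OF x])
  finally show "push F x \<le> tail_const * x powr (1 - \<gamma>)" .
qed (use decr_cdfD[OF F] in \<open>auto simp: push_0 push_1\<close>)

lemma push_iter_1: "(push ^^ n) F 1 = F 1"
  by (induction n) (auto simp: push_1)

lemma decr_cdf_push_iter: "decr_cdf F \<Longrightarrow> decr_cdf ((push ^^ n) F)"
  by (induction n) (auto intro: decr_cdf_push)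

text \<open>The mass that has not yet visited \<open>{1/2..1}\<close> is carried along by the left branch and gives the
  second summand; the rest keeps a density of order \<open>x\<^sup>-\<^sup>\<gamma>\<close>.\<close>

lemma push_iter_tail:
  assumes F: "decr_cdf F" and x: "x \<in> {0..1}"
  shows "(push ^^ n) F x \<le> tail_const * x powr (1 - \<gamma>) * F 1 + F ((preim ^^ n) x)"
  using x
proof (induction n arbitrary: x)
  case 0
  then show ?case using decr_cdf_nonneg[OF F, of 1] tail_const_pos by auto
next
  case (Suc n)
  let ?G = "(push ^^ n) F"
  have G: "decr_cdf ?G" by (rule decr_cdf_push_iter[OF F])
  have p: "preim x \<in> {0..1}" using preim_range[OF Suc.prems] by auto
  \<comment> \<open>The argument of \<open>push_right_le\<close> with the factor \<open>F 1\<close>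
    kept: after repeated splitting the total mass is small, and the bound must stay proportional to
    it.\<close>
  have *: "?G ((1 + x) / 2) - ?G (1/2) \<le> x * F 1"
  proof -
    have "(?G ((1 + x) / 2) - ?G (1/2)) * (1/2 - 0) \<le> (?G (1/2) - ?G 0) * ((1 + x) / 2 - 1/2)"
      using Suc.prems decr_cdf_three_points[OF G, of 0 "1/2" "(1 + x) / 2"] by auto
    moreover have "?G (1/2) \<le> ?G 1" using decr_cdf_mono[OF G, of "1/2" 1] by auto
    then have "(?G (1/2) - ?G 0) * ((1 + x) / 2 - 1/2) \<le> F 1 * ((1 + x) / 2 - 1/2)"
      using decr_cdfD(3)[OF G] Suc.prems push_iter_1[of n F] by (intro mult_right_mono) (auto simp: field_simps)
    ultimately show ?thesis by (simp add: field_simps)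
  qed
  have "(push ^^ Suc n) F x \<le> (tail_const * preim x powr (1 - \<gamma>) + x) * F 1 + F ((preim ^^ n) (preim x))"
    using Suc.IH[OF p] * by (simp add: push_def[of ?G] algebra_simps)
  also have "\<dots> \<le> tail_const * x powr (1 - \<gamma>) * F 1 + F ((preim ^^ n) (preim x))"
    using tail_const_preim[OF Suc.prems] decr_cdf_nonneg[OF F, of 1] by (intro add_right_mono mult_right_mono) auto
  finally show ?case by (simp add: funpow_swap1)
qed

section \<open>Lower density bounds after one block of steps\<close>

text \<open>A density bounded below by s on \<open>{0..b}\<close>, expressed through increments so
  that no density has to exist.\<close>

definition min_slope :: "real \<Rightarrow> real \<Rightarrow> (real \<Rightarrow> real) \<Rightarrow> bool" where
  "min_slope s b F \<longleftrightarrow> (\<forall>u v. 0 \<le> u \<longrightarrow> u \<le> v \<longrightarrow> v \<le> b \<longrightarrow> s * (v - u) \<le> F v - F u)"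

text \<open>Only the left branch is used, whose inverse has slope at least 1/3; the right branch
  adds a nonnegative amount. The interval carrying the bound grows from \<open>{0..preim b}\<close>
  to \<open>{0..b}\<close>.\<close>

lemma min_slope_push:
  assumes F: "mono_on {0..1} F" and b: "b \<in> {0..1}" and s: "0 \<le> s" and "min_slope s (preim b) F"
  shows "min_slope (s / 3) b (push F)"
  unfolding min_slope_def
proof (intro allI impI)
  fix u v :: real assume uv: "0 \<le> u" "u \<le> v" "v \<le> b"
  then have uv1: "u \<in> {0..1}" "v \<in> {0..1}" using b by auto
  have "s * ((v - u) / 3) \<le> s * (preim v - preim u)"
    using preim_slope[OF uv1 uv(2)] s by (intro mult_left_mono) auto
  also have "\<dots> \<le> F (preim v) - F (preim u)"
    using assms(4) uv preim_mono[OF uv1 uv(2)] preim_mono[OF uv1(2) b uv(3)] preim_range[OF uv1(1)]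
    unfolding min_slope_def by simp
  also have "\<dots> \<le> push F v - push F u"
    unfolding push_def using mono_onD[OF F, of "(1 + u) / 2" "(1 + v) / 2"] uv uv1 by auto
  finally show "s / 3 * (v - u) \<le> push F v - push F u" by simp
qed

lemma min_slope_push_iter:
  assumes "decr_cdf F" "b \<in> {0..1}" "0 \<le> s" "min_slope s ((preim ^^ j) b) F"
  shows "min_slope (s / 3 ^ j) b ((push ^^ j) F)"
  using assms(2,4)
proof (induction j arbitrary: b)
  case (Suc j)
  have "min_slope (s / 3 ^ j) (preim b) ((push ^^ j) F)"
    using Suc.prems preim_range[of b] by (intro Suc.IH) (auto simp: funpow_swap1)
  from min_slope_push[OF decr_cdfD(2)[OF decr_cdf_push_iter[OF assms(1)]] Suc.prems(1) _ this]
  show ?case using assms(3) by (simp add: field_simps)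
qed simp

text \<open>Below b a nonincreasing density is at least its mean over \<open>{b..1}\<close>, and
  that interval is no longer than 1.\<close>

lemma decr_cdf_min_slope:
  assumes F: "decr_cdf F" and b: "0 \<le> b" "b < 1"
  shows "min_slope (F 1 - F b) b F"
  unfolding min_slope_def
proof (intro allI impI)
  fix u v :: real assume uv: "0 \<le> u" "u \<le> v" "v \<le> b"
  have d: "0 \<le> F 1 - F b" using decr_cdf_mono[OF F, of b 1] b by auto
  have le: "F v \<le> F b" using decr_cdf_mono[OF F, of v b] uv b by auto
  have "(F 1 - F b) * (v - u) * (1 - v) \<le> (F 1 - F v) * (v - u) * 1"
    using uv b le d by (intro mult_mono mult_right_mono) auto
  also have "(F 1 - F v) * (v - u) \<le> (F v - F u) * (1 - v)"
    using uv b decr_cdf_three_points[OF F, of u v 1] by auto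
  finally show "(F 1 - F b) * (v - u) \<le> F v - F u" using uv b by simp
qed

lemma mixing_depth_ex: "\<exists>j. cusp_seq j < 1 \<and> tail_const * cusp_seq j powr (1 - \<gamma>) \<le> 1/4"
proof -
  have c: "(1::real) < 2 powr \<gamma>" using gamma_pos by simp
  have "(\<lambda>n. ((2 powr \<gamma> - 1) * (real n + 1)) powr (-1/\<gamma>)) \<longlonglongrightarrow> 0"
  proof (rule tendsto_neg_powr)
    show "filterlim (\<lambda>n. (2 powr \<gamma> - 1) * (real n + 1)) at_top sequentially"
      using c by (intro filterlim_tendsto_pos_mult_at_top[OF tendsto_const]
        filterlim_at_top_mono[OF filterlim_real_sequentially]) auto
  qed (use gamma_pos in auto)
  from tendsto_sandwich[OF _ _ tendsto_const this, of cusp_seq] have lim: "cusp_seq \<longlonglongrightarrow> 0"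
    using cusp_seq_upper cusp_seq_pos by (auto intro: less_imp_le always_eventually)
  have "(\<lambda>n. cusp_seq n powr (1 - \<gamma>)) \<longlonglongrightarrow> 0 powr (1 - \<gamma>)"
    by (rule tendsto_powr'[OF lim tendsto_const])
      (use gamma_less_1 cusp_seq_pos in \<open>auto intro!: always_eventually less_imp_le\<close>)
  from tendsto_mult_left[OF this, of tail_const]
  have "(\<lambda>n. tail_const * cusp_seq n powr (1 - \<gamma>)) \<longlonglongrightarrow> 0" by simp
  then have "\<forall>\<^sub>F n in sequentially. tail_const * cusp_seq n powr (1 - \<gamma>) < 1/4"
    by (rule order_tendstoD) simp
  moreover have "\<forall>\<^sub>F n in sequentially. cusp_seq n < 1" using lim by (rule order_tendstoD) simp
  ultimately have "\<forall>\<^sub>F n in sequentially. cusp_seq n < 1 \<and> tail_const * cusp_seq n powr (1 - \<gamma>) \<le> 1/4"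
    by eventually_elim auto
  then show ?thesis by (auto simp: eventually_sequentially)
qed

text \<open>So deep that at most a quarter of the mass that has already visited the right half can
  sit in \<open>{0..cusp_seq mixing_depth}\<close>, an interval that the left branch stretches over
  \<open>{0..1}\<close> in \<open>mixing_depth\<close> steps.\<close>

definition mixing_depth :: nat where
  "mixing_depth = (SOME j. cusp_seq j < 1 \<and> tail_const * cusp_seq j powr (1 - \<gamma>) \<le> 1/4)"

lemma mixing_depth: "cusp_seq mixing_depth < 1" 
    "tail_const * cusp_seq mixing_depth powr (1 - \<gamma>) \<le> 1/4"
  using someI_ex[OF mixing_depth_ex] by (auto simp: mixing_depth_def)

text \<open>The 2 stands for the half of the excess mass that is found beyond
  \<open>cusp_seq mixing_depth\<close>, the power of 3 for the loss while the bound is spread over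
  \<open>{0..1}\<close>.\<close>

definition mixing_const :: real where
  "mixing_const = 1 / (2 * 3 ^ mixing_depth)"

lemma mixing_const: "0 < mixing_const" "mixing_const < 1"
  by (auto simp: mixing_const_def field_simps intro: less_le_trans[of 1 2])

text \<open>Twice the largest mass that \<open>decr_cdf\<close> admits on
  \<open>{0..cusp_seq n}\<close>, the part that may miss the right half for n steps. The factor 2
  lets the later estimates be written with \<open>F 1 - cusp_mass n\<close>.\<close>

definition cusp_mass :: "nat \<Rightarrow> real" where
  "cusp_mass n = 2 * (tail_const * cusp_seq n powr (1 - \<gamma>))"

lemma cusp_mass_pos: "0 < cusp_mass n"
  using tail_const_pos cusp_seq_pos[of n] by (simp add: cusp_mass_def)

text \<open>The minorization for one block. After n steps at least half of
  \<open>F 1 - cusp_mass n\<close> lies beyond \<open>cusp_seq mixing_depth\<close>; monotonicity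
  turns this into a lower density bound below that point, and the remaining
  \<open>mixing_depth\<close> steps spread it over the whole interval.\<close>

lemma min_slope_mixing:
  assumes F: "decr_cdf F" and ge: "cusp_mass n \<le> F 1"
  shows "min_slope (mixing_const * (F 1 - cusp_mass n)) 1 ((push ^^ (mixing_depth + n)) F)"
proof -
  let ?b = "cusp_seq mixing_depth"
  let ?G = "(push ^^ n) F"
  have b: "?b \<in> {0..1}" by (rule cusp_seq_range)
  have G: "decr_cdf ?G" by (rule decr_cdf_push_iter[OF F])
  have "?G ?b \<le> tail_const * ?b powr (1 - \<gamma>) * F 1 + F ((preim ^^ n) ?b)"
    by (rule push_iter_tail[OF F b])
  also have "\<dots> \<le> 1/4 * F 1 + cusp_mass n / 2"
  proof (intro add_mono mult_right_mono mixing_depth)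
    have "F ((preim ^^ n) ?b) \<le> F (cusp_seq n)"
      using preim_iter_range[OF b, of n] cusp_seq_range[of n] preim_iter_mono[OF b, of 1 n] b
        decr_cdf_mono[OF F, of "(preim ^^ n) ?b" "cusp_seq n"] by (auto simp: cusp_seq_def)
    also have "\<dots> \<le> cusp_mass n / 2"
      using decr_cdfD(5)[OF F cusp_seq_range] by (simp add: cusp_mass_def)
    finally show "F ((preim ^^ n) ?b) \<le> cusp_mass n / 2" .
  qed (use decr_cdf_nonneg[OF F, of 1] in auto)
  finally have le: "(F 1 - cusp_mass n) / 2 \<le> ?G 1 - ?G ?b" 
    using decr_cdf_nonneg[OF F, of 1] by (simp add: push_iter_1 field_simps)
  have "min_slope (?G 1 - ?G ?b) ?b ?G"
    using b mixing_depth by (intro decr_cdf_min_slope G) auto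
  then have "min_slope ((F 1 - cusp_mass n) / 2) ((preim ^^ mixing_depth) 1) ?G"
    using mult_right_mono[OF le] unfolding min_slope_def cusp_seq_def by (meson diff_ge_0_iff_ge order_trans)
  from min_slope_push_iter[OF G _ _ this] show ?thesis
    using ge by (simp add: funpow_add mixing_const_def)
qed

text \<open>Removal of a multiple of Lebesgue measure: subtracting a linear function does not affect
  concavity, and \<open>min_slope\<close> is exactly what keeps the difference
  nondecreasing.\<close>

lemma decr_cdf_diff_linear:
  assumes F: "decr_cdf F" and s: "min_slope s 1 F" "0 \<le> s"
  shows "decr_cdf (\<lambda>x. F x - s * x)"
  unfolding decr_cdf_def
proof (intro conjI ballI)
  show "concave_on {0..1} (\<lambda>x. F x - s * x)"
    using s by (intro concave_on_diff decr_cdfD(1)[OF F] convex_on_cmul convex_on_ident[THEN iffD2]) auto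
  show "mono_on {0..1} (\<lambda>x. F x - s * x)"
    using s by (auto simp: mono_on_def min_slope_def algebra_simps)
  show "F x - s * x \<le> tail_const * x powr (1 - \<gamma>)" if "x \<in> {0..1}" for x
  proof -
    have "0 \<le> s * x" using that s by auto
    then show ?thesis using decr_cdfD(5)[OF F that] by linarith
  qed
qed (use decr_cdfD[OF F] s in auto)

section \<open>Coupling of two measures of equal mass\<close>

text \<open>The number r bounds the mass not yet coupled. A decomposition is recorded rather than a
  norm of Z, because both remainders must keep nonincreasing densities for the next block and for
  the final bound r / x.\<close>

definition coupled :: "real \<Rightarrow> (real \<Rightarrow> real) \<Rightarrow> bool" where
  "coupled r Z \<longleftrightarrow> (\<exists>G G'. decr_cdf G \<and> decr_cdf G' \<and> G 1 = G' 1 \<and> G 1 \<le> r \<and>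
     (\<forall>x\<in>{0..1}. Z x = G x - G' x))"

lemma push_diff: 
  assumes "\<And>x. x \<in> {0..1} \<Longrightarrow> Z x = G x - G' x" "x \<in> {0..1}"
  shows "push Z x = push G x - push G' x"
  using assms preim_range[of x] by (simp add: push_def)

lemma push_iter_diff: 
  assumes "\<And>x. x \<in> {0..1} \<Longrightarrow> Z x = G x - G' x" "x \<in> {0..1}"
  shows "(push ^^ n) Z x = (push ^^ n) G x - (push ^^ n) G' x"
  using assms(2)
proof (induction n arbitrary: x)
  case (Suc n)
  then show ?case using push_diff[of "(push ^^ n) Z" "(push ^^ n) G" "(push ^^ n) G'" x] by simp
qed (simp add: assms(1))

lemma coupled_push_iter: 
  assumes "coupled r Z" shows "coupled r ((push ^^ n) Z)"
proof -
  obtain G G' where G: "decr_cdf G" "decr_cdf G'" "G 1 = G' 1" "G 1 \<le> r" 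
    and Z: "\<And>x. x \<in> {0..1} \<Longrightarrow> Z x = G x - G' x" using assms unfolding coupled_def by auto
  show ?thesis unfolding coupled_def
    by (rule exI[of _ "(push ^^ n) G"], rule exI[of _ "(push ^^ n) G'"])
      (use G push_iter_diff[OF Z] in \<open>auto intro: decr_cdf_push_iter simp: push_iter_1\<close>)
qed

text \<open>Only the mass in excess of \<open>cusp_mass n\<close> is subject to the minorization, so
  only r contracts; the term \<open>cusp_mass n\<close> does not accumulate over the blocks.\<close>

lemma coupled_mixing:
  assumes "coupled (r + cusp_mass n) Z" "0 \<le> r"
  shows "coupled ((1 - mixing_const) * r + cusp_mass n) ((push ^^ (mixing_depth + n)) Z)"
proof -
  let ?N = "mixing_depth + n"
  obtain G G' where G: "decr_cdf G" "decr_cdf G'" "G 1 = G' 1" "G 1 \<le> r + cusp_mass n" 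
    and Z: "\<And>x. x \<in> {0..1} \<Longrightarrow> Z x = G x - G' x" using assms unfolding coupled_def by auto
  have PZ: "(push ^^ ?N) Z x = (push ^^ ?N) G x - (push ^^ ?N) G' x" if "x \<in> {0..1}" for x
    by (rule push_iter_diff[OF Z that])
  note dG = decr_cdf_push_iter[OF G(1), of ?N] and dG' = decr_cdf_push_iter[OF G(2), of ?N]
  show ?thesis
  proof (cases "cusp_mass n \<le> G 1")
    case True
    define s where "s = mixing_const * (G 1 - cusp_mass n)"
    have s: "0 \<le> s" using True mixing_const by (simp add: s_def)
    have "min_slope s 1 ((push ^^ ?N) G)" "min_slope s 1 ((push ^^ ?N) G')"
      using min_slope_mixing[OF G(1)] min_slope_mixing[OF G(2)] True G(3) by (auto simp: s_def)
    then have d: "decr_cdf (\<lambda>x. (push ^^ ?N) G x - s * x)" "decr_cdf (\<lambda>x. (push ^^ ?N) G' x - s * x)"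
      using dG dG' s by (auto intro!: decr_cdf_diff_linear)
    have "G 1 - s = (1 - mixing_const) * (G 1 - cusp_mass n) + cusp_mass n" 
      by (simp add: s_def algebra_simps)
    also have "\<dots> \<le> (1 - mixing_const) * r + cusp_mass n"
      using G(4) mixing_const by (intro add_right_mono mult_left_mono) auto
    finally show ?thesis unfolding coupled_def using d G(3) PZ
      by (intro exI[of _ "\<lambda>x. (push ^^ ?N) G x - s * x"] exI[of _ "\<lambda>x. (push ^^ ?N) G' x - s * x"])
        (auto simp: push_iter_1)
  next
    case False
    \<comment> \<open>The common mass is already below \<open>cusp_mass n\<close>, so the bound
      holds with nothing split off.\<close>
    moreover have "0 \<le> (1 - mixing_const) * r" using mixing_const assms by auto
    ultimately show ?thesis unfolding coupled_def using dG dG' G(3) PZ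
      by (intro exI[of _ "(push ^^ ?N) G"] exI[of _ "(push ^^ ?N) G'"])
        (auto simp: push_iter_1)
  qed
qed

definition coupling_bound :: "nat \<Rightarrow> nat \<Rightarrow> real" where
  "coupling_bound k n = (1 - mixing_const) ^ k + cusp_mass n"

text \<open>After k full blocks the leftover steps are harmless, since \<open>push\<close> keeps the
  masses of both remainders. The geometric term starts at 1 because
  \<open>F 1 \<le> 1\<close>.\<close>

lemma coupled_push:
  assumes F: "decr_cdf F" "decr_cdf F'" "F 1 = F' 1" and Z: "\<And>x. x \<in> {0..1} \<Longrightarrow> Z x = F x - F' x" 
    and N: "k * (mixing_depth + n) \<le> N"
  shows "coupled (coupling_bound k n) ((push ^^ N) Z)"
proof -
  have "coupled ((1 - mixing_const) ^ k + cusp_mass n) ((push ^^ (k * (mixing_depth + n))) Z)"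
  proof (induction k)
    case 0
    show ?case unfolding coupled_def using F Z decr_cdfD(4)[OF F(1)] cusp_mass_pos[of n] 
      by (intro exI[of _ F] exI[of _ F']) auto
  next
    case (Suc k)
    then show ?case using coupled_mixing[OF Suc.IH] mixing_const 
      by (simp add: funpow_add[of "mixing_depth + n"] del: funpow_add)
  qed
  from coupled_push_iter[OF this, of "N - k * (mixing_depth + n)"] show ?thesis
    using N funpow_add[of "N - k * (mixing_depth + n)" "k * (mixing_depth + n)" push]
    by (simp add: coupling_bound_def)
qed

text \<open>A nonincreasing density of mass at most r is at most r / a to the right of a. Both
  increments thus lie between 0 and the bound, and so does the modulus of their difference.\<close>

lemma coupled_increment:
  assumes "coupled r Z" "0 < a" "a \<le> b" "b \<le> 1"
  shows "\<bar>Z b - Z a\<bar> \<le> r * (b - a) / a"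
proof -
  obtain G G' where G: "decr_cdf G" "decr_cdf G'" "G 1 = G' 1" "G 1 \<le> r" 
    and Z: "\<And>x. x \<in> {0..1} \<Longrightarrow> Z x = G x - G' x" using assms unfolding coupled_def by auto
  have *: "0 \<le> H b - H a \<and> H b - H a \<le> r * (b - a) / a" if H: "decr_cdf H" "H 1 \<le> r" for H
  proof -
    have "(H b - H a) * (a - 0) \<le> (H a - H 0) * (b - a)"
      using assms decr_cdf_three_points[OF H(1), of 0 a b] by auto
    also have "\<dots> \<le> r * (b - a)"
      using decr_cdf_mono[OF H(1), of a 1] H assms decr_cdfD(3)[OF H(1)] by (intro mult_right_mono) auto
    finally show ?thesis using assms decr_cdf_mono[OF H(1), of a b] by (auto simp: field_simps)
  qed
  show ?thesis using *[of G] *[of G'] G Z[of a] Z[of b] assms by auto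
qed

lemma coupled_bound:
  assumes "coupled r Z" "x \<in> {0..1}" shows "\<bar>Z x\<bar> \<le> r"
proof -
  obtain G G' where G: "decr_cdf G" "decr_cdf G'" "G 1 = G' 1" "G 1 \<le> r" 
    and Z: "\<And>x. x \<in> {0..1} \<Longrightarrow> Z x = G x - G' x" using assms unfolding coupled_def by auto
  show ?thesis using decr_cdf_nonneg[OF G(1) assms(2)] decr_cdf_nonneg[OF G(2) assms(2)] 
    decr_cdf_mono[OF G(1), of x 1] decr_cdf_mono[OF G(2), of x 1] G Z[of x] assms by auto
qed

text \<open>This is restriction to \<open>{..t}\<close>, the effect of multiplying a density by the
  indicator of a half-line: cutting off a nonincreasing density leaves it nonincreasing.\<close>

lemma decr_cdf_min: 
  assumes F: "decr_cdf F" and t: "0 \<le> t"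
  shows "decr_cdf (\<lambda>x. F (min x t))"
  unfolding decr_cdf_def
proof (intro conjI ballI)
  show "concave_on {0..1} (\<lambda>x. F (min x t))"
  proof (rule concave_on_compose_mono[OF _ _ decr_cdfD(1,2)[OF F]])
    show "concave_on {0..1} (\<lambda>x. min x t)"
      unfolding concave_on_iff
    proof (intro conjI ballI allI impI)
      fix x y u v :: real assume *: "0 \<le> u" "0 \<le> v" "u + v = 1"
      have "u * min x t + v * min y t \<le> u * x + v * y"
        using * by (intro add_mono mult_left_mono) auto
      moreover have "u * min x t + v * min y t \<le> u * t + v * t"
        using * by (intro add_mono mult_left_mono) auto
      moreover have "u * t + v * t = t" using * by (simp flip: distrib_right)
      ultimately show "u * min x t + v * min y t \<le> min (u *\<^sub>R x + v *\<^sub>R y) t" by simp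
    qed auto
  qed (use t in auto)
  show "mono_on {0..1} (\<lambda>x. F (min x t))"
    by (auto simp: mono_on_def t intro!: decr_cdf_mono[OF F])
  show "F (min 1 t) \<le> 1"
    using decr_cdf_mono[OF F, of "min 1 t" 1] decr_cdfD(4)[OF F] t by auto
  show "F (min x t) \<le> tail_const * x powr (1 - \<gamma>)" if "x \<in> {0..1}" for x
    using decr_cdf_mono[OF F, of "min x t" x] decr_cdfD(5)[OF F that] t that by auto
qed (use decr_cdfD(3)[OF F] t in auto)

lemma decr_cdf_ident: "decr_cdf (\<lambda>x. x)"
  unfolding decr_cdf_def
proof (intro conjI ballI)
  fix x :: real assume x: "x \<in> {0..1}"
  have "x = x powr 1" using x by simp
  also have "\<dots> \<le> x powr (1 - \<gamma>)" using x gamma_pos by (intro powr_mono') auto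
  also have "\<dots> \<le> tail_const * x powr (1 - \<gamma>)" using tail_const_ge_1 by (simp add: mult_le_cancel_right1)
  finally show "x \<le> tail_const * x powr (1 - \<gamma>)" .
qed (auto simp: mono_on_def concave_on_ident)

lemma decr_cdf_cmult: 
  assumes F: "decr_cdf F" and c: "0 \<le> c" "c \<le> 1"
  shows "decr_cdf (\<lambda>x. c * F x)"
  unfolding decr_cdf_def
proof (intro conjI ballI)
  show "concave_on {0..1} (\<lambda>x. c * F x)"
    using c decr_cdfD(1)[OF F] by (intro concave_on_cmul)
  show "mono_on {0..1} (\<lambda>x. c * F x)"
    using c decr_cdfD(2)[OF F] by (auto simp: mono_on_def intro: mult_left_mono)
  show "c * F 1 \<le> 1" using c decr_cdfD(4)[OF F] decr_cdf_nonneg[OF F, of 1] by (intro mult_le_one) auto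
  show "c * F x \<le> tail_const * x powr (1 - \<gamma>)" if "x \<in> {0..1}" for x
    using c decr_cdfD(5)[OF F that] mult_left_le_one_le[OF decr_cdf_nonneg[OF F that] c] by auto
qed (use decr_cdfD(3)[OF F] in auto)

end

section \<open>Rates\<close>

lemma eventually_block_length:
  fixes s d :: real
  assumes "0 < s" "s < 1/2"
  shows "\<forall>\<^sub>F n in sequentially. (real n + 1) powr s * (d + (real n + 1) powr (1 - 2 * s)) \<le> real n"
  using assms by real_asymp

text \<open>A stretched exponential beats every power; the -1 pays for rounding the number of blocks
  down.\<close>

lemma eventually_geometric_small:
  fixes s c p :: real
  assumes "0 < s" "0 < c" "c < 1"
  shows "\<forall>\<^sub>F n in sequentially. c powr ((real n + 1) powr s - 1) \<le> (real n + 1) powr p"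
  using assms by real_asymp


context lsv begin

lemma cusp_mass_le: "\<exists>B>0. \<forall>n. cusp_mass n \<le> B * (real n + 1) powr ((\<gamma> - 1) / \<gamma>)"
proof -
  define a where "a = (2::real) powr \<gamma> - 1"
  have a: "0 < a" using gamma_pos by (simp add: a_def)
  have e: "(-1/\<gamma>) * (1 - \<gamma>) = (\<gamma> - 1) / \<gamma>" using gamma_pos by (simp add: field_simps)
  have "cusp_mass n \<le> 2 * tail_const * a powr ((\<gamma> - 1) / \<gamma>) * (real n + 1) powr ((\<gamma> - 1) / \<gamma>)" for n
  proof -
    have "cusp_seq n powr (1 - \<gamma>) \<le> ((a * (real n + 1)) powr (-1/\<gamma>)) powr (1 - \<gamma>)"
      using cusp_seq_upper[of n] cusp_seq_pos[of n] gamma_less_1 by (intro powr_mono2) (auto simp: a_def)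
    also have "\<dots> = a powr ((\<gamma> - 1) / \<gamma>) * (real n + 1) powr ((\<gamma> - 1) / \<gamma>)"
      using a by (simp only: powr_powr e) (simp add: powr_mult)
    finally show ?thesis
      using tail_const_pos mult_left_mono[of "cusp_seq n powr (1 - \<gamma>)" _ "2 * tail_const"]
      by (simp add: cusp_mass_def mult.assoc)
  qed
  moreover have "0 < 2 * tail_const * a powr ((\<gamma> - 1) / \<gamma>)" using a tail_const_pos by simp
  ultimately show ?thesis by blast
qed

lemma rate_exponent_neg: "(\<gamma> - 1) / \<gamma> < 0"
  using gamma_pos gamma_less_1 by (simp add: field_simps)

lemma coupling_bound_pos: "0 < coupling_bound k n"
  using cusp_mass_pos[of n] mixing_const by (auto simp: coupling_bound_def intro!: add_nonneg_pos)

text \<open>About \<open>n\<^sup>s\<close> blocks of length about \<open>n\<^sup>1\<^sup>-\<^sup>2\<^sup>s\<close> make the geometric term negligible and cost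
  an arbitrarily small power in the other one.\<close>

lemma coupling_bound_rate:
  assumes \<delta>: "0 < \<delta>"
  shows "\<exists>C>0. \<forall>n. \<exists>k N. k * (mixing_depth + N) \<le> n \<and>
    coupling_bound k N \<le> C * (real n + 1) powr ((\<gamma> - 1) / \<gamma> + \<delta>)"
proof -
  define q where "q = (\<gamma> - 1) / \<gamma>"
  have q: "q < 0" using rate_exponent_neg by (simp add: q_def)
  \<comment> \<open>The first term keeps the block length a positive power of n, the second bounds
    the cost 2 s (-q) of shorter blocks by \<delta>.\<close>
  define s where "s = min (1/4) (\<delta> / (2 * - q))"
  have s: "0 < s" "s < 1/2" using \<delta> q by (auto simp: s_def divide_neg_pos zero_less_divide_iff divide_less_0_iff)
  have sq: "q * (1 - 2 * s) \<le> q + \<delta>"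
  proof -
    have "s \<le> \<delta> / (2 * - q)" by (simp add: s_def)
    then have "s * (2 * - q) \<le> \<delta>" using q by (subst (asm) pos_le_divide_eq) auto
    then show ?thesis by (simp add: algebra_simps)
  qed
  obtain B where B: "B > 0" "\<And>n. cusp_mass n \<le> B * (real n + 1) powr q"
    using cusp_mass_le unfolding q_def by blast
  have c: "0 < 1 - mixing_const" "1 - mixing_const < 1" using mixing_const by auto
  have "\<forall>\<^sub>F n in sequentially. \<exists>k N. k * (mixing_depth + N) \<le> n \<and>
    coupling_bound k N \<le> (1 + B) * (real n + 1) powr (q + \<delta>)"
    using eventually_block_length[OF s, of mixing_depth] 
      eventually_geometric_small[OF s(1) c, of q]
  proof eventually_elim
    case (elim n)
    define u where "u = real n + 1"
    have u: "1 \<le> u" by (simp add: u_def)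
    define k where "k = nat \<lfloor>u powr s\<rfloor>"
    define N where "N = nat \<lfloor>u powr (1 - 2 * s)\<rfloor>"
    have k: "real k \<le> u powr s" "u powr s - 1 \<le> real k" 
      using floor_correct[of "u powr s"] by (auto simp: k_def)
    have N: "real N \<le> u powr (1 - 2 * s)" "u powr (1 - 2 * s) \<le> real N + 1" 
      using floor_correct[of "u powr (1 - 2 * s)"] by (auto simp: N_def)
    have "real (k * (mixing_depth + N)) \<le> u powr s * (mixing_depth + u powr (1 - 2 * s))"
      using k N by (auto intro!: mult_mono)
    also have "\<dots> \<le> real n" using elim(1) by (simp add: u_def)
    finally have kN: "k * (mixing_depth + N) \<le> n" by linarith
    have "(1 - mixing_const) ^ k = (1 - mixing_const) powr k" 
      using mixing_const by (simp add: powr_realpow)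
    also have "\<dots> \<le> (1 - mixing_const) powr (u powr s - 1)"
      using k mixing_const by (intro powr_mono') auto
    also have "\<dots> \<le> u powr q" using elim(2) s mixing_const by (simp add: u_def)
    also have "\<dots> \<le> u powr (q + \<delta>)" using u \<delta> by (intro powr_mono) auto
    finally have 1: "(1 - mixing_const) ^ k \<le> u powr (q + \<delta>)" .
    have "cusp_mass N \<le> B * (real N + 1) powr q" by (rule B)
    also have "(real N + 1) powr q \<le> (u powr (1 - 2 * s)) powr q"
      using N q u by (intro powr_mono2') auto
    also have "\<dots> = u powr (q * (1 - 2 * s))" by (simp add: powr_powr mult.commute)
    also have "\<dots> \<le> u powr (q + \<delta>)" using u sq by (intro powr_mono) auto
    finally have 2: "cusp_mass N \<le> B * u powr (q + \<delta>)" using B by simp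
    show ?case using kN 1 2 by (intro exI[of _ k] exI[of _ N]) (auto simp: coupling_bound_def u_def algebra_simps)
  qed
  then obtain n0 where n0: "\<And>n. n \<ge> n0 \<Longrightarrow> \<exists>k N. k * (mixing_depth + N) \<le> n \<and>
    coupling_bound k N \<le> (1 + B) * (real n + 1) powr (q + \<delta>)" by (auto simp: eventually_sequentially)
  \<comment> \<open>For the finitely many n below \<open>n0\<close> no block is used at all; D makes
    the trivial bound \<open>coupling_bound 0 0\<close> fit.\<close>
  define D where "D = coupling_bound 0 0 * (real n0 + 1) powr -q"
  have D: "0 < D" using coupling_bound_pos by (simp add: D_def)
  have "\<exists>k N. k * (mixing_depth + N) \<le> n \<and>
      coupling_bound k N \<le> (1 + B + D) * (real n + 1) powr (q + \<delta>)" for n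
  proof (cases "n \<ge> n0")
    case True
    have "(1 + B) * (real n + 1) powr (q + \<delta>) \<le> (1 + B + D) * (real n + 1) powr (q + \<delta>)"
      using D by (intro mult_right_mono) auto
    then show ?thesis using n0[OF True] by (meson order_trans)
  next
    case False
    have "coupling_bound 0 0 = D * (real n0 + 1) powr q" by (simp add: D_def powr_minus)
    also have "(real n0 + 1) powr q \<le> (real n + 1) powr q" using False q by (intro powr_mono2') auto
    also have "(real n + 1) powr q \<le> (real n + 1) powr (q + \<delta>)" using \<delta> by (intro powr_mono) auto
    finally have "coupling_bound 0 0 \<le> D * (real n + 1) powr (q + \<delta>)" using D by simp
    also have "\<dots> \<le> (1 + B + D) * (real n + 1) powr (q + \<delta>)" using B by (intro mult_right_mono) auto
    finally show ?thesis by (intro exI[of _ 0]) auto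
  qed
  then show ?thesis using B D unfolding q_def by (intro exI[of _ "1 + B + D"]) auto
qed

text \<open>The left side is the form in which the integrated supremum gets bounded. Cutting at x =
  (n + 1)^(-1/\<gamma>) gives the first term the optimal order, and the logarithm is absorbed by one
  half of \<delta>, the coupling taking the other half.\<close>

lemma dependence_bound_rate:
  assumes \<delta>: "0 < \<delta>"
  shows "\<exists>C>0. \<forall>n. \<exists>k N x. k * (mixing_depth + N) \<le> n \<and> 0 < x \<and> x \<le> 1 \<and>
    tail_const * x powr (1 - \<gamma>) + coupling_bound k N * ln (1 / x) \<le> C * (real n + 1) powr ((\<gamma> - 1) / \<gamma> + \<delta>)"
proof -
  define q where "q = (\<gamma> - 1) / \<gamma>"
  obtain C where C: "C > 0" and CB: "\<And>n. \<exists>k N. k * (mixing_depth + N) \<le> n \<and>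
    coupling_bound k N \<le> C * (real n + 1) powr (q + \<delta> / 2)"
    using coupling_bound_rate[of "\<delta> / 2"] \<delta> unfolding q_def by auto
  define D where "D = tail_const + C * (2 / (\<gamma> * \<delta>))"
  have "\<exists>k N x. k * (mixing_depth + N) \<le> n \<and> 0 < x \<and> x \<le> 1 \<and>
    tail_const * x powr (1 - \<gamma>) + coupling_bound k N * ln (1 / x) \<le> D * (real n + 1) powr (q + \<delta>)" for n
  proof -
    obtain k N where kN: "k * (mixing_depth + N) \<le> n" 
      "coupling_bound k N \<le> C * (real n + 1) powr (q + \<delta> / 2)" using CB by blast
    define u where "u = real n + 1"
    have u: "1 \<le> u" by (simp add: u_def)
    define x where "x = u powr (-1/\<gamma>)"
    have x: "0 < x" "x \<le> 1" using u gamma_pos powr_mono2'[of "-1/\<gamma>" 1 u] by (auto simp: x_def)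
    have "x powr (1 - \<gamma>) = u powr q"
    proof -
      have "(-1/\<gamma>) * (1 - \<gamma>) = q" using gamma_pos by (simp add: q_def field_simps)
      then show ?thesis by (simp only: x_def powr_powr)
    qed
    also have "\<dots> \<le> u powr (q + \<delta>)" using u \<delta> by (intro powr_mono) auto
    finally have 1: "tail_const * x powr (1 - \<gamma>) \<le> tail_const * u powr (q + \<delta>)"
      using tail_const_pos by simp
    have "ln (1 / x) = ln u / \<gamma>" using u by (simp add: x_def ln_div ln_powr)
    also have "\<dots> \<le> (u powr (\<delta> / 2) / (\<delta> / 2)) / \<gamma>"
      using ln_powr_bound[of u "\<delta> / 2"] u \<delta> gamma_pos by (intro divide_right_mono) auto
    also have "\<dots> = 2 / (\<gamma> * \<delta>) * u powr (\<delta> / 2)" by (simp add: mult_ac)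
    finally have "coupling_bound k N * ln (1 / x) \<le> (C * u powr (q + \<delta> / 2)) * (2 / (\<gamma> * \<delta>) * u powr (\<delta> / 2))"
      using kN(2) x coupling_bound_pos[of k N] C by (intro mult_mono) (auto simp: u_def)
    also have "\<dots> = C * (2 / (\<gamma> * \<delta>)) * (u powr (q + \<delta> / 2) * u powr (\<delta> / 2))" by simp
    also have "u powr (q + \<delta> / 2) * u powr (\<delta> / 2) = u powr (q + \<delta>)" by (simp add: add.commute flip: powr_add)
    finally have "tail_const * x powr (1 - \<gamma>) + coupling_bound k N * ln (1 / x) \<le> D * u powr (q + \<delta>)"
      using 1 by (simp add: D_def distrib_right)
    then show ?thesis using kN(1) x unfolding u_def by blast
  qed
  moreover have "D > 0" using C gamma_pos \<delta> tail_const_pos by (simp add: D_def add_pos_pos)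
  ultimately show ?thesis unfolding q_def by blast
qed

lemma push_iter_fixed:
  assumes inv: "\<And>x. x \<in> {0..1} \<Longrightarrow> push F x = F x" and "x \<in> {0..1}"
  shows "(push ^^ n) F x = F x"
  using assms(2)
proof (induction n arbitrary: x)
  case (Suc n)
  have "push ((push ^^ n) F) x = push F x"
    using Suc.IH Suc.prems preim_range[OF Suc.prems] by (simp add: push_def[of F] push_def[of "(push ^^ n) F"])
  then show ?case using inv[OF Suc.prems] by simp
qed simp

text \<open>By invariance the mass between \<open>cusp_seq (Suc m)\<close> and
  \<open>cusp_seq m\<close> equals that of a piece of the right half of length
  \<open>cusp_seq m / 2\<close>, where the density is bounded below. Summing over n + 1 consecutive
  m gives the order (n + 1) (n + 1)^(-1/\<gamma>). The constant is chosen before F, to serve all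
  invariant measures.\<close>

lemma invariant_cdf_lower:
  "\<exists>C>0. \<forall>F n. decr_cdf F \<longrightarrow> F 1 = 1 \<longrightarrow> (\<forall>x\<in>{0..1}. push F x = F x) \<longrightarrow>
    C * (real n + 1) powr ((\<gamma> - 1) / \<gamma>) \<le> F (cusp_seq (Suc n)) * (1 - F (1/2))"
proof -
  define c where "c = mixing_const / 2"
  have c: "0 < c" using mixing_const by (simp add: c_def)
  define C where "C = c / 2 * 6 powr (-1/\<gamma>) * (c / 2)"
  have "C * (real n + 1) powr ((\<gamma> - 1) / \<gamma>) \<le> F (cusp_seq (Suc n)) * (1 - F (1/2))"
    if F: "decr_cdf F" and F1: "F 1 = 1" and inv: "\<And>x. x \<in> {0..1} \<Longrightarrow> push F x = F x" for F n
  proof -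
    \<comment> \<open>The depth doubles as the block parameter n: one block with at least half of
      the mass in excess gives the invariant F a density of at least
      \<open>mixing_const / 2\<close>.\<close>
    have half: "cusp_mass mixing_depth \<le> 1/2" using mixing_depth by (simp add: cusp_mass_def)
    have "min_slope (mixing_const * (1 - cusp_mass mixing_depth)) 1 F"
      using min_slope_mixing[OF F, of mixing_depth] half F1 push_iter_fixed[OF inv]
      by (simp add: min_slope_def del: funpow_add)
    moreover have "c \<le> mixing_const * (1 - cusp_mass mixing_depth)"
      using half mixing_const mult_left_mono[of "1/2" "1 - cusp_mass mixing_depth" mixing_const] 
      by (simp add: c_def)
    ultimately have sl: "c * (v - u) \<le> F v - F u" if "0 \<le> u" "u \<le> v" "v \<le> 1" for u v
      using that mult_right_mono[of c "mixing_const * (1 - cusp_mass mixing_depth)" "v - u"]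
      unfolding min_slope_def by (meson diff_ge_0_iff_ge order_trans)
    have step: "F (cusp_seq (Suc m)) + c / 2 * cusp_seq m \<le> F (cusp_seq m)" for m
      using inv[OF cusp_seq_range[of m]] sl[of "1/2" "(1 + cusp_seq m) / 2"] cusp_seq_range[of m]
      by (simp add: push_def cusp_seq_Suc) (simp add: field_simps)
    have sum: "F (cusp_seq (m + l)) + c / 2 * real l * cusp_seq (m + l) \<le> F (cusp_seq m)" for m l
    proof (induction l)
      case (Suc l)
      have "c / 2 * real (Suc l) * cusp_seq (Suc (m + l)) \<le> c / 2 * real (Suc l) * cusp_seq (m + l)"
        using c cusp_seq_antimono[of "m + l" "Suc (m + l)"] by (intro mult_left_mono) auto
      then show ?case using Suc.IH step[of "m + l"] by (simp add: field_simps)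
    qed simp
    \<comment> \<open>Here 2 (2 (n + 1) + 1) = 4 n + 6 is at most 6 (n + 1), and the exponent is
      negative.\<close>
    have "(6 * (real n + 1)) powr (-1/\<gamma>) \<le> (2 * (real (Suc n + Suc n) + 1)) powr (-1/\<gamma>)"
      using gamma_pos by (intro powr_mono2') auto
    also have "\<dots> \<le> cusp_seq (Suc n + Suc n)" by (rule cusp_seq_lower)
    finally have "c / 2 * real (Suc n) * (6 * (real n + 1)) powr (-1/\<gamma>) \<le> c / 2 * real (Suc n) * cusp_seq (Suc n + Suc n)"
      using c by (intro mult_left_mono) auto
    also have "\<dots> \<le> F (cusp_seq (Suc n))"
      using sum[of "Suc n" "Suc n"] decr_cdf_nonneg[OF F cusp_seq_range[of "Suc n + Suc n"]] by linarith
    finally have *: "c / 2 * real (Suc n) * (6 * (real n + 1)) powr (-1/\<gamma>) \<le> F (cusp_seq (Suc n))" .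
    have "(real n + 1) powr ((\<gamma> - 1) / \<gamma>) = (real n + 1) powr (1 + (-1/\<gamma>))"
      using gamma_pos by (simp add: field_simps)
    also have "\<dots> = (real n + 1) * (real n + 1) powr (-1/\<gamma>)" by (subst powr_add) auto
    finally have pw: "(real n + 1) powr ((\<gamma> - 1) / \<gamma>) = (real n + 1) * (real n + 1) powr (-1/\<gamma>)" .
    then have "C * (real n + 1) powr ((\<gamma> - 1) / \<gamma>) 
        = (c / 2 * real (Suc n) * (6 * (real n + 1)) powr (-1/\<gamma>)) * (c / 2)"
    proof -
      have "(6 * (real n + 1)) powr (-1/\<gamma>) = 6 powr (-1/\<gamma>) * (real n + 1) powr (-1/\<gamma>)"
        by (rule powr_mult)
      moreover have "real (Suc n) = real n + 1" by simp
      ultimately show ?thesis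
        using pw by (simp only: C_def mult_ac)
    qed
    also have "\<dots> \<le> F (cusp_seq (Suc n)) * (1 - F (1/2))"
      using * sl[of "1/2" 1] F1 c decr_cdf_nonneg[OF F cusp_seq_range] by (intro mult_mono) auto
    finally show ?thesis .
  qed
  moreover have "C > 0" using c by (simp add: C_def)
  ultimately show ?thesis by blast
qed

end

section \<open>Images of measures under the map\<close>

abbreviation (input) unit_lebesgue :: "real measure" where
  "unit_lebesgue \<equiv> restrict_space lborel {0..1}"

lemma unit_borel_cong [measurable_cong]: "sets unit_lebesgue = sets unit_borel"
  by (simp add: unit_borel_def sets_restrict_space)

lemma space_unit_borel: "space unit_borel = {0..1}"
  by (simp add: unit_borel_def space_restrict_space)

lemma finite_measure_unit_lebesgue: "finite_measure unit_lebesgue"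
  by (intro finite_measure_restrict_space finite_measureI) (auto simp: space_restrict_space emeasure_restrict_space)

lemma borel_measurable_unit_borel:
  assumes "sets M = sets unit_borel" "f \<in> borel_measurable borel"
  shows "f \<in> borel_measurable M"
  unfolding measurable_cong_sets[OF assms(1) refl] unit_borel_def
  using assms(2) by (rule measurable_restrict_space1)

text \<open>The distribution function of the possibly signed measure with density \<phi> relative to
  M.\<close>

definition cdf_of :: "real measure \<Rightarrow> (real \<Rightarrow> real) \<Rightarrow> real \<Rightarrow> real" where
  "cdf_of M \<phi> x = (\<integral>z. \<phi> z * indicator {..x} z \<partial>M)"

lemma borel_measurable_unit_lebesgue: "f \<in> borel_measurable borel \<Longrightarrow> f \<in> borel_measurable unit_lebesgue"
  by (rule borel_measurable_unit_borel[OF unit_borel_cong])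

context lsv begin

lemma lsv_map_measurable_borel: "lsv_map \<gamma> \<in> borel_measurable borel"
  unfolding lsv_map_def by measurable

lemma lsv_map_range: assumes "x \<in> {0..1}" shows "lsv_map \<gamma> x \<in> {0..1}"
proof (cases "x < 1/2")
  case True
  then show ?thesis using assms left_branch_bij lsv_map_left[of x] by (auto simp: bij_betw_def)
qed (use assms lsv_map_right[of x] in auto)

lemma lsv_map_iter_range: "x \<in> {0..1} \<Longrightarrow> (lsv_map \<gamma> ^^ n) x \<in> {0..1}"
  by (induction n) (auto simp: lsv_map_range simp del: atLeastAtMost_iff)

lemma lsv_map_iter_measurable: "lsv_map \<gamma> ^^ n \<in> borel_measurable borel"
  by (induction n) (auto simp: comp_def intro: measurable_compose[OF _ lsv_map_measurable_borel])

text \<open>Each point has at most two preimages. It makes the orbits that hit the break point 1/2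
  negligible.\<close>

lemma countable_vimage_lsv_map_iter:
  assumes "countable S" shows "countable {z \<in> {0..1}. (lsv_map \<gamma> ^^ n) z \<in> S}"
  using assms
proof (induction n arbitrary: S)
  case 0
  then show ?case by (auto intro: countable_subset[OF _ 0])
next
  case (Suc n)
  have "{z \<in> {0..1}. lsv_map \<gamma> z \<in> S} \<subseteq> preim ` S \<union> (\<lambda>s. (1 + s) / 2) ` S"
  proof
    fix z assume z: "z \<in> {z \<in> {0..1}. lsv_map \<gamma> z \<in> S}"
    show "z \<in> preim ` S \<union> (\<lambda>s. (1 + s) / 2) ` S"
    proof (cases "z < 1/2")
      case True
      then have "z = preim (lsv_map \<gamma> z)" using z preim_left_branch[of z] lsv_map_left[of z] by simp
      then show ?thesis using z by blast
    next
      case False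
      then have "z = (1 + lsv_map \<gamma> z) / 2" using z lsv_map_right[of z] by simp
      then show ?thesis using z by blast
    qed
  qed
  then have "countable {z \<in> {0..1}. lsv_map \<gamma> z \<in> S}"
    using Suc.prems by (meson countable_Un countable_image countable_subset)
  from Suc.IH[OF this] show ?case
    by (rule countable_subset[rotated]) (auto simp: lsv_map_iter_range[unfolded atLeastAtMost_iff])
qed

text \<open>At z = 1/2 the identity fails for x < 1: the left side is 1, since 1/2 is mapped to 0,
  and the right side is 0.\<close>

lemma indicator_lsv_map:
  assumes "z \<in> {0..1}" "z \<noteq> 1/2" "x \<in> {0..1}"
  shows "(indicator {..x} (lsv_map \<gamma> z) :: real)
    = indicator {..preim x} z + indicator {..(1 + x) / 2} z - indicator {..1/2} z"
proof (cases "z < 1/2")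
  case True
  then show ?thesis using assms left_branch_le_iff[of z x] lsv_map_left[of z] 
    by (auto simp: indicator_def)
next
  case False
  then show ?thesis using assms preim_range[of x] lsv_map_right[of z] by (auto simp: indicator_def)
qed

text \<open>The bridge from measures to \<open>push\<close>, by splitting the last application of
  the map into its two branches. Absolute continuity discards the orbits through 1/2.\<close>

lemma integral_indicator_lsv_map:
  assumes M: "sets M = sets unit_borel" and ac: "absolutely_continuous unit_lebesgue M"
    and \<phi>: "integrable M \<phi>" and x: "x \<in> {0..1}"
  shows "(\<integral>z. \<phi> z * indicator {..x} ((lsv_map \<gamma> ^^ n) z) \<partial>M) = (push ^^ n) (cdf_of M \<phi>) x"
  using x
proof (induction n arbitrary: x)
  case 0
  then show ?case by (simp add: cdf_of_def)
next
  case (Suc n)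
  let ?T = "lsv_map \<gamma>"
  have sp: "space M = {0..1}" using sets_eq_imp_space_eq[OF M] by (simp add: space_unit_borel)
  have meas: "(\<lambda>z. indicator {..a} ((?T ^^ m) z) :: real) \<in> borel_measurable M" for a m
    by (intro borel_measurable_unit_borel[OF M] measurable_compose[OF lsv_map_iter_measurable]) auto
  have int: "integrable M (\<lambda>z. \<phi> z * indicator {..a} ((?T ^^ m) z))" for a m
    by (rule Bochner_Integration.integrable_bound[OF \<phi>])
      (use meas \<phi> in \<open>auto intro!: borel_measurable_times simp: indicator_def\<close>)
  have "{z \<in> {0..1}. (?T ^^ n) z \<in> {1/2}} \<in> null_sets M"
  proof -
    have "countable {z \<in> {0..1}. (?T ^^ n) z \<in> {1/2}}" by (intro countable_vimage_lsv_map_iter) auto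
    then have "{z \<in> {0..1}. (?T ^^ n) z \<in> {1/2}} \<in> null_sets unit_lebesgue"
      by (auto simp: null_sets_restrict_space countable_imp_null_set_lborel)
    then show ?thesis using ac by (auto simp: absolutely_continuous_def)
  qed
  then have ae: "AE z in M. (?T ^^ n) z \<noteq> 1/2"
    by (rule AE_I') (auto simp: sp)
  have "(\<integral>z. \<phi> z * indicator {..x} ((?T ^^ Suc n) z) \<partial>M) =
     (\<integral>z. \<phi> z * indicator {..preim x} ((?T ^^ n) z) + \<phi> z * indicator {..(1 + x) / 2} ((?T ^^ n) z)
        - \<phi> z * indicator {..1/2} ((?T ^^ n) z) \<partial>M)"
  proof (rule integral_cong_AE)
    show "AE z in M. \<phi> z * indicator {..x} ((?T ^^ Suc n) z) =
        \<phi> z * indicator {..preim x} ((?T ^^ n) z) + \<phi> z * indicator {..(1 + x) / 2} ((?T ^^ n) z)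
        - \<phi> z * indicator {..1/2} ((?T ^^ n) z)"
      using ae AE_space
    proof eventually_elim
      case (elim z)
      then have eq: "(indicator {..x} (?T ((?T ^^ n) z)) :: real) = indicator {..preim x} ((?T ^^ n) z)
          + indicator {..(1 + x) / 2} ((?T ^^ n) z) - indicator {..1/2} ((?T ^^ n) z)"
        by (intro indicator_lsv_map Suc.prems lsv_map_iter_range) (auto simp: sp)
      show ?case by (simp only: funpow.simps comp_def eq) (simp add: algebra_simps)
    qed
  qed (use int[of _ "Suc n"] int[of _ n] in \<open>auto dest!: borel_measurable_integrable intro!: borel_measurable_add borel_measurable_diff\<close>)
  also have "\<dots> = (\<integral>z. \<phi> z * indicator {..preim x} ((?T ^^ n) z) \<partial>M) +
      (\<integral>z. \<phi> z * indicator {..(1 + x) / 2} ((?T ^^ n) z) \<partial>M) - (\<integral>z. \<phi> z * indicator {..1/2} ((?T ^^ n) z) \<partial>M)"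
    using int by simp
  also have "\<dots> = (push ^^ Suc n) (cdf_of M \<phi>) x"
    using Suc.prems preim_range[OF Suc.prems] by (simp add: Suc.IH push_def[of "(push ^^ n) _"])
  finally show ?case .
qed

section \<open>Loss of memory of the initial density\<close>

text \<open>It compares, at the point x, the n-th image of the measure with Lebesgue density \<phi>
  with that of Lebesgue measure scaled to the same mass. It is linear in \<phi> and bounded by the
  L1 norm for all n at once.\<close>

definition discrepancy :: "real \<Rightarrow> nat \<Rightarrow> (real \<Rightarrow> real) \<Rightarrow> real" where
  "discrepancy x n \<phi> = (\<integral>z. \<phi> z * (indicator {..x} ((lsv_map \<gamma> ^^ n) z) - (push ^^ n) (\<lambda>x. x) x) \<partial>unit_lebesgue)"

lemma integrable_discrepancy:
  assumes \<phi>: "integrable unit_lebesgue \<phi>" and x: "x \<in> {0..1}"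
  shows "integrable unit_lebesgue (\<lambda>z. \<phi> z * (indicator {..x} ((lsv_map \<gamma> ^^ n) z) - (push ^^ n) (\<lambda>x. x) x))"
    and "\<bar>discrepancy x n \<phi>\<bar> \<le> (\<integral>z. \<bar>\<phi> z\<bar> \<partial>unit_lebesgue)"
proof -
  let ?c = "(push ^^ n) (\<lambda>x. x) x"
  let ?f = "\<lambda>z. \<phi> z * (indicator {..x} ((lsv_map \<gamma> ^^ n) z) - ?c)"
  have d: "decr_cdf ((push ^^ n) (\<lambda>x. x))" by (rule decr_cdf_push_iter[OF decr_cdf_ident])
  have c: "0 \<le> ?c" "?c \<le> 1"
    using decr_cdf_nonneg[OF d x] decr_cdf_mono[OF d, of x 1] decr_cdfD(4)[OF d] x by auto
  have le: "\<bar>?f z\<bar> \<le> \<bar>\<phi> z\<bar>" for z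
    using c by (auto simp: indicator_def abs_mult mult_left_le)
  have "(\<lambda>z. indicator {..x} ((lsv_map \<gamma> ^^ n) z) :: real) \<in> borel_measurable unit_lebesgue"
    by (intro borel_measurable_unit_lebesgue measurable_compose[OF lsv_map_iter_measurable]) auto
  then show int: "integrable unit_lebesgue ?f"
    using le \<phi> by (intro Bochner_Integration.integrable_bound[OF \<phi>]) auto
  have "\<bar>discrepancy x n \<phi>\<bar> \<le> (\<integral>z. \<bar>?f z\<bar> \<partial>unit_lebesgue)"
    unfolding discrepancy_def by (rule integral_abs_bound)
  also have "\<dots> \<le> (\<integral>z. \<bar>\<phi> z\<bar> \<partial>unit_lebesgue)"
    using int \<phi> le by (intro integral_mono) auto
  finally show "\<bar>discrepancy x n \<phi>\<bar> \<le> (\<integral>z. \<bar>\<phi> z\<bar> \<partial>unit_lebesgue)" .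
qed

lemma discrepancy_add:
  assumes "integrable unit_lebesgue f" "integrable unit_lebesgue g" "x \<in> {0..1}"
  shows "discrepancy x n (\<lambda>z. f z + g z) = discrepancy x n f + discrepancy x n g"
  using integrable_discrepancy(1)[OF assms(1,3)] integrable_discrepancy(1)[OF assms(2,3)]
  by (simp add: discrepancy_def distrib_right)

lemma discrepancy_cmult: "discrepancy x n (\<lambda>z. c * f z) = c * discrepancy x n f"
  by (simp add: discrepancy_def mult.assoc)

text \<open>The L1 bound is uniform in n, so convergence to 0 passes to L1 limits.\<close>

lemma discrepancy_closed:
  assumes f: "integrable unit_lebesgue f" and g: "\<And>i. integrable unit_lebesgue (g i)" 
    and x: "x \<in> {0..1}" and lim: "\<And>i. (\<lambda>n. discrepancy x n (g i)) \<longlonglongrightarrow> 0"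
    and conv: "(\<lambda>i. \<integral>z. \<bar>f z - g i z\<bar> \<partial>unit_lebesgue) \<longlonglongrightarrow> 0"
  shows "(\<lambda>n. discrepancy x n f) \<longlonglongrightarrow> 0"
proof (rule LIMSEQ_I)
  fix r :: real assume r: "0 < r"
  obtain i where i: "(\<integral>z. \<bar>f z - g i z\<bar> \<partial>unit_lebesgue) < r / 2"
    using order_tendstoD(2)[OF conv, of "r / 2"] r by (auto simp: eventually_sequentially)
  obtain n0 where n0: "\<And>n. n \<ge> n0 \<Longrightarrow> \<bar>discrepancy x n (g i)\<bar> < r / 2"
    using LIMSEQ_D[OF lim[of i], of "r / 2"] r by auto
  have "\<bar>discrepancy x n f\<bar> < r" if "n \<ge> n0" for n
  proof -
    have "discrepancy x n f = discrepancy x n (g i) + discrepancy x n (\<lambda>z. f z - g i z)"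
      using discrepancy_add[OF g[of i] Bochner_Integration.integrable_diff[OF f g[of i]] x, of n] by simp
    moreover have "\<bar>discrepancy x n (\<lambda>z. f z - g i z)\<bar> \<le> (\<integral>z. \<bar>f z - g i z\<bar> \<partial>unit_lebesgue)"
      using f g x by (intro integrable_discrepancy) auto
    ultimately show ?thesis using i n0[OF that] by linarith
  qed
  then show "\<exists>no. \<forall>n\<ge>no. norm (discrepancy x n f - 0) < r" by auto
qed

lemma coupled_tendsto_0:
  assumes "\<And>k N n. k * (mixing_depth + N) \<le> n \<Longrightarrow> \<bar>z n\<bar> \<le> coupling_bound k N"
  shows "z \<longlonglongrightarrow> (0::real)"
proof -
  define q where "q = (\<gamma> - 1) / \<gamma>"
  have q: "q < 0" using rate_exponent_neg by (simp add: q_def)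
  \<comment> \<open>Half of the decay rate is given away as \<delta>; the remaining exponent q / 2
    is still negative.\<close>
  obtain C where C: "C > 0" and CB: "\<And>n. \<exists>k N. k * (mixing_depth + N) \<le> n \<and>
    coupling_bound k N \<le> C * (real n + 1) powr (q + - q / 2)"
    using coupling_bound_rate[of "- q / 2"] q unfolding q_def by auto
  have "\<bar>z n\<bar> \<le> C * (real n + 1) powr (q / 2)" for n
    using CB[of n] assms by (auto intro: order_trans)
  moreover have "(\<lambda>n. C * (real n + 1) powr (q / 2)) \<longlonglongrightarrow> 0"
    using q by real_asymp
  ultimately show ?thesis by (intro Lim_null_comparison[of z]) auto
qed

text \<open>The case that coupling handles directly: Lebesgue measure on \<open>{0..t}\<close> and t
  times Lebesgue measure both have nonincreasing densities and mass t.\<close>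

lemma discrepancy_interval:
  assumes t: "0 \<le> t" "t \<le> 1" and x: "x \<in> {0..1}"
  shows "(\<lambda>n. discrepancy x n (indicator {..t})) \<longlonglongrightarrow> 0"
proof (rule coupled_tendsto_0)
  fix k N n assume kN: "k * (mixing_depth + N) \<le> n"
  interpret finite_measure unit_lebesgue by (rule finite_measure_unit_lebesgue)
  let ?Z = "\<lambda>x. min x t - t * x"
  have int: "integrable unit_lebesgue (indicator {..t} :: real \<Rightarrow> real)"
    by (intro integrable_const_bound[where B = 1] borel_measurable_unit_lebesgue) (auto simp: indicator_def)
  have leb: "measure unit_lebesgue ({0..1} \<inter> {..s}) = s" if "0 \<le> s" "s \<le> 1" for s :: real
  proof -
    have "{0..1} \<inter> {..s} = {0..s}" using that by auto
    then show ?thesis using that by (simp add: measure_restrict_space)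
  qed
  have cdf: "cdf_of unit_lebesgue (indicator {..t}) y = min y t" if "y \<in> {0..1}" for y
  proof -
    have "cdf_of unit_lebesgue (indicator {..t}) y = (\<integral>z. indicator ({0..1} \<inter> {..min y t}) z \<partial>unit_lebesgue)"
      unfolding cdf_of_def
      by (intro Bochner_Integration.integral_cong refl) (auto simp: space_restrict_space indicator_def)
    also have "\<dots> = min y t"
      using that t leb[of "min y t"] by (simp add: space_restrict_space Int_commute)
    finally show ?thesis .
  qed
  have ac: "absolutely_continuous unit_lebesgue unit_lebesgue" by (simp add: absolutely_continuous_def)
  have "discrepancy x n (indicator {..t}) 
      = (\<integral>z. indicator {..t} z * indicator {..x} ((lsv_map \<gamma> ^^ n) z) \<partial>unit_lebesgue)
        - (\<integral>z. indicator {..t} z * (push ^^ n) (\<lambda>x. x) x \<partial>unit_lebesgue)"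
  proof -
    have "integrable unit_lebesgue (\<lambda>z. indicator {..t} z * indicator {..x} ((lsv_map \<gamma> ^^ n) z) :: real)"
      by (intro integrable_const_bound[where B = 1] borel_measurable_unit_lebesgue borel_measurable_times
         measurable_compose[OF lsv_map_iter_measurable])
        (auto simp: indicator_def)
    then show ?thesis unfolding discrepancy_def using int by (simp add: right_diff_distrib)
  qed
  also have "(\<integral>z. indicator {..t} z * indicator {..x} ((lsv_map \<gamma> ^^ n) z) \<partial>unit_lebesgue)
      = (push ^^ n) (cdf_of unit_lebesgue (indicator {..t})) x"
    using unit_borel_cong ac int x by (rule integral_indicator_lsv_map)
  also have "(\<integral>z. indicator {..t} z * (push ^^ n) (\<lambda>x. x) x \<partial>unit_lebesgue) = t * (push ^^ n) (\<lambda>x. x) x"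
  proof -
    have "(\<integral>z. indicator {..t} z \<partial>unit_lebesgue) = cdf_of unit_lebesgue (indicator {..t}) 1"
      unfolding cdf_of_def
      by (intro Bochner_Integration.integral_cong refl) (auto simp: space_restrict_space indicator_def)
    then show ?thesis using cdf[of 1] t by simp
  qed
  also have "t * (push ^^ n) (\<lambda>x. x) x = (push ^^ n) (\<lambda>x. t * x) x"
    using x
  proof (induction n arbitrary: x)
    case (Suc n)
    then show ?case using preim_range[of x] by (simp add: push_def[of "(push ^^ n) _"] algebra_simps flip: Suc.IH)
  qed simp
  also have "(push ^^ n) (cdf_of unit_lebesgue (indicator {..t})) x - (push ^^ n) (\<lambda>x. t * x) x = (push ^^ n) ?Z x"
    by (rule push_iter_diff[symmetric]) (use cdf x in auto)
  finally have eq: "discrepancy x n (indicator {..t}) = (push ^^ n) ?Z x" .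
  have "coupled (coupling_bound k N) ((push ^^ n) ?Z)"
    by (rule coupled_push[OF decr_cdf_min[OF decr_cdf_ident t(1)] decr_cdf_cmult[OF decr_cdf_ident t] _ _ kN])
      (use t in auto)
  then show "\<bar>discrepancy x n (indicator {..t})\<bar> \<le> coupling_bound k N"
    using coupled_bound[OF _ x] eq by metis
qed

end

section \<open>Invariant distribution functions\<close>

context lsv begin

text \<open>From half-lines to Borel sets along a generator stable under intersection; countable
  disjoint unions are L1 limits of finite ones.\<close>

lemma discrepancy_set:
  assumes x: "x \<in> {0..1}" and A: "A \<in> sets borel"
  shows "(\<lambda>n. discrepancy x n (indicator A)) \<longlonglongrightarrow> 0"
proof -
  interpret finite_measure unit_lebesgue by (rule finite_measure_unit_lebesgue)
  have int: "integrable unit_lebesgue (indicator B :: real \<Rightarrow> real)" if "B \<in> sets borel" for B :: "real set"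
    using that by (intro integrable_const_bound[where B = 1] borel_measurable_unit_lebesgue) (auto simp: indicator_def)
  have cong: "discrepancy x n f = discrepancy x n g" if "\<And>z. z \<in> {0..1} \<Longrightarrow> f z = g z" for f g n
    unfolding discrepancy_def
    by (intro Bochner_Integration.integral_cong refl) (use that in \<open>auto simp: space_restrict_space\<close>)
  have ivl: "(\<lambda>n. discrepancy x n (indicator {..t})) \<longlonglongrightarrow> 0" for t :: real
  proof (cases "0 \<le> t")
    case True
    have "discrepancy x n (indicator {..t}) = discrepancy x n (indicator {..min t 1})" for n
      by (rule cong) (auto simp: indicator_def)
    then show ?thesis using discrepancy_interval[OF _ _ x, of "min t 1"] True by simp
  next
    case False
    then have "discrepancy x n (indicator {..t}) = discrepancy x n (\<lambda>_. 0)" for n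
      by (intro cong) (auto simp: indicator_def)
    then show ?thesis by (simp add: discrepancy_def)
  qed
  have sb: "sets borel = sigma_sets UNIV (range (\<lambda>t::real. {..t}))"
    by (subst borel_eq_atMost) (simp add: sets_measure_of)
  have "Int_stable (range (\<lambda>t::real. {..t}))"
    by (auto simp: Int_stable_def)
  moreover have "range (\<lambda>t::real. {..t}) \<subseteq> Pow UNIV" by simp
  moreover have "A \<in> sigma_sets UNIV (range (\<lambda>t::real. {..t}))" using A sb by simp
  ultimately show ?thesis
  proof (induction rule: sigma_sets_induct_disjoint)
    case (basic A)
    then show ?case using ivl by auto
  next
    case empty
    then show ?case by (simp add: discrepancy_def)
  next
    case (compl A)
    then have A: "A \<in> sets borel" using sb by simp
    have "discrepancy x n (indicator (UNIV - A)) 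
        = discrepancy x n (indicator {..1}) + -1 * discrepancy x n (indicator A)" for n
    proof -
      have "discrepancy x n (indicator (UNIV - A)) = discrepancy x n (\<lambda>z. indicator {..1} z + -1 * indicator A z)"
        by (rule cong) (auto simp: indicator_def)
      also have "\<dots> = discrepancy x n (indicator {..1}) + discrepancy x n (\<lambda>z. -1 * indicator A z)"
        using int[of "{..1}"] int[OF A] by (intro discrepancy_add x) auto
      finally show ?thesis by (simp only: discrepancy_cmult)
    qed
    then show ?case using tendsto_diff[OF ivl[of 1] compl(2)] by simp
  next
    case (union A)
    then have A: "A i \<in> sets borel" for i using sb by auto
    show ?case
    proof (rule discrepancy_closed[OF _ _ x])
      show "integrable unit_lebesgue (indicator (\<Union>i. A i) :: real \<Rightarrow> real)" using A by (intro int) auto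
      show "integrable unit_lebesgue (indicator (\<Union>i<m. A i) :: real \<Rightarrow> real)" for m using A by (intro int) auto
      show "(\<lambda>n. discrepancy x n (indicator (\<Union>i<m. A i))) \<longlonglongrightarrow> 0" for m
      proof (induction m)
        case 0
        then show ?case by (simp add: discrepancy_def)
      next
        case (Suc m)
        have "discrepancy x n (indicator (\<Union>i<Suc m. A i)) 
          = discrepancy x n (indicator (\<Union>i<m. A i)) + discrepancy x n (indicator (A m))" for n
        proof -
          have "A i \<inter> A m = {}" if "i < m" for i
            using disjoint_family_onD[OF union(1), of i m] that by simp
          then have eq: "indicator (\<Union>i<Suc m. A i) = (\<lambda>z. indicator (\<Union>i<m. A i) z + indicator (A m) z :: real)"
            by (intro ext) (auto simp: lessThan_Suc indicator_def)
          show ?thesis unfolding eq using A by (intro discrepancy_add int x) auto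
        qed
        then show ?case using tendsto_add[OF Suc.IH union(3)[of m]] by simp
      qed
      have "(\<lambda>m. \<integral>z. \<bar>indicator (\<Union>i. A i) z - indicator (\<Union>i<m. A i) z :: real\<bar> \<partial>unit_lebesgue) 
          \<longlonglongrightarrow> (\<integral>z. (0::real) \<partial>unit_lebesgue)"
      proof (rule integral_dominated_convergence[where w = "\<lambda>_. 1"])
        show "AE z in unit_lebesgue. (\<lambda>m. \<bar>indicator (\<Union>i. A i) z - indicator (\<Union>i<m. A i) z :: real\<bar>) \<longlonglongrightarrow> 0"
        proof (rule AE_I2, rule tendsto_eventually)
          fix z
          show "\<forall>\<^sub>F m in sequentially. \<bar>indicator (\<Union>i. A i) z - indicator (\<Union>i<m. A i) z :: real\<bar> = 0"
          proof (cases "\<exists>i. z \<in> A i")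
            case True
            then obtain i where "z \<in> A i" by blast
            then have "m > i \<Longrightarrow> \<bar>indicator (\<Union>i. A i) z - indicator (\<Union>i<m. A i) z :: real\<bar> = 0" for m
              by (auto simp: indicator_def)
            then show ?thesis by (intro eventually_mono[OF eventually_gt_at_top[of i]]) blast
          qed (auto simp: indicator_def)
        qed
      qed (use A in \<open>auto intro!: borel_measurable_unit_lebesgue simp: indicator_def\<close>)
      then show "(\<lambda>m. \<integral>z. \<bar>indicator (\<Union>i. A i) z - indicator (\<Union>i<m. A i) z :: real\<bar> \<partial>unit_lebesgue) \<longlonglongrightarrow> 0"
        by simp
    qed
  qed
qed

lemma discrepancy_tendsto_0:
  assumes x: "x \<in> {0..1}" and f: "integrable unit_lebesgue f"
  shows "(\<lambda>n. discrepancy x n f) \<longlonglongrightarrow> 0"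
  using f
proof (induction rule: integrable_induct)
  case (base A c)
  then have A: "A \<in> sets borel" by (auto simp: sets_restrict_space)
  have "discrepancy x n (\<lambda>z. indicator A z *\<^sub>R c) = c * discrepancy x n (indicator A)" for n
    by (simp add: mult.commute flip: discrepancy_cmult)
  then show ?case using tendsto_mult_left[OF discrepancy_set[OF x A], of c] by simp
next
  case (add f g)
  then show ?case using tendsto_add[OF add.IH] x add.hyps by (simp add: discrepancy_add)
next
  case (lim f s)
  show ?case
  proof (rule discrepancy_closed[OF lim.hyps(4) lim.hyps(1) x lim.IH])
    have "(\<lambda>i. \<integral>z. \<bar>f z - s i z\<bar> \<partial>unit_lebesgue) \<longlonglongrightarrow> (\<integral>z. (0::real) \<partial>unit_lebesgue)"
    proof (rule integral_dominated_convergence[where w = "\<lambda>z. 3 * \<bar>f z\<bar>"])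
      show "AE z in unit_lebesgue. (\<lambda>i. \<bar>f z - s i z\<bar>) \<longlonglongrightarrow> 0"
        using lim.hyps(2) by (intro AE_I2 tendsto_rabs_zero) (auto intro!: tendsto_eq_intros)
      show "AE z in unit_lebesgue. norm \<bar>f z - s i z\<bar> \<le> 3 * \<bar>f z\<bar>" for i
      proof (rule AE_I2)
        fix z assume "z \<in> space unit_lebesgue"
        then show "norm \<bar>f z - s i z\<bar> \<le> 3 * \<bar>f z\<bar>" using lim.hyps(3)[of z i] by auto
      qed
    qed (use lim.hyps(1,4) in auto)
    then show "(\<lambda>i. \<integral>z. \<bar>f z - s i z\<bar> \<partial>unit_lebesgue) \<longlonglongrightarrow> 0" by simp
  qed
qed

end

locale lsv_invariant = lsv +
  fixes \<nu> :: "real measure"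
  assumes acim: "lsv_acim \<gamma> \<nu>"
begin

sublocale prob_space \<nu> using acim by (simp add: lsv_acim_def)

lemma sets_nu: "sets \<nu> = sets unit_borel" and ac_nu: "absolutely_continuous unit_lebesgue \<nu>"
  and distr_nu: "distr \<nu> unit_borel (lsv_map \<gamma>) = \<nu>"
  using acim by (auto simp: lsv_acim_def)

lemma space_nu: "space \<nu> = {0..1}"
  using sets_eq_imp_space_eq[OF sets_nu] by (simp add: space_unit_borel)

lemma measurable_nu: "f \<in> borel_measurable borel \<Longrightarrow> f \<in> borel_measurable \<nu>"
  by (rule borel_measurable_unit_borel[OF sets_nu])

lemma integrable_bounded:
  assumes "\<phi> \<in> borel_measurable \<nu>" "\<And>z. z \<in> {0..1} \<Longrightarrow> \<bar>\<phi> z\<bar> \<le> B"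
  shows "integrable \<nu> (\<phi> :: real \<Rightarrow> real)"
  using assms by (intro integrable_const_bound[where B = B]) (auto simp: space_nu)

lemma lsv_map_measurable_nu: "lsv_map \<gamma> \<in> \<nu> \<rightarrow>\<^sub>M unit_borel"
  unfolding unit_borel_def
  by (intro measurable_restrict_space2 measurable_nu lsv_map_measurable_borel)
    (use lsv_map_range in \<open>auto simp: space_nu\<close>)

abbreviation inv_cdf :: "real \<Rightarrow> real" where
  "inv_cdf \<equiv> cdf_of \<nu> (\<lambda>_. 1)"

lemma push_inv_cdf:
  assumes x: "x \<in> {0..1}" shows "push inv_cdf x = inv_cdf x"
proof -
  have "push inv_cdf x = (\<integral>z. 1 * indicator {..x} ((lsv_map \<gamma> ^^ 1) z) \<partial>\<nu>)"
    using integral_indicator_lsv_map[OF sets_nu ac_nu _ x, of "\<lambda>_. 1" 1] by simp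
  also have "\<dots> = (\<integral>z. indicator {..x} z \<partial>distr \<nu> unit_borel (lsv_map \<gamma>))"
    using integral_distr[OF lsv_map_measurable_nu borel_measurable_unit_borel[OF refl], of "indicator {..x} :: real \<Rightarrow> real"] 
    by (simp del: Bochner_Integration.integral_indicator)
  also have "\<dots> = inv_cdf x" unfolding distr_nu cdf_of_def by simp
  finally show ?thesis .
qed

lemma density_ex:
  obtains h where "h \<in> borel_measurable unit_lebesgue" "\<And>x. 0 \<le> h x" "integrable unit_lebesgue h"
    "\<nu> = density unit_lebesgue (\<lambda>x. ennreal (h x))"
proof -
  interpret L: finite_measure unit_lebesgue by (rule finite_measure_unit_lebesgue)
  have s: "sets \<nu> = sets unit_lebesgue" by (simp add: sets_nu unit_borel_cong)
  obtain h where h: "h \<in> borel_measurable unit_lebesgue" 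
    "AE x in unit_lebesgue. RN_deriv unit_lebesgue \<nu> x = ennreal (h x)" "\<And>x. 0 \<le> h x"
    using L.real_RN_deriv[OF finite_measure_axioms ac_nu s] by blast
  have "\<nu> = density unit_lebesgue (RN_deriv unit_lebesgue \<nu>)"
    using L.density_RN_deriv[OF ac_nu s] by simp
  also have "\<dots> = density unit_lebesgue (\<lambda>x. ennreal (h x))"
    using h by (intro density_cong) auto
  finally have eq: "\<nu> = density unit_lebesgue (\<lambda>x. ennreal (h x))" .
  have "integrable \<nu> (\<lambda>_. 1 :: real)" by simp
  then have "integrable unit_lebesgue h"
    using h by (subst (asm) eq, subst (asm) integrable_density) auto
  then show ?thesis using that h eq by blast
qed

lemma inv_cdf_1: "inv_cdf 1 = 1"
proof -
  have "inv_cdf 1 = (\<integral>z. 1 \<partial>\<nu>)" unfolding cdf_of_def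
    by (intro Bochner_Integration.integral_cong) (auto simp: space_nu)
  then show ?thesis by (simp add: prob_space)
qed

text \<open>This contains the uniqueness of the invariant measure.\<close>

lemma inv_cdf_limit:
  assumes x: "x \<in> {0..1}" shows "(\<lambda>n. (push ^^ n) (\<lambda>x. x) x) \<longlonglongrightarrow> inv_cdf x"
proof -
  obtain h where h: "h \<in> borel_measurable unit_lebesgue" "\<And>x. 0 \<le> h x" "integrable unit_lebesgue h"
    and eq: "\<nu> = density unit_lebesgue (\<lambda>x. ennreal (h x))" using density_ex by blast
  have int: "(\<integral>z. f z \<partial>\<nu>) = (\<integral>z. h z * f z \<partial>unit_lebesgue)" 
    if "f \<in> borel_measurable borel" for f :: "real \<Rightarrow> real"
    unfolding eq using h that by (subst integral_density) (auto intro!: borel_measurable_unit_lebesgue)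
  have m: "(\<lambda>z. indicator {..x} ((lsv_map \<gamma> ^^ n) z) :: real) \<in> borel_measurable borel" for n
    by (intro measurable_compose[OF lsv_map_iter_measurable]) auto
  have "discrepancy x n h = inv_cdf x - (push ^^ n) (\<lambda>x. x) x" for n
  proof -
    let ?c = "(push ^^ n) (\<lambda>x. x) x"
    have "discrepancy x n h = (\<integral>z. indicator {..x} ((lsv_map \<gamma> ^^ n) z) - ?c \<partial>\<nu>)"
      unfolding discrepancy_def using m[of n] by (subst int) auto
    also have "\<dots> = (\<integral>z. indicator {..x} ((lsv_map \<gamma> ^^ n) z) \<partial>\<nu>) - ?c"
      using integrable_bounded[of "\<lambda>z. indicator {..x} ((lsv_map \<gamma> ^^ n) z)" 1] measurable_nu[OF m[of n]]
      by (simp add: prob_space)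
    also have "(\<integral>z. indicator {..x} ((lsv_map \<gamma> ^^ n) z) \<partial>\<nu>) = (push ^^ n) inv_cdf x"
      using integral_indicator_lsv_map[OF sets_nu ac_nu _ x, of "\<lambda>_. 1" n] by simp
    also have "(push ^^ n) inv_cdf x = inv_cdf x" using push_inv_cdf x by (rule push_iter_fixed)
    finally show ?thesis .
  qed
  then have "(\<lambda>n. inv_cdf x - (push ^^ n) (\<lambda>x. x) x) \<longlonglongrightarrow> 0"
    using discrepancy_tendsto_0[OF x h(3)] by simp
  from tendsto_diff[OF tendsto_const[of "inv_cdf x"] this] show ?thesis by simp
qed

text \<open>Concavity, monotonicity and the power bound survive pointwise limits, here of the images
  of Lebesgue measure.\<close>

lemma decr_cdf_inv: "decr_cdf inv_cdf"
proof -
  note d = decr_cdf_push_iter[OF decr_cdf_ident]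
  have "concave_on {0..1} inv_cdf"
    unfolding concave_on_iff
  proof (intro conjI ballI allI impI)
    fix x y u v :: real
    assume *: "x \<in> {0..1}" "y \<in> {0..1}" "0 \<le> u" "0 \<le> v" "u + v = 1"
    then have xy: "u *\<^sub>R x + v *\<^sub>R y \<in> {0..1}" by (intro convexD) auto
    show "u * inv_cdf x + v * inv_cdf y \<le> inv_cdf (u *\<^sub>R x + v *\<^sub>R y)"
    proof (rule LIMSEQ_le[OF tendsto_add[OF tendsto_mult_left[OF inv_cdf_limit[OF *(1)], of u]
        tendsto_mult_left[OF inv_cdf_limit[OF *(2)], of v]] inv_cdf_limit[OF xy]], intro exI[of _ 0] allI impI)
      fix n show "u * (push ^^ n) (\<lambda>x. x) x + v * (push ^^ n) (\<lambda>x. x) y \<le> (push ^^ n) (\<lambda>x. x) (u *\<^sub>R x + v *\<^sub>R y)"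
        using decr_cdfD(1)[OF d, of n] * by (auto simp: concave_on_iff)
    qed
  qed auto
  moreover have "mono_on {0..1} inv_cdf"
  proof (rule mono_onI)
    fix r s :: real assume *: "r \<in> {0..1}" "s \<in> {0..1}" "r \<le> s"
    show "inv_cdf r \<le> inv_cdf s"
      by (rule LIMSEQ_le[OF inv_cdf_limit[OF *(1)] inv_cdf_limit[OF *(2)]])
        (use * mono_onD[OF decr_cdfD(2)[OF d]] in blast)
  qed
  moreover have "inv_cdf 0 = 0"
    using LIMSEQ_unique[OF inv_cdf_limit[of 0] tendsto_eventually[of _ 0]] decr_cdfD(3)[OF d] by simp
  moreover have "inv_cdf x \<le> tail_const * x powr (1 - \<gamma>)" if "x \<in> {0..1}" for x
    by (rule LIMSEQ_le_const2[OF inv_cdf_limit[OF that]]) (use decr_cdfD(5)[OF d that] in auto)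
  ultimately show ?thesis by (simp add: decr_cdf_def inv_cdf_1)
qed

end

section \<open>Densities from interval estimates\<close>

text \<open>The difference of the two distribution functions is nondecreasing and right-continuous,
  hence belongs to a measure D, and N = M + D because both sides agree on half-lines.\<close>

lemma measure_le_if_Ioc_le:
  assumes M: "finite_borel_measure M" and N: "finite_borel_measure N"
    and le: "\<And>a b. a < b \<Longrightarrow> measure M {a<..b} \<le> measure N {a<..b}" and A: "A \<in> sets borel"
  shows "measure M A \<le> measure N A"
proof -
  interpret M: finite_borel_measure M by fact
  interpret N: finite_borel_measure N by fact
  define F where "F = (\<lambda>x. cdf N x - cdf M x)"
  define m where "m = measure N (space N) - measure M (space M)"
  have mono: "F x \<le> F y" if "x \<le> y" for x y
    using le[of x y] that M.cdf_diff_eq[of x y] N.cdf_diff_eq[of x y] 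
    by (cases "x = y") (auto simp: F_def)
  have cont: "continuous (at_right a) F" for a
    unfolding F_def by (intro continuous_diff M.cdf_is_right_cont N.cdf_is_right_cont)
  have bot: "(F \<longlongrightarrow> 0) at_bot"
    using tendsto_diff[OF N.cdf_lim_at_bot M.cdf_lim_at_bot] by (simp add: F_def)
  have top: "(F \<longlongrightarrow> m) at_top"
    using tendsto_diff[OF N.cdf_lim_at_top M.cdf_lim_at_top] by (simp add: F_def m_def)
  have "0 \<le> m"
  proof -
    have "0 \<le> F x" for x
      by (rule tendsto_upperbound[OF bot]) (auto intro!: mono eventually_mono[OF eventually_le_at_bot[of x]])
    then show ?thesis by (intro tendsto_lowerbound[OF top]) auto
  qed
  define D where "D = interval_measure F"
  have D: "finite_borel_measure D"
    unfolding D_def by (rule finite_borel_measure_interval_measure[OF mono cont bot top \<open>0 \<le> m\<close>])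
  interpret D: finite_borel_measure D by fact
  have D_UNIV: "measure D UNIV = m"
    using interval_measure_UNIV[OF mono cont bot top \<open>0 \<le> m\<close>] \<open>0 \<le> m\<close> by (simp add: D_def measure_def)
  have cdf_D: "measure D {..t} = F t" for t
  proof -
    have "(\<lambda>i. measure D {- real i<..t}) \<longlonglongrightarrow> measure D (\<Union>i. {- real i<..t})"
      by (intro D.finite_Lim_measure_incseq) (auto simp: incseq_def)
    also have "(\<Union>i. {- real i<..t}) = {..t}"
      by auto (metis neg_less_iff_less minus_minus reals_Archimedean2)
    finally have 1: "(\<lambda>i. measure D {- real i<..t}) \<longlonglongrightarrow> measure D {..t}" .
    have "\<forall>\<^sub>F i in sequentially. measure D {- real i<..t} = F t - F (- real i)"
      using eventually_ge_at_top[of "nat \<lceil>- t\<rceil>"]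
    proof eventually_elim
      case (elim i)
      then have "- real i \<le> t" by linarith
      then show ?case using emeasure_interval_measure_Ioc[OF _ mono cont, of "- real i" t] mono[of "- real i" t]
        by (simp add: D_def measure_def)
    qed
    moreover have "(\<lambda>i. F t - F (- real i)) \<longlonglongrightarrow> F t - 0"
      by (intro tendsto_diff tendsto_const filterlim_compose[OF bot])
        (simp add: filterlim_uminus_at_bot filterlim_real_sequentially)
    ultimately have "(\<lambda>i. measure D {- real i<..t}) \<longlonglongrightarrow> F t"
      by (auto intro: tendsto_cong[THEN iffD2])
    then show ?thesis using 1 LIMSEQ_unique by blast
  qed
  have sb: "sets borel = sigma_sets UNIV (range (\<lambda>t::real. {..t}))"
    by (subst borel_eq_atMost) (simp add: sets_measure_of)
  have "Int_stable (range (\<lambda>t::real. {..t}))"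
    by (auto simp: Int_stable_def)
  moreover have "range (\<lambda>t::real. {..t}) \<subseteq> Pow UNIV" by simp
  moreover have "A \<in> sigma_sets UNIV (range (\<lambda>t::real. {..t}))" using A sb by simp
  ultimately have "measure N A = measure M A + measure D A"
  proof (induction rule: sigma_sets_induct_disjoint)
    case (basic A)
    then show ?case by (auto simp: cdf_D F_def cdf_def)
  next
    case (compl A)
    then have "A \<in> sets borel" using sb by simp
    then show ?case using compl(2) D_UNIV N.finite_measure_compl[of A] M.finite_measure_compl[of A] D.finite_measure_compl[of A]
      by (simp add: N.borel_UNIV M.borel_UNIV D.borel_UNIV M.sets_M N.sets_M D.sets_M m_def)
  next
    case (union A)
    then have A: "range A \<subseteq> sets borel" using sb by simp
    have "(\<lambda>i. measure M (A i) + measure D (A i)) sums (measure M (\<Union>i. A i) + measure D (\<Union>i. A i))"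
      using A union(1) M.M_is_borel D.M_is_borel
      by (intro sums_add M.finite_measure_UNION D.finite_measure_UNION) auto
    moreover have "(\<lambda>i. measure N (A i)) sums measure N (\<Union>i. A i)"
      using A union(1) N.M_is_borel by (intro N.finite_measure_UNION) auto
    ultimately show ?case using union(3) sums_unique2 by simp
  qed simp
  then show ?thesis by simp
qed

lemma AE_le_if_Ioc_integral_le:
  fixes u v :: "real \<Rightarrow> real"
  assumes u: "integrable lborel u" "\<And>z. 0 \<le> u z" and v: "integrable lborel v" "\<And>z. 0 \<le> v z"
    and le: "\<And>a b. a < b \<Longrightarrow> (\<integral>z. v z * indicator {a<..b} z \<partial>lborel) \<le> (\<integral>z. u z * indicator {a<..b} z \<partial>lborel)"
  shows "AE z in lborel. v z \<le> u z"
proof -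
  have meas: "measure (density lborel (\<lambda>z. ennreal (w z))) A = (\<integral>z. w z * indicator A z \<partial>lborel)"
    and fin: "finite_borel_measure (density lborel (\<lambda>z. ennreal (w z)))"
    if w: "integrable lborel w" "\<And>z. 0 \<le> w z" and A: "A \<in> sets borel" for w :: "real \<Rightarrow> real" and A
  proof -
    have i: "integrable lborel (\<lambda>z. w z * indicator A z)"
      using integrable_mult_indicator[OF _ w(1), of A] A by (simp add: mult.commute)
    have "emeasure (density lborel (\<lambda>z. ennreal (w z))) A = (\<integral>\<^sup>+z. ennreal (w z * indicator A z) \<partial>lborel)"
      using w A by (subst emeasure_density) (auto simp: indicator_def intro!: nn_integral_cong)
    also have "\<dots> = ennreal (\<integral>z. w z * indicator A z \<partial>lborel)"
      using i w(2) by (intro nn_integral_eq_integral) auto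
    finally show "measure (density lborel (\<lambda>z. ennreal (w z))) A = (\<integral>z. w z * indicator A z \<partial>lborel)"
      using w(2) by (simp add: measure_def)
    have "emeasure (density lborel (\<lambda>z. ennreal (w z))) UNIV = (\<integral>\<^sup>+z. ennreal (w z) \<partial>lborel)"
      using w by (subst emeasure_density) auto
    also have "\<dots> = ennreal (\<integral>z. w z \<partial>lborel)" using w by (intro nn_integral_eq_integral) auto
    finally have "finite_measure (density lborel (\<lambda>z. ennreal (w z)))"
      by (intro finite_measureI) simp
    then show "finite_borel_measure (density lborel (\<lambda>z. ennreal (w z)))"
      by (simp add: finite_borel_measure_def finite_borel_measure_axioms_def)
  qed
  have "AE z in lborel. 0 \<le> u z - v z"
  proof (rule sigma_finite_measure.density_nonneg[OF sigma_finite_lborel])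
    fix A :: "real set" assume "A \<in> sets lborel"
    then have A: "A \<in> sets borel" by simp
    have "measure (density lborel (\<lambda>z. ennreal (v z))) A \<le> measure (density lborel (\<lambda>z. ennreal (u z))) A"
      by (rule measure_le_if_Ioc_le[OF fin[OF v A] fin[OF u A] _ A]) (use le meas[OF u] meas[OF v] in simp)
    then have "(\<integral>z. v z * indicator A z \<partial>lborel) \<le> (\<integral>z. u z * indicator A z \<partial>lborel)"
      using meas[OF u A] meas[OF v A] by simp
    moreover have "integrable lborel (\<lambda>z. u z * indicator A z)" "integrable lborel (\<lambda>z. v z * indicator A z)"
      using integrable_mult_indicator[OF _ u(1), of A] integrable_mult_indicator[OF _ v(1), of A] A
      by (simp_all add: mult.commute)
    ultimately show "0 \<le> set_lebesgue_integral lborel A (\<lambda>z. u z - v z)"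
      by (simp add: set_lebesgue_integral_def right_diff_distrib mult.commute)
  qed (use u v in auto)
  then show ?thesis by simp
qed

lemma integral_inverse_Ioc:
  fixes a b :: real
  assumes "0 < a" "a \<le> b"
  shows "integrable lborel (\<lambda>z. 1 / z * indicator {a<..b} z)"
    and "(\<integral>z. 1 / z * indicator {a<..b} z \<partial>lborel) = ln (b / a)"
proof -
  \<comment> \<open>Replacing z by \<open>max a z\<close> makes the integrand continuous on the
    whole line without changing it on \<open>{a..b}\<close>.\<close>
  have eq: "(\<lambda>z::real. 1 / z * indicator {a..b} z) = (\<lambda>z. 1 / max a z * indicator {a..b} z)"
    by (auto simp: indicator_def fun_eq_iff)
  have F: "(\<integral>z. 1 / z * indicator {a..b} z \<partial>lborel) = ln b - ln a" "integrable lborel (\<lambda>z. 1 / z * indicator {a..b} z)"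
  proof -
    have "has_bochner_integral lborel (\<lambda>z. 1 / max a z * indicator {a..b} z) (ln b - ln a)"
    proof (rule has_bochner_integral_FTC_Icc_real)
      show "DERIV ln x :> 1 / max a x" if "a \<le> x" "x \<le> b" for x
        using that assms by (auto intro!: derivative_eq_intros simp: max_def)
      show "isCont (\<lambda>z. 1 / max a z) x" for x
        using assms by (intro continuous_intros) auto
    qed (use assms in auto)
    then show "(\<integral>z. 1 / z * indicator {a..b} z \<partial>lborel) = ln b - ln a" "integrable lborel (\<lambda>z. 1 / z * indicator {a..b} z)"
      unfolding eq by (auto simp: has_bochner_integral_iff)
  qed
  have ae: "AE z in lborel. 1 / z * indicator {a..b} z = 1 / z * indicator {a<..b} z"
    using AE_lborel_singleton[of a] by eventually_elim (auto simp: indicator_def)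
  show "integrable lborel (\<lambda>z. 1 / z * indicator {a<..b} z)"
    by (rule integrable_cong_AE_imp[OF F(2) _ ae]) measurable
  show "(\<integral>z. 1 / z * indicator {a<..b} z \<partial>lborel) = ln (b / a)"
    using F(1) integral_cong_AE[OF _ _ ae] assms by (simp add: ln_div)
qed

text \<open>Subdivide into n pieces of ratio c^(1/n) with c = b / a: each contributes r (c^(1/n) -
  1), and n (c^(1/n) - 1) tends to ln c. The new bound is additive over adjacent intervals, being
  the integral of r / z.\<close>

lemma increment_le_log:
  fixes Z :: "real \<Rightarrow> real"
  assumes inc: "\<And>a b. 0 < a \<Longrightarrow> a \<le> b \<Longrightarrow> b \<le> 1 \<Longrightarrow> \<bar>Z b - Z a\<bar> \<le> r * (b - a) / a"
    and ab: "0 < a" "a \<le> b" "b \<le> 1"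
  shows "\<bar>Z b - Z a\<bar> \<le> r * ln (b / a)"
proof (cases "a = b")
  case False
  define c where "c = b / a"
  have c: "1 < c" using ab False by (simp add: c_def)
  have step: "\<bar>Z b - Z a\<bar> \<le> r * (real n * (c powr (1 / real n) - 1))" if n: "n > 0" for n
  proof -
    define x where "x i = a * c powr (real i / real n)" for i
    have x0: "x 0 = a" and xn: "x n = b" using n c ab by (auto simp: x_def c_def)
    have xS: "x (Suc i) = x i * c powr (1 / real n)" for i
      using n c by (simp add: x_def add_divide_distrib powr_add)
    have xp: "0 < x i" for i using ab c by (simp add: x_def)
    have xle: "x i \<le> 1" if "i \<le> n" for i
    proof -
      have "x i \<le> x n" unfolding x_def using that ab c n by (intro mult_left_mono powr_mono divide_right_mono) auto
      then show ?thesis using xn ab by simp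
    qed
    have "\<bar>Z (x m) - Z (x 0)\<bar> \<le> r * (real m * (c powr (1 / real n) - 1))" if "m \<le> n" for m
      using that
    proof (induction m)
      case (Suc m)
      have "1 \<le> c powr (1 / real n)" using c by (intro ge_one_powr_ge_zero) auto
      then have "x m \<le> x (Suc m)" using xp[of m] by (simp add: xS)
      then have "\<bar>Z (x (Suc m)) - Z (x m)\<bar> \<le> r * (x (Suc m) - x m) / x m"
        using xp xle[OF Suc.prems] by (intro inc)
      also have "\<dots> = r * (c powr (1 / real n) - 1)" using xp[of m] by (simp add: xS field_simps)
      finally show ?case using Suc by (simp add: algebra_simps)
    qed simp
    from this[of n] show ?thesis by (simp add: x0 xn)
  qed
  have "(\<lambda>n. r * (real n * (c powr (1 / real n) - 1))) \<longlonglongrightarrow> r * ln c"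
    using c by (intro tendsto_mult_left) real_asymp
  then have "\<bar>Z b - Z a\<bar> \<le> r * ln c"
    by (rule tendsto_lowerbound) (use step in \<open>auto intro!: eventually_mono[OF eventually_gt_at_top[of 0]]\<close>)
  then show ?thesis by (simp add: c_def)
qed simp

section \<open>The kernel\<close>

locale lsv_kernel = lsv_invariant +
  fixes K :: "real \<Rightarrow> real measure"
  assumes perron_frobenius: "perron_frobenius_kernel (lsv_map \<gamma>) \<nu> K"
begin

lemma kernel_measurable: "K \<in> \<nu> \<rightarrow>\<^sub>M prob_algebra \<nu>"
  using perron_frobenius by (auto simp: perron_frobenius_kernel_def invariant_markov_kernel_def)

lemma kernel_prob: "x \<in> {0..1} \<Longrightarrow> prob_space (K x)" and sets_kernel: "x \<in> {0..1} \<Longrightarrow> sets (K x) = sets \<nu>"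
  using measurable_space[OF kernel_measurable, of x] by (auto simp: space_nu space_prob_algebra)

lemma space_kernel: "x \<in> {0..1} \<Longrightarrow> space (K x) = {0..1}"
  using sets_eq_imp_space_eq[OF sets_kernel[of x]] by (simp add: space_nu)

definition unit_valued :: "(real \<Rightarrow> real) \<Rightarrow> bool" where
  "unit_valued \<phi> \<longleftrightarrow> \<phi> \<in> borel_measurable \<nu> \<and> (\<forall>z\<in>{0..1}. 0 \<le> \<phi> z \<and> \<phi> z \<le> 1)"

lemma unit_valued_integrable: "unit_valued \<phi> \<Longrightarrow> integrable \<nu> \<phi>"
  by (rule integrable_bounded[of _ 1]) (auto simp: unit_valued_def)

lemma unit_valued_integrable_kernel: 
  assumes "unit_valued \<phi>" "x \<in> {0..1}" shows "integrable (K x) \<phi>"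
proof -
  interpret Kx: prob_space "K x" by (rule kernel_prob[OF assms(2)])
  show ?thesis using assms by (intro Kx.integrable_const_bound[where B = 1])
    (auto simp: unit_valued_def space_kernel measurable_cong_sets[OF sets_kernel refl])
qed

lemma unit_valued_bounded_measurable: "unit_valued \<phi> \<Longrightarrow> bounded_measurable \<nu> \<phi>"
  unfolding bounded_measurable_def bounded_iff by (auto simp: unit_valued_def space_nu intro!: exI[of _ 1])

lemma unit_valued_half_line: "unit_valued (half_line t)"
  by (auto simp: unit_valued_def half_line_def indicator_def intro!: measurable_nu)

lemma unit_valued_mult: "unit_valued f \<Longrightarrow> unit_valued g \<Longrightarrow> unit_valued (\<lambda>x. f x * g x)"
  by (auto simp: unit_valued_def intro!: mult_le_one)

lemma unit_valued_1: "unit_valued (\<lambda>_. 1)"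
  by (auto simp: unit_valued_def)

lemma unit_valued_kernel_op: 
  assumes "unit_valued \<phi>" shows "unit_valued (kernel_op K \<phi>)"
  unfolding unit_valued_def
proof (intro conjI ballI)
  show "kernel_op K \<phi> \<in> borel_measurable \<nu>"
    unfolding kernel_op_def using assms
    by (intro measurable_compose[OF measurable_prob_algebraD[OF kernel_measurable]
      integral_measurable_subprob_algebra]) (auto simp: unit_valued_def)
  fix z :: real assume z: "z \<in> {0..1}"
  interpret Kz: prob_space "K z" by (rule kernel_prob[OF z])
  show "0 \<le> kernel_op K \<phi> z" unfolding kernel_op_def
    using assms by (intro integral_nonneg_AE AE_I2) (auto simp: space_kernel[OF z] unit_valued_def)
  have "kernel_op K \<phi> z \<le> (\<integral>y. 1 \<partial>K z)" unfolding kernel_op_def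
    using assms unit_valued_integrable_kernel[OF assms z] 
    by (intro integral_mono_AE AE_I2) (auto simp: space_kernel[OF z] unit_valued_def)
  then show "kernel_op K \<phi> z \<le> 1" by (simp add: Kz.prob_space)
qed

lemma unit_valued_kernel_op_iter: "unit_valued \<phi> \<Longrightarrow> unit_valued ((kernel_op K ^^ n) \<phi>)"
  by (induction n) (auto intro: unit_valued_kernel_op)

text \<open>Duality tested against the indicator of a half-line. This is where the Perron-Frobenius
  identity enters; from here on the kernel acts through \<open>push\<close>.\<close>

lemma cdf_of_kernel_op:
  assumes \<phi>: "unit_valued \<phi>" and x: "x \<in> {0..1}"
  shows "cdf_of \<nu> (kernel_op K \<phi>) x = push (cdf_of \<nu> \<phi>) x"
proof -
  have "cdf_of \<nu> (kernel_op K \<phi>) x = (\<integral>z. \<phi> z * half_line x (lsv_map \<gamma> z) \<partial>\<nu>)"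
    using perron_frobenius unit_valued_bounded_measurable[OF \<phi>] 
      unit_valued_bounded_measurable[OF unit_valued_half_line[of x]]
    by (simp add: perron_frobenius_kernel_def cdf_of_def half_line_def)
  also have "\<dots> = push (cdf_of \<nu> \<phi>) x"
    using integral_indicator_lsv_map[OF sets_nu ac_nu unit_valued_integrable[OF \<phi>] x, of 1]
    by (simp add: half_line_def)
  finally show ?thesis .
qed

lemma cdf_of_kernel_op_iter:
  assumes \<phi>: "unit_valued \<phi>" and x: "x \<in> {0..1}"
  shows "cdf_of \<nu> ((kernel_op K ^^ n) \<phi>) x = (push ^^ n) (cdf_of \<nu> \<phi>) x"
  using x
proof (induction n arbitrary: x)
  case (Suc n)
  have "cdf_of \<nu> ((kernel_op K ^^ Suc n) \<phi>) x = push (cdf_of \<nu> ((kernel_op K ^^ n) \<phi>)) x"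
    using cdf_of_kernel_op[OF unit_valued_kernel_op_iter[OF \<phi>] Suc.prems] by simp
  also have "\<dots> = push ((push ^^ n) (cdf_of \<nu> \<phi>)) x"
    using Suc.IH Suc.prems preim_range[OF Suc.prems] 
    by (simp add: push_def[of "(push ^^ n) _"] push_def[of "cdf_of _ _"])
  finally show ?case by simp
qed simp

lemma cdf_of_1: "cdf_of \<nu> \<phi> 1 = (\<integral>z. \<phi> z \<partial>\<nu>)"
  unfolding cdf_of_def by (intro Bochner_Integration.integral_cong) (auto simp: space_nu)

text \<open>The functions whose product with the density of \<open>\<nu>\<close> is nonincreasing.\<close>

definition decr_weight :: "(real \<Rightarrow> real) \<Rightarrow> bool" where
  "decr_weight \<phi> \<longleftrightarrow> unit_valued \<phi> \<and> decr_cdf (cdf_of \<nu> \<phi>)"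

lemma decr_weight_1: "decr_weight (\<lambda>_. 1)"
  by (simp add: decr_weight_def unit_valued_1 decr_cdf_inv)

lemma decr_weight_kernel_op_iter: 
  assumes "decr_weight \<phi>" shows "decr_weight ((kernel_op K ^^ n) \<phi>)"
  unfolding decr_weight_def
proof
  have u: "unit_valued \<phi>" and F: "decr_cdf (cdf_of \<nu> \<phi>)" using assms by (auto simp: decr_weight_def)
  show "decr_cdf (cdf_of \<nu> ((kernel_op K ^^ n) \<phi>))"
    by (rule decr_cdf_cong[OF decr_cdf_push_iter[OF F, of n]]) (rule cdf_of_kernel_op_iter[OF u, symmetric])
qed (use assms unit_valued_kernel_op_iter in \<open>auto simp: decr_weight_def\<close>)

lemma decr_weight_half_line: 
  assumes "decr_weight \<phi>" shows "decr_weight (\<lambda>x. half_line t x * \<phi> x)"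
  unfolding decr_weight_def
proof
  have F: "decr_cdf (cdf_of \<nu> \<phi>)" using assms by (simp add: decr_weight_def)
  have "cdf_of \<nu> (\<lambda>x. half_line t x * \<phi> x) y = cdf_of \<nu> \<phi> (min y t)" for y
    unfolding cdf_of_def
    by (intro Bochner_Integration.integral_cong) (auto simp: half_line_def indicator_def)
  moreover have "decr_cdf (\<lambda>y. cdf_of \<nu> \<phi> (min y t))"
  proof (cases "0 \<le> t")
    case False
    then have "cdf_of \<nu> \<phi> (min y t) = 0 * cdf_of \<nu> \<phi> y" for y
      unfolding cdf_of_def
      by (subst Bochner_Integration.integral_cong[where g = "\<lambda>_. 0"]) (auto simp: space_nu indicator_def)
    then show ?thesis using decr_cdf_cmult[OF F, of 0] by simp
  qed (rule decr_cdf_min[OF F])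
  ultimately show "decr_cdf (cdf_of \<nu> (\<lambda>x. half_line t x * \<phi> x))"
    by (metis (no_types, lifting) decr_cdf_cong)
qed (use assms in \<open>auto simp: decr_weight_def intro!: unit_valued_mult unit_valued_half_line\<close>)

lemma decr_weight_kernel_iter: "decr_weight (kernel_iter K (zip ns (map half_line ts)))"
proof (induction ns arbitrary: ts)
  case (Cons n ns)
  then show ?case 
    by (cases ts) (auto intro!: decr_weight_1 decr_weight_kernel_op_iter decr_weight_half_line)
qed (simp add: decr_weight_1)

text \<open>The weight is coupled with the constant weight of the same \<nu>-mass m, whose
  distribution function \<open>m * inv_cdf\<close> is fixed by \<open>push\<close>.\<close>

lemma decr_weight_mixing:
  assumes \<phi>: "decr_weight \<phi>" and kN: "k * (mixing_depth + N) \<le> n" and ab: "0 < a" "a \<le> b" "b \<le> 1"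
  defines "\<zeta> \<equiv> \<lambda>x. (kernel_op K ^^ n) \<phi> x - (\<integral>y. (kernel_op K ^^ n) \<phi> y \<partial>\<nu>)"
  shows "\<bar>cdf_of \<nu> \<zeta> b - cdf_of \<nu> \<zeta> a\<bar> \<le> coupling_bound k N * ln (b / a)"
proof (rule increment_le_log[OF _ ab])
  fix a b :: real assume ab: "0 < a" "a \<le> b" "b \<le> 1"
  define m where "m = (\<integral>y. \<phi> y \<partial>\<nu>)"
  let ?F = "cdf_of \<nu> \<phi>" and ?F' = "\<lambda>x. m * inv_cdf x"
  have u: "unit_valued \<phi>" and F: "decr_cdf ?F" using \<phi> by (auto simp: decr_weight_def)
  have m: "0 \<le> m" "m \<le> 1" "?F 1 = m"
    using decr_cdf_nonneg[OF F, of 1] decr_cdfD(4)[OF F] by (auto simp: m_def cdf_of_1)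
  have Km: "(\<integral>y. (kernel_op K ^^ n) \<phi> y \<partial>\<nu>) = m"
    using cdf_of_kernel_op_iter[OF u, of 1 n] by (simp add: cdf_of_1 push_iter_1 m_def)
  have F': "decr_cdf ?F'" by (rule decr_cdf_cmult[OF decr_cdf_inv m(1,2)])
  have inv: "(push ^^ n) ?F' x = m * inv_cdf x" if "x \<in> {0..1}" for x
    by (rule push_iter_fixed) 
      (use push_inv_cdf that in \<open>auto simp: push_def simp flip: right_diff_distrib distrib_left\<close>)
  have Z: "cdf_of \<nu> \<zeta> x = (push ^^ n) (\<lambda>x. ?F x - ?F' x) x" if x: "x \<in> {0..1}" for x
  proof -
    have i: "integrable \<nu> (\<lambda>z. f z * indicator {..x} z)" if "unit_valued f" for f
      using unit_valued_integrable[OF unit_valued_mult[OF that unit_valued_half_line[of x]]] by (simp add: half_line_def)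
    have "cdf_of \<nu> \<zeta> x = cdf_of \<nu> ((kernel_op K ^^ n) \<phi>) x - m * inv_cdf x"
      using i[OF unit_valued_kernel_op_iter[OF u]] i[OF unit_valued_1]
      by (simp add: cdf_of_def \<zeta>_def Km left_diff_distrib mult.assoc)
    also have "\<dots> = (push ^^ n) ?F x - (push ^^ n) ?F' x"
      using x inv cdf_of_kernel_op_iter[OF u x] by simp
    also have "\<dots> = (push ^^ n) (\<lambda>x. ?F x - ?F' x) x"
      using x by (intro push_iter_diff[symmetric]) auto
    finally show ?thesis .
  qed
  have "coupled (coupling_bound k N) ((push ^^ n) (\<lambda>x. ?F x - ?F' x))"
    by (rule coupled_push[OF F F' _ _ kN]) (auto simp: m inv_cdf_1)
  from coupled_increment[OF this ab] show "\<bar>cdf_of \<nu> \<zeta> b - cdf_of \<nu> \<zeta> a\<bar> \<le> coupling_bound k N * (b - a) / a"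
    using Z[of a] Z[of b] ab by simp
qed

text \<open>Passage from increments to a pointwise bound on the density of \<zeta> with respect to
  Lebesgue measure. It is one-sided and gets applied to \<zeta> and to its negative.\<close>

lemma AE_density_bound:
  assumes h: "h \<in> borel_measurable unit_lebesgue" "\<And>x. 0 \<le> h x" "integrable unit_lebesgue h"
      "\<nu> = density unit_lebesgue (\<lambda>x. ennreal (h x))"
    and \<zeta>: "\<zeta> \<in> borel_measurable \<nu>" "\<And>z. z \<in> {0..1} \<Longrightarrow> \<bar>\<zeta> z\<bar> \<le> 1"
    and inc: "\<And>a b. 0 < a \<Longrightarrow> a \<le> b \<Longrightarrow> b \<le> 1 \<Longrightarrow> cdf_of \<nu> \<zeta> b - cdf_of \<nu> \<zeta> a \<le> r * ln (b / a)"
    and r: "0 \<le> r" and x: "0 < x" "x \<le> 1"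
  shows "AE z in lborel. z \<in> {x<..1} \<longrightarrow> \<zeta> z * h z \<le> r / z"
proof -
  define I where "I = {x<..1}"
  have \<zeta>L: "\<zeta> \<in> borel_measurable unit_lebesgue"
    using \<zeta>(1) measurable_cong_sets[OF trans[OF sets_nu unit_borel_cong[symmetric]] refl] by auto
  have ir: "integrable lborel (\<lambda>z. f z * indicator B z)"
    "(\<integral>z. f z * indicator B z \<partial>lborel) = (\<integral>z. f z * indicator B z \<partial>unit_lebesgue)"
    if f: "integrable unit_lebesgue f" and B: "B \<in> sets borel" "B \<subseteq> {0..1}" 
    for f :: "real \<Rightarrow> real" and B :: "real set"
  proof -
    have "integrable unit_lebesgue (\<lambda>z. f z * indicator B z)"
      using integrable_mult_indicator[OF _ f, of B] B by (auto simp: mult.commute sets_restrict_space)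
    then have "integrable lborel (\<lambda>z. indicator {0..1} z *\<^sub>R (f z * indicator B z))"
      by (subst (asm) integrable_restrict_space) auto
    moreover have eq: "(\<lambda>z. indicator {0..1} z *\<^sub>R (f z * indicator B z)) = (\<lambda>z. f z * indicator B z)"
      using B by (auto simp: indicator_def fun_eq_iff)
    ultimately show "integrable lborel (\<lambda>z. f z * indicator B z)" by simp
    show "(\<integral>z. f z * indicator B z \<partial>lborel) = (\<integral>z. f z * indicator B z \<partial>unit_lebesgue)"
      by (subst integral_restrict_space, simp, simp only: eq)
  qed
  have \<zeta>h: "integrable unit_lebesgue (\<lambda>z. \<zeta> z * h z)"
    by (rule Bochner_Integration.integrable_bound[OF h(3)])
      (use \<zeta> \<zeta>L h in \<open>auto simp: space_restrict_space abs_mult mult_left_le_one_le\<close>)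
  \<comment> \<open>The comparison of integrals requires nonnegative functions; adding
    \<open>h\<close> to both sides achieves this because \<zeta> is at least -1.\<close>
  define u where "u z = (r * (1 / z) + h z) * indicator I z" for z
  define v where "v z = (\<zeta> z * h z + h z) * indicator I z" for z
  have I: "I \<in> sets borel" "I \<subseteq> {0..1}" using x by (auto simp: I_def)
  have "AE z in lborel. v z \<le> u z"
  proof (rule AE_le_if_Ioc_integral_le)
    show "0 \<le> u z" for z using r x h(2)[of z] by (auto simp: u_def I_def indicator_def)
    show "0 \<le> v z" for z
    proof -
      have "0 \<le> (\<zeta> z + 1) * h z" if "z \<in> I" using \<zeta>(2)[of z] h(2)[of z] that I by (intro mult_nonneg_nonneg) auto
      then show ?thesis by (auto simp: v_def indicator_def algebra_simps)
    qed
    have 1: "integrable lborel (\<lambda>z. r * (1 / z * indicator I z))"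
      unfolding I_def using x by (intro integrable_mult_right integral_inverse_Ioc)
    show "integrable lborel u" 
      using Bochner_Integration.integrable_add[OF 1 ir(1)[OF h(3) I]] 
      by (simp add: u_def[abs_def] distrib_right mult.assoc)
    show "integrable lborel v" 
      unfolding v_def using \<zeta>h h(3) by (intro ir(1) I) auto
    fix a b :: real assume "a < b"
    define a' where "a' = max a x"
    define b' where "b' = min b 1"
    have int: "indicator I z * indicator {a<..b} z = (indicator {a'<..b'} z :: real)" for z
      by (auto simp: I_def a'_def b'_def indicator_def)
    show "(\<integral>z. v z * indicator {a<..b} z \<partial>lborel) \<le> (\<integral>z. u z * indicator {a<..b} z \<partial>lborel)"
    proof (cases "a' \<le> b'")
      case False
      then show ?thesis by (simp add: u_def v_def mult.assoc int)
    next
      case True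
      have ab: "0 < a'" "b' \<le> 1" using x by (auto simp: a'_def b'_def)
      have J: "{a'<..b'} \<in> sets borel" "{a'<..b'} \<subseteq> {0..1}" using ab by auto
      have "(\<integral>z. \<zeta> z * h z * indicator {a'<..b'} z \<partial>lborel) 
          = (\<integral>z. h z * (\<zeta> z * indicator {..b'} z - \<zeta> z * indicator {..a'} z) \<partial>unit_lebesgue)"
        unfolding ir(2)[OF \<zeta>h J] using True
        by (intro Bochner_Integration.integral_cong refl) (auto simp: indicator_def)
      also have "\<dots> = (\<integral>z. \<zeta> z * indicator {..b'} z - \<zeta> z * indicator {..a'} z \<partial>\<nu>)"
      proof -
        have "(indicator {..c} :: real \<Rightarrow> real) \<in> borel_measurable unit_lebesgue" for c
          by (intro borel_measurable_unit_lebesgue) auto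
        then have "(\<lambda>z. \<zeta> z * indicator {..b'} z - \<zeta> z * indicator {..a'} z) \<in> borel_measurable unit_lebesgue"
          by (intro borel_measurable_diff borel_measurable_times \<zeta>L)
        then show ?thesis using h by (subst h(4), subst integral_density) auto
      qed
      also have "\<dots> = cdf_of \<nu> \<zeta> b' - cdf_of \<nu> \<zeta> a'"
      proof -
        have "integrable \<nu> (\<lambda>z. \<zeta> z * indicator {..c} z)" for c
        proof (rule integrable_bounded[of _ 1])
          show "(\<lambda>z. \<zeta> z * indicator {..c} z) \<in> borel_measurable \<nu>"
            by (rule borel_measurable_times[OF \<zeta>(1) measurable_nu]) auto
        qed (use \<zeta>(2) in \<open>auto simp: indicator_def\<close>)
        then show ?thesis unfolding cdf_of_def by (intro Bochner_Integration.integral_diff)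
      qed
      also have "\<dots> \<le> r * ln (b' / a')" using ab True by (intro inc)
      also have "\<dots> = (\<integral>z. r * (1 / z * indicator {a'<..b'} z) \<partial>lborel)"
        by (simp only: integral_mult_right_zero integral_inverse_Ioc(2)[OF ab(1) True])
      finally have le: "(\<integral>z. \<zeta> z * h z * indicator {a'<..b'} z \<partial>lborel) \<le> (\<integral>z. r * (1 / z * indicator {a'<..b'} z) \<partial>lborel)" .
      have i1: "integrable lborel (\<lambda>z. r * (1 / z * indicator {a'<..b'} z))"
        using integral_inverse_Ioc(1)[OF ab(1) True] by (intro integrable_mult_right)
      have "(\<integral>z. v z * indicator {a<..b} z \<partial>lborel) = (\<integral>z. \<zeta> z * h z * indicator {a'<..b'} z + h z * indicator {a'<..b'} z \<partial>lborel)"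
        by (simp add: v_def mult.assoc int distrib_right)
      also have "\<dots> = (\<integral>z. \<zeta> z * h z * indicator {a'<..b'} z \<partial>lborel) + (\<integral>z. h z * indicator {a'<..b'} z \<partial>lborel)"
        by (intro Bochner_Integration.integral_add ir(1) J \<zeta>h h(3))
      also have "\<dots> \<le> (\<integral>z. r * (1 / z * indicator {a'<..b'} z) \<partial>lborel) + (\<integral>z. h z * indicator {a'<..b'} z \<partial>lborel)"
        using le by simp
      also have "\<dots> = (\<integral>z. r * (1 / z * indicator {a'<..b'} z) + h z * indicator {a'<..b'} z \<partial>lborel)"
        by (intro Bochner_Integration.integral_add[symmetric] ir(1) J i1 h(3))
      also have "\<dots> = (\<integral>z. u z * indicator {a<..b} z \<partial>lborel)"
        by (simp only: u_def mult.assoc int distrib_right)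
      finally show ?thesis .
    qed
  qed
  then show ?thesis
    by eventually_elim (auto simp: u_def v_def I_def)
qed

end

section \<open>Suprema over thresholds\<close>

text \<open>Rational approximation strictly from above, because the indicator of a half-line is
  right-continuous in its threshold.\<close>

definition upper_approx :: "nat \<Rightarrow> real \<Rightarrow> real" where
  "upper_approx m t = (of_int \<lfloor>t * (real m + 1)\<rfloor> + 1) / (real m + 1)"

lemma upper_approx_Rats: "upper_approx m t \<in> \<rat>"
proof -
  have "upper_approx m t = of_int (\<lfloor>t * (real m + 1)\<rfloor> + 1) / of_nat (m + 1)"
    by (simp add: upper_approx_def add.commute)
  then show ?thesis by simp
qed

lemma upper_approx_gt: "t < upper_approx m t" and upper_approx_le: "upper_approx m t \<le> t + 1 / (real m + 1)"
proof -
  have "t * (real m + 1) < of_int \<lfloor>t * (real m + 1)\<rfloor> + 1" by linarith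
  then show "t < upper_approx m t" by (simp add: upper_approx_def field_simps)
  have "of_int \<lfloor>t * (real m + 1)\<rfloor> + 1 \<le> t * (real m + 1) + 1" by linarith
  then have "upper_approx m t \<le> (t * (real m + 1) + 1) / (real m + 1)"
    unfolding upper_approx_def by (intro divide_right_mono) auto
  then show "upper_approx m t \<le> t + 1 / (real m + 1)" by (simp add: add_divide_distrib)
qed

lemma half_line_upper_approx: "(\<lambda>m. half_line (upper_approx m t) z) \<longlonglongrightarrow> half_line t z"
proof (cases "z \<le> t")
  case True
  then have "half_line (upper_approx m t) z = half_line t z" for m
    using upper_approx_gt[of t m] by (simp add: half_line_def)
  then show ?thesis by simp
next
  case False
  have "(\<lambda>m. t + 1 / (real m + 1)) \<longlonglongrightarrow> t" by real_asymp
  then have "\<forall>\<^sub>F m in sequentially. t + 1 / (real m + 1) < z"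
    using False by (intro order_tendstoD) auto
  then have "\<forall>\<^sub>F m in sequentially. half_line (upper_approx m t) z = half_line t z"
  proof eventually_elim
    case (elim m)
    then show ?case using False upper_approx_le[of m t] by (simp add: half_line_def)
  qed
  then show ?thesis by (rule tendsto_eventually)
qed

context lsv_kernel begin

lemma kernel_op_tendsto:
  assumes f: "\<And>m. unit_valued (f m)" "unit_valued g" and lim: "\<And>z. z \<in> {0..1} \<Longrightarrow> (\<lambda>m. f m z) \<longlonglongrightarrow> g z"
    and x: "x \<in> {0..1}"
  shows "(\<lambda>m. kernel_op K (f m) x) \<longlonglongrightarrow> kernel_op K g x"
proof -
  interpret Kx: prob_space "K x" by (rule kernel_prob[OF x])
  show ?thesis unfolding kernel_op_def
  proof (rule integral_dominated_convergence[where w = "\<lambda>_. 1"])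
    show "g \<in> borel_measurable (K x)" "f m \<in> borel_measurable (K x)" for m
      using unit_valued_integrable_kernel[OF f(2) x] unit_valued_integrable_kernel[OF f(1) x] by auto
    show "AE z in K x. (\<lambda>m. f m z) \<longlonglongrightarrow> g z"
      by (rule AE_I2) (use lim in \<open>simp add: space_kernel[OF x]\<close>)
    show "AE z in K x. norm (f m z) \<le> 1" for m
      by (rule AE_I2) (use f(1)[of m] in \<open>simp add: space_kernel[OF x] unit_valued_def\<close>)
  qed simp
qed

lemma integral_tendsto:
  assumes f: "\<And>m. unit_valued (f m)" "unit_valued g" and lim: "\<And>z. z \<in> {0..1} \<Longrightarrow> (\<lambda>m. f m z) \<longlonglongrightarrow> g z"
  shows "(\<lambda>m. \<integral>z. f m z \<partial>\<nu>) \<longlonglongrightarrow> (\<integral>z. g z \<partial>\<nu>)"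
proof (rule integral_dominated_convergence[where w = "\<lambda>_. 1"])
  show "g \<in> borel_measurable \<nu>" "f m \<in> borel_measurable \<nu>" for m
    using f(2) f(1)[of m] by (auto simp: unit_valued_def)
  show "AE z in \<nu>. (\<lambda>m. f m z) \<longlonglongrightarrow> g z"
    by (rule AE_I2) (use lim in \<open>simp add: space_nu\<close>)
  show "AE z in \<nu>. norm (f m z) \<le> 1" for m
    by (rule AE_I2) (use f(1)[of m] in \<open>simp add: space_nu unit_valued_def\<close>)
qed simp

lemma kernel_op_iter_tendsto:
  assumes f: "\<And>m. unit_valued (f m)" "unit_valued g" and lim: "\<And>z. z \<in> {0..1} \<Longrightarrow> (\<lambda>m. f m z) \<longlonglongrightarrow> g z"
    and x: "x \<in> {0..1}"
  shows "(\<lambda>m. (kernel_op K ^^ n) (f m) x) \<longlonglongrightarrow> (kernel_op K ^^ n) g x"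
  using x
proof (induction n arbitrary: x)
  case (Suc n)
  show ?case unfolding funpow.simps comp_def
    by (rule kernel_op_tendsto[OF _ _ Suc.IH Suc.prems]) (auto intro: unit_valued_kernel_op_iter f)
qed (use lim in auto)

lemma unit_valued_kernel_iter: "unit_valued (kernel_iter K (zip ns (map half_line ts)))"
  using decr_weight_kernel_iter by (simp add: decr_weight_def)

lemma kernel_iter_tendsto:
  assumes x: "x \<in> {0..1}"
  shows "(\<lambda>m. kernel_iter K (zip ns (map half_line (map (upper_approx m) ts))) x)
    \<longlonglongrightarrow> kernel_iter K (zip ns (map half_line ts)) x"
  using x
proof (induction ns arbitrary: ts x)
  case (Cons n ns)
  show ?case
  proof (cases ts)
    case ts: (Cons t ts')
    show ?thesis unfolding ts list.map zip_Cons_Cons kernel_iter.simps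
      by (intro kernel_op_iter_tendsto unit_valued_mult unit_valued_half_line unit_valued_kernel_iter
        tendsto_mult half_line_upper_approx Cons)
  qed simp
qed simp

section \<open>Fluctuations and their suprema over thresholds\<close>

definition fluctuation :: "nat list \<Rightarrow> real list \<Rightarrow> real \<Rightarrow> real" where
  "fluctuation ns ts = kernel_iter0 \<nu> K (zip ns (map half_line ts))"

lemma fluctuation_tendsto:
  assumes x: "x \<in> {0..1}"
  shows "(\<lambda>m. fluctuation ns (map (upper_approx m) ts) x) \<longlonglongrightarrow> fluctuation ns ts x"
  unfolding fluctuation_def kernel_iter0_def
  by (intro tendsto_diff kernel_iter_tendsto[OF x] integral_tendsto unit_valued_kernel_iter kernel_iter_tendsto)

lemma fluctuation_measurable [measurable]: "fluctuation ns ts \<in> borel_measurable \<nu>"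
  using unit_valued_kernel_iter[of ns ts] unfolding fluctuation_def kernel_iter0_def[abs_def] 
  by (intro borel_measurable_diff) (auto simp: unit_valued_def)

lemma fluctuation_bound: assumes x: "x \<in> {0..1}" shows "\<bar>fluctuation ns ts x\<bar> \<le> 1"
proof -
  let ?f = "kernel_iter K (zip ns (map half_line ts))"
  have u: "unit_valued ?f" by (rule unit_valued_kernel_iter)
  have "0 \<le> (\<integral>y. ?f y \<partial>\<nu>)"
    using u by (intro integral_nonneg_AE AE_I2) (auto simp: space_nu unit_valued_def)
  moreover have "(\<integral>y. ?f y \<partial>\<nu>) \<le> (\<integral>y. 1 \<partial>\<nu>)"
    using u unit_valued_integrable[OF u] by (intro integral_mono_AE AE_I2) (auto simp: space_nu unit_valued_def)
  moreover have "0 \<le> ?f x" "?f x \<le> 1" using u x by (auto simp: unit_valued_def)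
  ultimately show ?thesis by (simp add: fluctuation_def kernel_iter0_def prob_space)
qed

lemma integrable_fluctuation: "integrable \<nu> (\<lambda>x. \<bar>fluctuation ns ts x\<bar>)"
  by (rule integrable_bounded[of _ 1]) (auto simp: fluctuation_bound[unfolded atLeastAtMost_iff])

definition max_fluctuation :: "nat list \<Rightarrow> nat \<Rightarrow> real \<Rightarrow> real" where
  "max_fluctuation ns l x = (SUP ts\<in>{ts. length ts = l}. \<bar>fluctuation ns ts x\<bar>)"

lemma bdd_above_fluctuation: "x \<in> {0..1} \<Longrightarrow> bdd_above ((\<lambda>ts. \<bar>fluctuation ns ts x\<bar>) ` A)"
  by (rule bdd_aboveI2[where M = 1]) (rule fluctuation_bound)

lemma lists_nonempty: "{ts :: real list. length ts = l} \<noteq> {}"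
  by (auto intro: exI[of _ "replicate l 0"])

lemma rational_lists_nonempty: "{ts :: real list. length ts = l \<and> set ts \<subseteq> \<rat>} \<noteq> {}"
  by (auto intro!: exI[of _ "replicate l 0"])

text \<open>Countably many thresholds suffice. This gives measurability of the supremum and permits
  the union of the exceptional null sets.\<close>

lemma max_fluctuation_rational:
  assumes x: "x \<in> {0..1}"
  shows "max_fluctuation ns l x = (SUP ts\<in>{ts. length ts = l \<and> set ts \<subseteq> \<rat>}. \<bar>fluctuation ns ts x\<bar>)"
proof (rule antisym)
  show "max_fluctuation ns l x \<le> (SUP ts\<in>{ts. length ts = l \<and> set ts \<subseteq> \<rat>}. \<bar>fluctuation ns ts x\<bar>)"
    unfolding max_fluctuation_def
  proof (rule cSUP_least[OF lists_nonempty])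
    fix ts :: "real list" assume ts: "ts \<in> {ts. length ts = l}"
    have "\<bar>fluctuation ns (map (upper_approx m) ts) x\<bar> \<le> (SUP ts\<in>{ts. length ts = l \<and> set ts \<subseteq> \<rat>}. \<bar>fluctuation ns ts x\<bar>)" for m
      using ts upper_approx_Rats by (intro cSUP_upper bdd_above_fluctuation x) auto
    with tendsto_rabs[OF fluctuation_tendsto[OF x, of ns ts]]
    show "\<bar>fluctuation ns ts x\<bar> \<le> (SUP ts\<in>{ts. length ts = l \<and> set ts \<subseteq> \<rat>}. \<bar>fluctuation ns ts x\<bar>)"
      by (intro LIMSEQ_le_const2) auto
  qed
  show "(SUP ts\<in>{ts. length ts = l \<and> set ts \<subseteq> \<rat>}. \<bar>fluctuation ns ts x\<bar>) \<le> max_fluctuation ns l x"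
    unfolding max_fluctuation_def
    by (intro cSUP_subset_mono rational_lists_nonempty bdd_above_fluctuation x) auto
qed

lemma countable_rational_lists: "countable {ts :: real list. length ts = l \<and> set ts \<subseteq> \<rat>}"
  by (rule countable_subset[OF _ countable_lists[OF countable_rat]]) (auto simp: lists_eq_set)

lemma max_fluctuation_measurable [measurable]: "max_fluctuation ns l \<in> borel_measurable \<nu>"
proof -
  have "(\<lambda>x. SUP ts\<in>{ts. length ts = l \<and> set ts \<subseteq> \<rat>}. \<bar>fluctuation ns ts x\<bar>) \<in> borel_measurable \<nu>"
    by (intro borel_measurable_cSUP countable_rational_lists bdd_above_fluctuation borel_measurable_abs fluctuation_measurable)
      (simp add: space_nu)
  then show ?thesis
    by (rule measurable_cong[THEN iffD1, rotated]) (simp add: max_fluctuation_rational space_nu)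
qed

lemma fluctuation_le_max: "x \<in> {0..1} \<Longrightarrow> length ts = l \<Longrightarrow> \<bar>fluctuation ns ts x\<bar> \<le> max_fluctuation ns l x"
  unfolding max_fluctuation_def by (intro cSUP_upper bdd_above_fluctuation) auto

lemma max_fluctuation_range: 
  assumes "x \<in> {0..1}" shows "0 \<le> max_fluctuation ns l x" "max_fluctuation ns l x \<le> 1"
proof -
  show "max_fluctuation ns l x \<le> 1"
    unfolding max_fluctuation_def by (intro cSUP_least lists_nonempty fluctuation_bound assms)
  show "0 \<le> max_fluctuation ns l x"
    using fluctuation_le_max[OF assms length_replicate[of l 0], of ns] abs_ge_zero order_trans by blast
qed

lemma integrable_max_fluctuation: "integrable \<nu> (max_fluctuation ns l)"
  by (rule integrable_bounded[of _ 1]) (use max_fluctuation_range[of _ ns l] in auto)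

lemma integral_fluctuation_le: 
  "length ts = l \<Longrightarrow> (\<integral>x. \<bar>fluctuation ns ts x\<bar> \<partial>\<nu>) \<le> (\<integral>x. max_fluctuation ns l x \<partial>\<nu>)"
  by (intro integral_mono_AE integrable_fluctuation integrable_max_fluctuation AE_I2)
    (auto simp: space_nu intro!: fluctuation_le_max)

lemma integral_max_fluctuation_le_1: "(\<integral>x. max_fluctuation ns l x \<partial>\<nu>) \<le> 1"
proof -
  have "(\<integral>x. max_fluctuation ns l x \<partial>\<nu>) \<le> (\<integral>x. 1 \<partial>\<nu>)"
    using max_fluctuation_range[of _ ns l] 
    by (intro integral_mono_AE integrable_max_fluctuation AE_I2) (auto simp: space_nu)
  then show ?thesis by (simp add: prob_space)
qed

lemma fluctuation_increment:
  assumes ts: "ts \<noteq> []" and kN: "k * (mixing_depth + N) \<le> n" and ab: "0 < a" "a \<le> b" "b \<le> 1"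
  shows "\<bar>cdf_of \<nu> (fluctuation (n # ns) ts) b - cdf_of \<nu> (fluctuation (n # ns) ts) a\<bar> \<le> coupling_bound k N * ln (b / a)"
proof -
  obtain t ts' where ts: "ts = t # ts'" using ts by (cases ts) auto
  have "decr_weight (\<lambda>x. half_line t x * kernel_iter K (zip ns (map half_line ts')) x)"
    by (intro decr_weight_half_line decr_weight_kernel_iter)
  from decr_weight_mixing[OF this kN ab] show ?thesis
    by (simp add: ts fluctuation_def kernel_iter0_def[abs_def])
qed

text \<open>A nonincreasing density of mass \<open>r\<close> is at most \<open>r / x\<close> at \<open>x\<close>. This bound does not depend on the
  thresholds, which is what allows the supremum inside the integral.\<close>

lemma integral_max_fluctuation_bound:
  assumes l: "l \<noteq> 0" and kN: "k * (mixing_depth + N) \<le> n" and x: "0 < x" "x \<le> 1"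
  shows "(\<integral>z. max_fluctuation (n # ns) l z \<partial>\<nu>) \<le> tail_const * x powr (1 - \<gamma>) + coupling_bound k N * ln (1 / x)"
proof -
  define r where "r = coupling_bound k N"
  define S where "S = max_fluctuation (n # ns) l"
  have r: "0 \<le> r" using coupling_bound_pos[of k N] by (simp add: r_def)
  obtain h where h: "h \<in> borel_measurable unit_lebesgue" "\<And>x. 0 \<le> h x" "integrable unit_lebesgue h"
    "\<nu> = density unit_lebesgue (\<lambda>x. ennreal (h x))" using density_ex by blast
  have leb: "f \<in> borel_measurable unit_lebesgue" if "f \<in> borel_measurable \<nu>" for f :: "real \<Rightarrow> real"
    using that measurable_cong_sets[OF trans[OF sets_nu unit_borel_cong[symmetric]] refl] by auto
  have "AE z in lborel. z \<in> {x<..1} \<longrightarrow> \<bar>fluctuation (n # ns) ts z\<bar> * h z \<le> r / z" if ts: "length ts = l" for ts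
  proof -
    let ?f = "fluctuation (n # ns) ts"
    have inc: "\<bar>cdf_of \<nu> ?f b - cdf_of \<nu> ?f a\<bar> \<le> r * ln (b / a)" if "0 < a" "a \<le> b" "b \<le> 1" for a b
      unfolding r_def using ts l that by (intro fluctuation_increment kN) auto
    have neg: "cdf_of \<nu> (\<lambda>z. - ?f z) y = - cdf_of \<nu> ?f y" for y
      by (simp add: cdf_of_def)
    have "AE z in lborel. z \<in> {x<..1} \<longrightarrow> ?f z * h z \<le> r / z"
      by (rule AE_density_bound[OF h _ _ _ r x]) 
        (use inc fluctuation_bound[of _ "n # ns" ts] in \<open>auto simp: abs_le_iff\<close>)
    moreover have "AE z in lborel. z \<in> {x<..1} \<longrightarrow> - ?f z * h z \<le> r / z"
      by (rule AE_density_bound[OF h _ _ _ r x]) 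
        (use inc fluctuation_bound[of _ "n # ns" ts] in \<open>auto simp: abs_le_iff neg\<close>)
    ultimately show ?thesis
      by eventually_elim (auto simp: abs_if)
  qed
  then have "AE z in lborel. \<forall>ts\<in>{ts. length ts = l \<and> set ts \<subseteq> \<rat>}. z \<in> {x<..1} \<longrightarrow> \<bar>fluctuation (n # ns) ts z\<bar> * h z \<le> r / z"
    by (subst AE_ball_countable[OF countable_rational_lists]) auto
  then have S: "AE z in lborel. z \<in> {x<..1} \<longrightarrow> S z * h z \<le> r / z"
  proof eventually_elim
    case (elim z)
    show ?case
    proof
      assume z: "z \<in> {x<..1}"
      show "S z * h z \<le> r / z"
      \<comment> \<open>Where \<open>h\<close> does not vanish it is divided out, so that the
        supremum is taken of the fluctuations alone.\<close>
      proof (cases "h z = 0")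
        case False
        then have hz: "0 < h z" using h(2)[of z] by simp
        have z01: "z \<in> {0..1}" using z x by auto
        have "S z \<le> r / z / h z"
          unfolding S_def max_fluctuation_rational[OF z01]
          using elim z by (intro cSUP_least rational_lists_nonempty pos_le_divide_eq[THEN iffD2, OF hz]) blast
        then show ?thesis by (rule pos_le_divide_eq[THEN iffD1, OF hz])
      qed (use r z x in auto)
    qed
  qed
  have S01: "0 \<le> S z" "S z \<le> 1" if "z \<in> {0..1}" for z
    using max_fluctuation_range[OF that] by (auto simp: S_def)
  have Sm: "S \<in> borel_measurable unit_lebesgue" unfolding S_def by (intro leb max_fluctuation_measurable)
  have ind: "(indicator {..x} :: real \<Rightarrow> real) \<in> borel_measurable unit_lebesgue"
    by (intro borel_measurable_unit_lebesgue) auto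
  have hx: "integrable unit_lebesgue (\<lambda>z. h z * indicator {..x} z)"
  proof (rule Bochner_Integration.integrable_bound[OF h(3)])
    show "(\<lambda>z. h z * indicator {..x} z) \<in> borel_measurable unit_lebesgue"
      by (rule borel_measurable_times[OF h(1) ind])
  qed (auto simp: indicator_def)
  have hl: "integrable lborel (\<lambda>z. indicator {0..1} z * (h z * indicator {..x} z))"
    using hx by (subst (asm) integrable_restrict_space) auto
  have rl: "integrable lborel (\<lambda>z. r * (1 / z * indicator {x<..1} z))"
    by (intro integrable_mult_right integral_inverse_Ioc x)
  have Sh: "integrable unit_lebesgue (\<lambda>z. h z * S z)"
    by (rule Bochner_Integration.integrable_bound[OF h(3)])
      (use h S01 Sm in \<open>auto simp: space_restrict_space abs_mult mult_left_le\<close>)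
  have "(\<integral>z. S z \<partial>\<nu>) = (\<integral>z. h z * S z \<partial>unit_lebesgue)"
    using h Sm by (subst h(4), subst integral_density) auto
  also have "\<dots> = (\<integral>z. indicator {0..1} z * (h z * S z) \<partial>lborel)"
    by (subst integral_restrict_space) auto
  \<comment> \<open>Up to x the supremum is bounded by 1, which leaves the \<nu>-mass of
    \<open>{0..x}\<close>; beyond x the bound r / z takes over.\<close>
  also have "\<dots> \<le> (\<integral>z. indicator {0..1} z * (h z * indicator {..x} z) + r * (1 / z * indicator {x<..1} z) \<partial>lborel)"
  proof (rule integral_mono_AE)
    show "integrable lborel (\<lambda>z. indicator {0..1} z * (h z * S z))"
      using Sh by (subst (asm) integrable_restrict_space) auto
    show "integrable lborel (\<lambda>z. indicator {0..1} z * (h z * indicator {..x} z) + r * (1 / z * indicator {x<..1} z))"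
      by (rule Bochner_Integration.integrable_add[OF hl rl])
    show "AE z in lborel. indicator {0..1} z * (h z * S z) 
        \<le> indicator {0..1} z * (h z * indicator {..x} z) + r * (1 / z * indicator {x<..1} z)"
      using S
    proof eventually_elim
      case (elim z)
      consider "z \<notin> {0..1}" | "z \<in> {0..x}" | "z \<in> {x<..1}" by force
      then show ?case
      proof cases
        case 2
        then have "h z * S z \<le> h z" using S01[of z] h(2)[of z] x by (auto intro: mult_left_le)
        then show ?thesis using 2 x by (auto simp: indicator_def)
      next
        case 3
        then show ?thesis using elim x by (auto simp: indicator_def mult.commute)
      qed (use x in \<open>auto simp: indicator_def\<close>)
    qed
  qed
  also have "\<dots> = (\<integral>z. indicator {0..1} z * (h z * indicator {..x} z) \<partial>lborel) + (\<integral>z. r * (1 / z * indicator {x<..1} z) \<partial>lborel)"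
    by (rule Bochner_Integration.integral_add[OF hl rl])
  also have "(\<integral>z. indicator {0..1} z * (h z * indicator {..x} z) \<partial>lborel) = (\<integral>z. h z * indicator {..x} z \<partial>unit_lebesgue)"
    by (subst integral_restrict_space) auto
  also have "\<dots> = inv_cdf x"
    unfolding cdf_of_def mult_1 using h(1,2) ind by (subst h(4), subst integral_density) auto
  also have "(\<integral>z. r * (1 / z * indicator {x<..1} z) \<partial>lborel) = r * ln (1 / x)"
    by (simp only: integral_mult_right_zero integral_inverse_Ioc(2)[OF x])
  finally show ?thesis using decr_cdfD(5)[OF decr_cdf_inv, of x] x by (simp add: S_def r_def)
qed

end

section \<open>The coefficients\<close>

context lsv_kernel begin

lemma length_1_lists: "{ts :: real list. length ts = 1} = range (\<lambda>t. [t])"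
  by (auto simp: length_Suc_conv)

text \<open>The coefficients of order one subtract the mean of the indicator itself; it equals the
  mean of its n-th iterate since \<open>push\<close> keeps the value at 1.\<close>

lemma fluctuation_single:
  "fluctuation [n] [t] x = (kernel_op K ^^ n) (half_line t) x - (\<integral>y. half_line t y \<partial>\<nu>)"
proof -
  have "(\<integral>y. (kernel_op K ^^ n) (half_line t) y \<partial>\<nu>) = (\<integral>y. half_line t y \<partial>\<nu>)"
    using cdf_of_kernel_op_iter[OF unit_valued_half_line, of 1 n t] by (simp add: cdf_of_1 push_iter_1)
  then show ?thesis by (simp add: fluctuation_def kernel_iter0_def)
qed

lemma alpha1_coeff_eq:
  "alpha1_coeff \<nu> K n = (SUP ts\<in>{ts. length ts = 1}. \<integral>x. \<bar>fluctuation [n] ts x\<bar> \<partial>\<nu>)"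
  by (simp add: alpha1_coeff_def length_1_lists image_image fluctuation_single del: One_nat_def)

lemma beta1_coeff_eq: "beta1_coeff \<nu> K n = (\<integral>x. max_fluctuation [n] 1 x \<partial>\<nu>)"
  by (simp add: beta1_coeff_def max_fluctuation_def[abs_def] length_1_lists image_image fluctuation_single del: One_nat_def)

lemma alpha_coeff_eq:
  "alpha_coeff \<nu> K k n = (if k < 2 then alpha1_coeff \<nu> K n else max (alpha1_coeff \<nu> K n)
     (SUP l\<in>{2..k}. SUP ns\<in>{ns. length ns = l - 1 \<and> (\<forall>m\<in>set ns. 1 \<le> m)}.
        SUP ts\<in>{ts. length ts = l}. \<integral>x. \<bar>fluctuation (n # ns) ts x\<bar> \<partial>\<nu>))"
  by (simp only: alpha_coeff_def fluctuation_def)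

lemma beta_coeff_eq:
  "beta_coeff \<nu> K k n = (if k < 2 then beta1_coeff \<nu> K n else max (beta1_coeff \<nu> K n)
     (SUP l\<in>{2..k}. SUP ns\<in>{ns. length ns = l - 1 \<and> (\<forall>m\<in>set ns. 1 \<le> m)}.
        \<integral>x. max_fluctuation (n # ns) l x \<partial>\<nu>))"
  by (simp only: beta_coeff_def fluctuation_def max_fluctuation_def)

lemma SUP_fluctuation_le:
  "(SUP ts\<in>{ts. length ts = l}. \<integral>x. \<bar>fluctuation ns ts x\<bar> \<partial>\<nu>) \<le> (\<integral>x. max_fluctuation ns l x \<partial>\<nu>)"
  by (intro cSUP_least lists_nonempty integral_fluctuation_le) auto

lemma index_lists_nonempty: "{ns :: nat list. length ns = l \<and> (\<forall>m\<in>set ns. 1 \<le> m)} \<noteq> {}"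
  by (auto intro!: exI[of _ "replicate l 1"])

text \<open>The comparison is made for each l and each list of times; the bound 1 on every integral
  supplies the boundedness that real suprema require.\<close>

lemma alpha_coeff_le_beta_coeff: "alpha_coeff \<nu> K k n \<le> beta_coeff \<nu> K k n"
proof -
  have 1: "alpha1_coeff \<nu> K n \<le> beta1_coeff \<nu> K n"
    unfolding alpha1_coeff_eq beta1_coeff_eq by (rule SUP_fluctuation_le)
  let ?N = "\<lambda>l. {ns :: nat list. length ns = l - 1 \<and> (\<forall>m\<in>set ns. 1 \<le> m)}"
  have "(SUP l\<in>{2..k}. SUP ns\<in>?N l. SUP ts\<in>{ts. length ts = l}. \<integral>x. \<bar>fluctuation (n # ns) ts x\<bar> \<partial>\<nu>)
      \<le> (SUP l\<in>{2..k}. SUP ns\<in>?N l. \<integral>x. max_fluctuation (n # ns) l x \<partial>\<nu>)" if k: "2 \<le> k"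
  proof (rule cSUP_mono)
    have "(SUP ns\<in>?N l. \<integral>x. max_fluctuation (n # ns) l x \<partial>\<nu>) \<le> 1" for l
      by (intro cSUP_least index_lists_nonempty integral_max_fluctuation_le_1)
    then show "bdd_above ((\<lambda>l. SUP ns\<in>?N l. \<integral>x. max_fluctuation (n # ns) l x \<partial>\<nu>) ` {2..k})"
      by (intro bdd_aboveI2[where M = 1])
    fix l assume l: "l \<in> {2..k}"
    have "(SUP ns\<in>?N l. SUP ts\<in>{ts. length ts = l}. \<integral>x. \<bar>fluctuation (n # ns) ts x\<bar> \<partial>\<nu>)
        \<le> (SUP ns\<in>?N l. \<integral>x. max_fluctuation (n # ns) l x \<partial>\<nu>)"
    proof (rule cSUP_mono[OF index_lists_nonempty])
      show "bdd_above ((\<lambda>ns. \<integral>x. max_fluctuation (n # ns) l x \<partial>\<nu>) ` ?N l)"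
        by (intro bdd_aboveI2[where M = 1] integral_max_fluctuation_le_1)
    qed (use SUP_fluctuation_le in blast)
    then show "\<exists>m\<in>{2..k}. (SUP ns\<in>?N l. SUP ts\<in>{ts. length ts = l}. \<integral>x. \<bar>fluctuation (n # ns) ts x\<bar> \<partial>\<nu>)
        \<le> (SUP ns\<in>?N m. \<integral>x. max_fluctuation (n # ns) m x \<partial>\<nu>)"
      using l by blast
  qed (use k in auto)
  then show ?thesis using 1 by (auto simp: alpha_coeff_eq beta_coeff_eq intro: max.mono)
qed

text \<open>A bound uniform in l and in the list of times serves every k.\<close>

lemma beta_coeff_le:
  assumes "\<And>l ns. l \<noteq> 0 \<Longrightarrow> (\<integral>x. max_fluctuation (n # ns) l x \<partial>\<nu>) \<le> B"
  shows "beta_coeff \<nu> K k n \<le> B"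
proof -
  have "(SUP l\<in>{2..k}. SUP ns\<in>{ns. length ns = l - 1 \<and> (\<forall>m\<in>set ns. 1 \<le> m)}.
        \<integral>x. max_fluctuation (n # ns) l x \<partial>\<nu>) \<le> B" if "2 \<le> k"
    using that by (intro cSUP_least index_lists_nonempty assms) auto
  moreover have "beta1_coeff \<nu> K n \<le> B" unfolding beta1_coeff_eq by (rule assms) simp
  ultimately show ?thesis by (simp add: beta_coeff_eq)
qed

text \<open>The points of \<open>{0..cusp_seq (Suc n)}\<close> stay in \<open>{0..1/2}\<close> for \<open>n\<close> steps, so the indicator of this
  interval and that of \<open>{1/2<..1}\<close> after \<open>n\<close> steps have disjoint supports.\<close>

lemma alpha1_coeff_ge: "inv_cdf (cusp_seq (Suc n)) * (1 - inv_cdf (1/2)) \<le> alpha1_coeff \<nu> K n"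
proof -
  define t where "t = cusp_seq (Suc n)"
  have t: "t \<in> {0..1}" by (simp only: t_def cusp_seq_range)
  let ?\<phi> = "(kernel_op K ^^ n) (half_line t)"
  have "decr_weight (\<lambda>x. half_line t x * 1)" by (intro decr_weight_half_line decr_weight_1)
  then have u: "unit_valued (half_line t)" and F: "decr_cdf (cdf_of \<nu> (half_line t))"
    by (simp_all add: decr_weight_def)
  have Ft: "cdf_of \<nu> (half_line t) x = inv_cdf (min x t)" for x
    unfolding cdf_of_def by (intro Bochner_Integration.integral_cong) (auto simp: half_line_def indicator_def)
  have K1: "cdf_of \<nu> ?\<phi> 1 = inv_cdf t"
    using cdf_of_kernel_op_iter[OF u, of 1 n] t by (simp add: push_iter_1 Ft)
  \<comment> \<open>The left branch alone already carries the mass below the m-th preimage of x into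
    \<open>{0..x}\<close>.\<close>
  have grow: "F ((preim ^^ m) x) \<le> (push ^^ m) F x" if "decr_cdf F" "x \<in> {0..1}" for F m x
    using that(2)
  proof (induction m arbitrary: x)
    case (Suc m)
    have "F ((preim ^^ Suc m) x) \<le> (push ^^ m) F (preim x)"
      using Suc.IH[of "preim x"] preim_range[OF Suc.prems] by (simp add: funpow_swap1)
    also have "\<dots> \<le> push ((push ^^ m) F) x"
      using decr_cdf_mono[OF decr_cdf_push_iter[OF that(1), of m], of "1/2" "(1 + x) / 2"] Suc.prems 
      by (simp add: push_def)
    finally show ?case by simp
  qed simp
  have "inv_cdf t \<le> cdf_of \<nu> ?\<phi> (1/2)"
  proof -
    \<comment> \<open>The point 1/2 is itself the first preimage of 1, which accounts for
      \<open>Suc n\<close>.\<close>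
    have "(preim ^^ n) (1/2) = t" by (simp add: t_def cusp_seq_def funpow_swap1 flip: preim_1)
    then show ?thesis using grow[OF F, of "1/2" n] cdf_of_kernel_op_iter[OF u, of "1/2" n] by (simp add: Ft)
  qed
  moreover have "cdf_of \<nu> ?\<phi> (1/2) \<le> inv_cdf t"
    using decr_weight_kernel_op_iter[OF \<open>decr_weight (\<lambda>x. half_line t x * 1)\<close>, of n] 
      decr_cdf_mono[of "cdf_of \<nu> ?\<phi>" "1/2" 1] K1 by (simp add: decr_weight_def)
  ultimately have K2: "cdf_of \<nu> ?\<phi> (1/2) = inv_cdf t" by simp
  define \<zeta> where "\<zeta> = fluctuation [n] [t]"
  have \<zeta>: "\<zeta> x = ?\<phi> x - inv_cdf t" for x
    using Ft[of 1] t by (simp add: \<zeta>_def fluctuation_single flip: cdf_of_1)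
  have int: "integrable \<nu> (\<lambda>z. f z * indicator {..y} z)" if "unit_valued f" for f y
    using unit_valued_integrable[OF unit_valued_mult[OF that unit_valued_half_line[of y]]] by (simp add: half_line_def)
  have cdf\<zeta>: "cdf_of \<nu> \<zeta> y = cdf_of \<nu> ?\<phi> y - inv_cdf t * inv_cdf y" for y
    using int[OF unit_valued_kernel_op_iter[OF u], of n y] int[OF unit_valued_1, of y]
    by (simp add: cdf_of_def \<zeta> left_diff_distrib mult.assoc)
  have int\<zeta>: "integrable \<nu> (\<lambda>z. \<zeta> z * indicator {..1/2} z)"
    using int[OF unit_valued_kernel_op_iter[OF u], of n "1/2"] int[OF unit_valued_1, of "1/2"]
    by (simp add: \<zeta> left_diff_distrib)
  \<comment> \<open>As \<zeta> has mean 0, integrating over the left half instead of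
    \<open>{1/2<..1}\<close> only changes the sign.\<close>
  have "inv_cdf t * (1 - inv_cdf (1/2)) = cdf_of \<nu> \<zeta> (1/2)"
    by (simp add: cdf\<zeta> K2 right_diff_distrib)
  also have "\<dots> \<le> (\<integral>x. \<bar>\<zeta> x\<bar> \<partial>\<nu>)"
    unfolding cdf_of_def using int\<zeta> integrable_fluctuation[of "[n]" "[t]"]
    by (intro integral_mono) (auto simp: \<zeta>_def indicator_def)
  also have "\<dots> \<le> alpha1_coeff \<nu> K n"
    unfolding alpha1_coeff_eq \<zeta>_def
    by (intro cSUP_upper bdd_aboveI2[where M = 1] order_trans[OF integral_fluctuation_le integral_max_fluctuation_le_1]) auto
  finally show ?thesis by (simp add: t_def)
qed

lemma alpha_coeff_ge: "inv_cdf (cusp_seq (Suc n)) * (1 - inv_cdf (1/2)) \<le> alpha_coeff \<nu> K k n"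
  using alpha1_coeff_ge[of n] by (auto simp: alpha_coeff_def)

end

theorem theorem3p1:
  fixes \<gamma> :: real
  assumes "0 < \<gamma>" and "\<gamma> < 1"
  shows "\<exists>(C1::real) (C2 :: real \<Rightarrow> nat \<Rightarrow> real).
    0 < C1 \<and> (\<forall>\<delta> k. 0 < C2 \<delta> k) \<and>
    (\<forall>(\<nu> :: real measure) (K :: real \<Rightarrow> real measure) (M :: 'w measure) (X :: nat \<Rightarrow> 'w \<Rightarrow> real).
       lsv_acim \<gamma> \<nu> \<longrightarrow>
       perron_frobenius_kernel (lsv_map \<gamma>) \<nu> K \<longrightarrow>
       stationary_markov_chain M X \<nu> K \<longrightarrow>
       (\<forall>\<delta> (k::nat) (n::nat). 0 < \<delta> \<longrightarrow> \<delta> < (1 - \<gamma>) / \<gamma> \<longrightarrow> 1 \<le> k \<longrightarrow>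
          C1 * (real n + 1) powr ((\<gamma> - 1) / \<gamma>) \<le> alpha_coeff \<nu> K k n \<and>
          alpha_coeff \<nu> K k n \<le> beta_coeff \<nu> K k n \<and>
          beta_coeff \<nu> K k n \<le> C2 \<delta> k * (real n + 1) powr ((\<gamma> - 1) / \<gamma> + \<delta>)))"
proof -
  interpret lsv \<gamma> using assms by unfold_locales
  obtain C1 where C1: "C1 > 0" and lower: "\<And>F n. decr_cdf F \<Longrightarrow> F 1 = 1 \<Longrightarrow> (\<forall>x\<in>{0..1}. push F x = F x) \<Longrightarrow>
      C1 * (real n + 1) powr ((\<gamma> - 1) / \<gamma>) \<le> F (cusp_seq (Suc n)) * (1 - F (1/2))"
    using invariant_cdf_lower by blast
  \<comment> \<open>Positivity is asserted for every real \<delta>; where \<delta> is not positive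
    the witness is 1.\<close>
  have "\<forall>\<delta>. \<exists>C>0. 0 < \<delta> \<longrightarrow> (\<forall>n. \<exists>k N x. k * (mixing_depth + N) \<le> n \<and> 0 < x \<and> x \<le> 1 \<and>
      tail_const * x powr (1 - \<gamma>) + coupling_bound k N * ln (1 / x) \<le> C * (real n + 1) powr ((\<gamma> - 1) / \<gamma> + \<delta>))"
    (is "\<forall>\<delta>. \<exists>C>0. ?Q \<delta> C")
  proof
    fix \<delta> show "\<exists>C>0. ?Q \<delta> C"
      using dependence_bound_rate[of \<delta>] by (cases "0 < \<delta>") (auto intro: exI[of _ 1])
  qed
  then obtain C where C: "\<And>\<delta>. C \<delta> > 0" "\<And>\<delta>. ?Q \<delta> (C \<delta>)" by metis
  show ?thesis
  proof (intro exI[of _ C1] exI[of _ "\<lambda>\<delta> _. C \<delta>"] conjI allI impI)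
    fix \<nu> :: "real measure" and K :: "real \<Rightarrow> real measure" and \<delta> :: real and k n :: nat
    assume "lsv_acim \<gamma> \<nu>" "perron_frobenius_kernel (lsv_map \<gamma>) \<nu> K" and \<delta>: "0 < \<delta>"
    then interpret lsv_kernel \<gamma> \<nu> K by unfold_locales
    show "C1 * (real n + 1) powr ((\<gamma> - 1) / \<gamma>) \<le> alpha_coeff \<nu> K k n"
      using lower[OF decr_cdf_inv inv_cdf_1, of n] push_inv_cdf alpha_coeff_ge[of n k] by (meson order_trans)
    show "alpha_coeff \<nu> K k n \<le> beta_coeff \<nu> K k n" by (rule alpha_coeff_le_beta_coeff)
    obtain j N x where b: "j * (mixing_depth + N) \<le> n" "0 < x" "x \<le> 1"
      "tail_const * x powr (1 - \<gamma>) + coupling_bound j N * ln (1 / x) \<le> C \<delta> * (real n + 1) powr ((\<gamma> - 1) / \<gamma> + \<delta>)"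
      using C(2)[of \<delta>] \<delta> by blast
    show "beta_coeff \<nu> K k n \<le> C \<delta> * (real n + 1) powr ((\<gamma> - 1) / \<gamma> + \<delta>)"
      using integral_max_fluctuation_bound[OF _ b(1-3)] b(4) by (intro beta_coeff_le) (meson order_trans)
  qed (use C1 C in auto)
qed

end
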